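(* Let $(M^n,g)$ be a closed, connected, oriented, $C^\infty$ Riemannian $n$-manifold with a transversely oriented codimension-$q$ foliation $\mathbf{F}$. If $\kappa\wedge\chi_{\mathbf F}$ is a closed (possibly zero) $(p+1)$-form, then for all (local) basic vector fields $X,Y$ the vector field $\mathcal{V}[X,Y]$ has vanishing leaf divergence, i.e. $\operatorname{div}_{\mathbf F}\mathcal{V}[X,Y]=0$ (equivalently, $\kappa$ is horizontally closed). Moreover, if $q=2$, then $\kappa$ is horizontally closed if and only if $\kappa\wedge\chi_{\mathbf F}$ is closed.
   Context: All objects are $C^\infty$. A closed manifold is compact without boundary. $\mathbf F$ has leaf dimension $p\ge 1$ and codimension $q\ge 1$, with $p+q=n$. $\mathbf V\subset TM$ is the distribution tangent to $\mathbf F$ and $\mathbf H=\mathbf V^{\perp}$ its $g$-orthogonal complement; $\mathcal V E$ and $\mathcal H E$ denote the projections of a vector field $E$ to $\mathbf V$ and $\mathbf H$. $E$ is vertical if $\mathcal V E=E$, horizontal if $\mathcal H E=E$. A (local) basic vector field is a horizontal vector field on an open set which projects to a well-defined vector field under the local submersions defining $\mathbf F$. $D$ is the Levi-Civita connection of $g$. Let $\{V_1,\dots,V_p\}$ be a positively oriented local orthonormal frame of $\mathbf V$ ($\mathbf V$ is oriented since $M$ is oriented and $\mathbf F$ is transversely oriented). The mean curvature one-form is $\kappa(E)=\sum_{i=1}^p g(E,\mathcal H D_{V_i}V_i)$. The characteristic form of $\mathbf F$ is the $p$-form $\chi_{\mathbf F}(E_1,\dots,E_p)=\det\big(g(E_i,V_j)\big)$.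 $\kappa$ is horizontally closed if $d\kappa(Z_1,Z_2)=0$ for all horizontal vector fields $Z_1,Z_2$. For a vertical vector field $W$, the leaf divergence is $\operatorname{div}_{\mathbf F}W=\sum_{i=1}^p g(D_{V_i}W,V_i)$. *)

theory Defs
  imports "HOL-Analysis.Analysis" "Jordan_Normal_Form.Determinant"
begin

section \<open>Smooth maps between open subsets of Euclidean spaces\<close>

primrec Ck_on :: "nat \<Rightarrow> 'a::real_normed_vector set \<Rightarrow> ('a \<Rightarrow> 'b::real_normed_vector) \<Rightarrow> bool" where
  "Ck_on 0 S f \<longleftrightarrow> continuous_on S f"
| "Ck_on (Suc k) S f \<longleftrightarrow> (\<forall>x\<in>S. f differentiable (at x)) \<and>
     (\<forall>v. Ck_on k S (\<lambda>x. frechet_derivative f (at x) v))"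

definition smooth_on :: "'a::real_normed_vector set \<Rightarrow> ('a \<Rightarrow> 'b::real_normed_vector) \<Rightarrow> bool" where
  "smooth_on S f \<longleftrightarrow> (\<forall>k. Ck_on k S f)"

definition diffeo_onto_open :: "'a::real_normed_vector set \<Rightarrow> ('a \<Rightarrow> 'b::real_normed_vector) \<Rightarrow> bool" where
  "diffeo_onto_open P \<gamma> \<longleftrightarrow> open P \<and> open (\<gamma> ` P) \<and> inj_on \<gamma> P \<and>
     smooth_on P \<gamma> \<and> smooth_on (\<gamma> ` P) (inv_into P \<gamma>)"

definition jacobian :: "(real^'k \<Rightarrow> real^'k) \<Rightarrow> real^'k \<Rightarrow> real" where
  "jacobian \<gamma> y = Determinants.det (matrix (frechet_derivative \<gamma> (at y)))"


section \<open>Oriented smooth manifolds\<close>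

text \<open>The points of the manifold are all elements of a type \<open>'m\<close>.  A chart is a pair of an open
  domain and a coordinate map; the map is relevant on the domain only.\<close>

type_synonym ('m, 'n) chart = "'m set \<times> ('m \<Rightarrow> real^'n)"

definition smooth_atlas :: "('m::{t2_space,second_countable_topology}, 'n::finite) chart set \<Rightarrow> bool" where
  "smooth_atlas A \<longleftrightarrow> (\<Union>(W, c)\<in>A. W) = UNIV \<and>
     (\<forall>(W, c)\<in>A. open W \<and> open (c ` W) \<and> homeomorphism W (c ` W) c (inv_into W c)) \<and>
     (\<forall>(W, c)\<in>A. \<forall>(W', c')\<in>A. smooth_on (c ` (W \<inter> W')) (c' \<circ> inv_into W c))"

definition oriented_atlas :: "('m::{t2_space,second_countable_topology}, 'n::finite) chart set \<Rightarrow> bool" where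
  "oriented_atlas A \<longleftrightarrow> smooth_atlas A \<and>
     (\<forall>(W, c)\<in>A. \<forall>(W', c')\<in>A. \<forall>x\<in>W \<inter> W'. jacobian (c' \<circ> inv_into W c) (c x) > 0)"

definition smooth_map_on ::
  "('m::topological_space, 'n::finite) chart set \<Rightarrow> 'm set \<Rightarrow> ('m \<Rightarrow> 'b::real_normed_vector) \<Rightarrow> bool" where
  "smooth_map_on A U f \<longleftrightarrow> (\<forall>(W, c)\<in>A. smooth_on (c ` (U \<inter> W)) (f \<circ> inv_into W c))"

definition smooth_near ::
  "('m::topological_space, 'n::finite) chart set \<Rightarrow> 'm \<Rightarrow> ('m \<Rightarrow> real) \<Rightarrow> bool" where
  "smooth_near A x f \<longleftrightarrow> (\<exists>U. open U \<and> x \<in> U \<and> smooth_map_on A U f)"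


section \<open>Tangent vectors and vector fields\<close>

text \<open>A tangent vector at \<open>x\<close> is the directional derivative \<open>\<Sum>\<^sub>i v\<^sub>i \<partial>/\<partial>c\<^sub>i\<close> at \<open>x\<close>, acting on functions that
  are smooth near \<open>x\<close>.  As HOL functions are total, it is given the value 0 on all other functions,
  so that a tangent vector is determined by its action on smooth germs.\<close>

type_synonym 'm tvec = "('m \<Rightarrow> real) \<Rightarrow> real"
type_synonym 'm vfield = "'m \<Rightarrow> 'm tvec"

definition coord_vector ::
  "('m::topological_space, 'n::finite) chart set \<Rightarrow> ('m, 'n) chart \<Rightarrow> 'm \<Rightarrow> real^'n \<Rightarrow> 'm tvec" where
  "coord_vector A C x v = (\<lambda>f. if smooth_near A x f
     then frechet_derivative (f \<circ> inv_into (fst C) (snd C)) (at (snd C x)) v else 0)"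

definition tangent_space :: "('m::topological_space, 'n::finite) chart set \<Rightarrow> 'm \<Rightarrow> 'm tvec set" where
  "tangent_space A x = {coord_vector A C x v | C v. C \<in> A \<and> x \<in> fst C}"

text \<open>Vector fields on an open set \<open>U\<close>; the values outside \<open>U\<close> are irrelevant.\<close>

definition vector_field_on ::
  "('m::topological_space, 'n::finite) chart set \<Rightarrow> 'm set \<Rightarrow> 'm vfield \<Rightarrow> bool" where
  "vector_field_on A U X \<longleftrightarrow> (\<forall>x\<in>U. X x \<in> tangent_space A x) \<and>
     (\<forall>U' f. open U' \<and> U' \<subseteq> U \<and> smooth_map_on A U' f \<longrightarrow> smooth_map_on A U' (\<lambda>y. X y f))"

definition lie_bracket ::
  "('m::topological_space, 'n::finite) chart set \<Rightarrow> 'm vfield \<Rightarrow> 'm vfield \<Rightarrow> 'm vfield" where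
  "lie_bracket A X Y x = (\<lambda>f. if smooth_near A x f
     then X x (\<lambda>y. Y y f) - Y x (\<lambda>y. X y f) else 0)"


section \<open>Riemannian metrics and the Levi-Civita connection\<close>

type_synonym 'm metric = "'m \<Rightarrow> 'm tvec \<Rightarrow> 'm tvec \<Rightarrow> real"

definition riemannian_metric ::
  "('m::topological_space, 'n::finite) chart set \<Rightarrow> 'm metric \<Rightarrow> bool" where
  "riemannian_metric A g \<longleftrightarrow>
     (\<forall>x. \<forall>u\<in>tangent_space A x. \<forall>v\<in>tangent_space A x.
        g x u v = g x v u \<and>
        (u \<noteq> (\<lambda>f. 0) \<longrightarrow> g x u u > 0) \<and>
        (\<forall>w\<in>tangent_space A x. \<forall>a b. g x (\<lambda>f. a * u f + b * v f) w = a * g x u w + b * g x v w)) \<and>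
     (\<forall>U X Y. open U \<and> vector_field_on A U X \<and> vector_field_on A U Y
        \<longrightarrow> smooth_map_on A U (\<lambda>x. g x (X x) (Y x)))"

text \<open>\<open>D X Y\<close> is the covariant derivative of \<open>Y\<close> in direction \<open>X\<close>, for vector fields on arbitrary
  open sets.  The clauses say: \<open>D\<close> is an affine connection, it is torsion free, and it is metric.\<close>

definition levi_civita ::
  "('m::topological_space, 'n::finite) chart set \<Rightarrow> 'm metric \<Rightarrow>
   ('m vfield \<Rightarrow> 'm vfield \<Rightarrow> 'm vfield) \<Rightarrow> bool" where
  "levi_civita A g D \<longleftrightarrow>
     (\<forall>U X Y Z h. open U \<and> vector_field_on A U X \<and> vector_field_on A U Y \<and> vector_field_on A U Z
          \<and> smooth_map_on A U h \<longrightarrow>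
        vector_field_on A U (D X Y) \<and>
        (\<forall>x\<in>U.
           D (\<lambda>y f. X y f + Y y f) Z x = (\<lambda>f. D X Z x f + D Y Z x f) \<and>
           D (\<lambda>y f. h y * X y f) Z x = (\<lambda>f. h x * D X Z x f) \<and>
           D X (\<lambda>y f. Y y f + Z y f) x = (\<lambda>f. D X Y x f + D X Z x f) \<and>
           D X (\<lambda>y f. h y * Y y f) x = (\<lambda>f. X x h * Y x f + h x * D X Y x f) \<and>
           lie_bracket A X Y x = (\<lambda>f. D X Y x f - D Y X x f) \<and>
           X x (\<lambda>y. g y (Y y) (Z y)) = g x (D X Y x) (Z x) + g x (Y x) (D X Z x)))"


section \<open>Foliations\<close>

text \<open>A codimension \<open>q\<close> foliation is given by its family of local defining submersions
  \<open>s : U \<rightarrow> \<real>\<^sup>q\<close>, which near each point of an overlap differ by a local diffeomorphism of \<open>\<real>\<^sup>q\<close>.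
  The leaves are the maximal connected submanifolds locally contained in fibres of submersions.\<close>

type_synonym ('m, 'q) submersion = "'m set \<times> ('m \<Rightarrow> real^'q)"

definition differential :: "('m \<Rightarrow> real^'q) \<Rightarrow> 'm tvec \<Rightarrow> real^'q" where
  "differential s v = (\<chi> j. v (\<lambda>y. vec_nth (s y) j))"

definition transition_near ::
  "'m::topological_space \<Rightarrow> ('m, 'q::finite) submersion \<Rightarrow> ('m, 'q) submersion \<Rightarrow>
   (real^'q) set \<Rightarrow> (real^'q \<Rightarrow> real^'q) \<Rightarrow> bool" where
  "transition_near x S S' P \<gamma> \<longleftrightarrow> diffeo_onto_open P \<gamma> \<and>
     (\<exists>W. open W \<and> x \<in> W \<and> W \<subseteq> fst S \<inter> fst S' \<and> snd S ` W \<subseteq> P \<and> (\<forall>y\<in>W. snd S' y = \<gamma> (snd S y)))"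

definition foliation ::
  "('m::topological_space, 'n::finite) chart set \<Rightarrow> ('m, 'q::finite) submersion set \<Rightarrow> bool" where
  "foliation A F \<longleftrightarrow> (\<Union>(U, s)\<in>F. U) = UNIV \<and>
     (\<forall>(U, s)\<in>F. open U \<and> smooth_map_on A U s \<and>
        (\<forall>x\<in>U. differential s ` tangent_space A x = UNIV)) \<and>
     (\<forall>S\<in>F. \<forall>S'\<in>F. \<forall>x\<in>fst S \<inter> fst S'. \<exists>P \<gamma>. transition_near x S S' P \<gamma>)"

definition transversely_oriented ::
  "('m::topological_space, 'q::finite) submersion set \<Rightarrow> bool" where
  "transversely_oriented F \<longleftrightarrow>
     (\<forall>S\<in>F. \<forall>S'\<in>F. \<forall>x P \<gamma>. transition_near x S S' P \<gamma> \<longrightarrow> jacobian \<gamma> (snd S x) > 0)"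

definition vert_space ::
  "('m::topological_space, 'n::finite) chart set \<Rightarrow> ('m, 'q::finite) submersion set \<Rightarrow> 'm \<Rightarrow> 'm tvec set" where
  "vert_space A F x = {v \<in> tangent_space A x. \<forall>(U, s)\<in>F. x \<in> U \<longrightarrow> differential s v = 0}"

definition hor_space ::
  "('m::topological_space, 'n::finite) chart set \<Rightarrow> ('m, 'q::finite) submersion set \<Rightarrow> 'm metric \<Rightarrow>
   'm \<Rightarrow> 'm tvec set" where
  "hor_space A F g x = {v \<in> tangent_space A x. \<forall>w\<in>vert_space A F x. g x v w = 0}"

definition vert ::
  "('m::topological_space, 'n::finite) chart set \<Rightarrow> ('m, 'q::finite) submersion set \<Rightarrow> 'm metric \<Rightarrow>
   'm vfield \<Rightarrow> 'm vfield" where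
  "vert A F g E x = (THE u. u \<in> vert_space A F x \<and> (\<lambda>f. E x f - u f) \<in> hor_space A F g x)"

definition hor ::
  "('m::topological_space, 'n::finite) chart set \<Rightarrow> ('m, 'q::finite) submersion set \<Rightarrow> 'm metric \<Rightarrow>
   'm vfield \<Rightarrow> 'm vfield" where
  "hor A F g E x = (\<lambda>f. E x f - vert A F g E x f)"

definition horizontal_field_on ::
  "('m::topological_space, 'n::finite) chart set \<Rightarrow> ('m, 'q::finite) submersion set \<Rightarrow> 'm metric \<Rightarrow>
   'm set \<Rightarrow> 'm vfield \<Rightarrow> bool" where
  "horizontal_field_on A F g U E \<longleftrightarrow> vector_field_on A U E \<and> (\<forall>x\<in>U. hor A F g E x = E x)"

text \<open>Fibres of a submersion in \<open>F\<close> need not be connected, so projectability is asked for after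
  shrinking the domain of the submersion around each point.\<close>

definition basic_field_on ::
  "('m::topological_space, 'n::finite) chart set \<Rightarrow> ('m, 'q::finite) submersion set \<Rightarrow> 'm metric \<Rightarrow>
   'm set \<Rightarrow> 'm vfield \<Rightarrow> bool" where
  "basic_field_on A F g U X \<longleftrightarrow> horizontal_field_on A F g U X \<and>
     (\<forall>(U', s)\<in>F. \<forall>x\<in>U \<inter> U'. \<exists>W Xb. open W \<and> x \<in> W \<and> W \<subseteq> U \<inter> U' \<and>
        smooth_on (s ` W) Xb \<and> (\<forall>y\<in>W. differential s (X y) = Xb (s y)))"


section \<open>Induced orientation of the leaves, adapted frames\<close>

text \<open>The order of the coordinates of \<open>real^'k\<close> is the order of the index type.\<close>

definition coord_index :: "nat \<Rightarrow> 'k::{finite,linorder}" where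
  "coord_index i = sorted_list_of_set (UNIV :: 'k set) ! i"

definition positive_basis ::
  "('m::topological_space, 'n::{finite,linorder}) chart set \<Rightarrow> 'm \<Rightarrow> (nat \<Rightarrow> 'm tvec) \<Rightarrow> bool" where
  "positive_basis A x e \<longleftrightarrow> (\<exists>(W, c)\<in>A. x \<in> W \<and>
     Determinant.det (mat CARD('n) CARD('n) (\<lambda>(i, j). vec_nth (differential c (e i)) (coord_index j))) > 0)"

definition transversely_positive ::
  "('m::topological_space, 'q::{finite,linorder}) submersion set \<Rightarrow> 'm \<Rightarrow> (nat \<Rightarrow> 'm tvec) \<Rightarrow> bool" where
  "transversely_positive F x z \<longleftrightarrow> (\<exists>(U, s)\<in>F. x \<in> U \<and>
     Determinant.det (mat CARD('q) CARD('q) (\<lambda>(i, j). vec_nth (differential s (z i)) (coord_index j))) > 0)"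

text \<open>Orientation convention: leaf directions first, then the transverse directions.\<close>

definition leaf_positive ::
  "('m::topological_space, 'n::{finite,linorder}) chart set \<Rightarrow> ('m, 'q::{finite,linorder}) submersion set \<Rightarrow>
   nat \<Rightarrow> 'm \<Rightarrow> (nat \<Rightarrow> 'm tvec) \<Rightarrow> bool" where
  "leaf_positive A F p x v \<longleftrightarrow>
     (\<forall>z. (\<forall>i<CARD('q). z i \<in> tangent_space A x) \<and> transversely_positive F x z
        \<longrightarrow> positive_basis A x (\<lambda>i. if i < p then v i else z (i - p)))"

definition adapted_frame_on ::
  "('m::topological_space, 'n::{finite,linorder}) chart set \<Rightarrow> ('m, 'q::{finite,linorder}) submersion set \<Rightarrow>
   'm metric \<Rightarrow> nat \<Rightarrow> 'm set \<Rightarrow> (nat \<Rightarrow> 'm vfield) \<Rightarrow> bool" where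
  "adapted_frame_on A F g p U V \<longleftrightarrow> (\<forall>i<p. vector_field_on A U (V i)) \<and>
     (\<forall>x\<in>U. (\<forall>i<p. V i x \<in> vert_space A F x) \<and>
        (\<forall>i<p. \<forall>j<p. g x (V i x) (V j x) = (if i = j then 1 else 0)) \<and>
        leaf_positive A F p x (\<lambda>i. V i x))"

text \<open>A choice of positively oriented local orthonormal frame of the vertical distribution near \<open>x\<close>.
  The objects defined from it below do not depend on the choice.\<close>

definition frame_near ::
  "('m::topological_space, 'n::{finite,linorder}) chart set \<Rightarrow> ('m, 'q::{finite,linorder}) submersion set \<Rightarrow>
   'm metric \<Rightarrow> nat \<Rightarrow> 'm \<Rightarrow> nat \<Rightarrow> 'm vfield" where
  "frame_near A F g p x = (SOME V. \<exists>U. open U \<and> x \<in> U \<and> adapted_frame_on A F g p U V)"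


section \<open>Mean curvature form, characteristic form, leaf divergence\<close>

definition mean_curvature ::
  "('m::topological_space, 'n::{finite,linorder}) chart set \<Rightarrow> ('m, 'q::{finite,linorder}) submersion set \<Rightarrow>
   'm metric \<Rightarrow> ('m vfield \<Rightarrow> 'm vfield \<Rightarrow> 'm vfield) \<Rightarrow> nat \<Rightarrow> 'm \<Rightarrow> 'm tvec \<Rightarrow> real" where
  "mean_curvature A F g D p x e =
     (let V = frame_near A F g p x in \<Sum>i<p. g x e (hor A F g (D (V i) (V i)) x))"

definition leaf_div ::
  "('m::topological_space, 'n::{finite,linorder}) chart set \<Rightarrow> ('m, 'q::{finite,linorder}) submersion set \<Rightarrow>
   'm metric \<Rightarrow> ('m vfield \<Rightarrow> 'm vfield \<Rightarrow> 'm vfield) \<Rightarrow> nat \<Rightarrow> 'm vfield \<Rightarrow> 'm \<Rightarrow> real" where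
  "leaf_div A F g D p W x =
     (let V = frame_near A F g p x in \<Sum>i<p. g x (D (V i) W x) (V i x))"

text \<open>A \<open>k\<close>-form is evaluated at \<open>x\<close> on a tuple indexed by naturals, of which the entries
  \<open>0, \<dots>, k - 1\<close> matter.\<close>

type_synonym 'm form = "'m \<Rightarrow> (nat \<Rightarrow> 'm tvec) \<Rightarrow> real"

definition characteristic_form ::
  "('m::topological_space, 'n::{finite,linorder}) chart set \<Rightarrow> ('m, 'q::{finite,linorder}) submersion set \<Rightarrow>
   'm metric \<Rightarrow> nat \<Rightarrow> 'm form" where
  "characteristic_form A F g p x e =
     (let V = frame_near A F g p x in Determinant.det (mat p p (\<lambda>(i, j). g x (e i) (V j x))))"


section \<open>Exterior calculus\<close>

definition omit :: "nat \<Rightarrow> (nat \<Rightarrow> 'a) \<Rightarrow> nat \<Rightarrow> 'a" where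
  "omit i e = (\<lambda>j. if j < i then e j else e (Suc j))"

text \<open>The wedge product of a 1-form with a \<open>k\<close>-form.\<close>

definition wedge1 :: "nat \<Rightarrow> ('m \<Rightarrow> 'm tvec \<Rightarrow> real) \<Rightarrow> 'm form \<Rightarrow> 'm form" where
  "wedge1 k \<alpha> \<omega> x e = (\<Sum>i\<le>k. (-1) ^ i * \<alpha> x (e i) * \<omega> x (omit i e))"

text \<open>The exterior derivative of a \<open>k\<close>-form, evaluated on vector fields \<open>E 0, \<dots>, E k\<close>:
  \<open>\<Sum>\<^sub>i (-1)\<^sup>i E\<^sub>i(\<omega>(\<dots>,\<^bold>\<not>E\<^sub>i,\<dots>)) + \<Sum>\<^sub>i\<^sub><\<^sub>j (-1)\<^sup>i\<^sup>+\<^sup>j \<omega>([E\<^sub>i,E\<^sub>j],\<dots>,\<^bold>\<not>E\<^sub>i,\<dots>,\<^bold>\<not>E\<^sub>j,\<dots>)\<close>, where the entries marked \<open>\<^bold>\<not>\<close>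
  are omitted.\<close>

definition ext_deriv ::
  "('m::topological_space, 'n::finite) chart set \<Rightarrow> nat \<Rightarrow> 'm form \<Rightarrow> (nat \<Rightarrow> 'm vfield) \<Rightarrow> 'm \<Rightarrow> real" where
  "ext_deriv A k \<omega> E x =
     (\<Sum>i\<le>k. (-1) ^ i * E i x (\<lambda>y. \<omega> y (\<lambda>l. omit i E l y))) +
     (\<Sum>j\<le>k. \<Sum>i<j. (-1) ^ (i + j) *
        \<omega> x (case_nat (lie_bracket A (E i) (E j) x) (\<lambda>l. omit i (omit j E) l x)))"

definition closed_form ::
  "('m::topological_space, 'n::finite) chart set \<Rightarrow> nat \<Rightarrow> 'm form \<Rightarrow> bool" where
  "closed_form A k \<omega> \<longleftrightarrow> (\<forall>U E. open U \<and> (\<forall>i\<le>k. vector_field_on A U (E i))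
     \<longrightarrow> (\<forall>x\<in>U. ext_deriv A k \<omega> E x = 0))"

definition horizontally_closed ::
  "('m::topological_space, 'n::finite) chart set \<Rightarrow> ('m, 'q::finite) submersion set \<Rightarrow> 'm metric \<Rightarrow>
   ('m \<Rightarrow> 'm tvec \<Rightarrow> real) \<Rightarrow> bool" where
  "horizontally_closed A F g \<alpha> \<longleftrightarrow>
     (\<forall>U Z1 Z2. open U \<and> horizontal_field_on A F g U Z1 \<and> horizontal_field_on A F g U Z2
        \<longrightarrow> (\<forall>x\<in>U. ext_deriv A 1 (\<lambda>y e. \<alpha> y (e 0)) (\<lambda>i. if i = 0 then Z1 else Z2) x = 0))"

end

theory Submission
  imports Defs
begin

text \<open>
  Let \<open>V\<^sub>1, \<dots>, V\<^sub>p\<close> be a local orthonormal frame of the leaves and \<open>Z\<close> a horizontal field.  Differentiating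
  \<open>g(Z, V\<^sub>i) = 0\<close> along \<open>V\<^sub>i\<close> gives \<open>\<kappa>(Z) = - \<Sum> g(D V\<^sub>i Z, V\<^sub>i)\<close>, and since the connection is torsion free and
  \<open>g(V\<^sub>i, V\<^sub>i)\<close> is constant, this equals \<open>\<Sum> g([Z, V\<^sub>i], V\<^sub>i)\<close>: the mean curvature of \<open>Z\<close> is the trace of the
  operator \<open>[Z, _]\<close> in the leaf directions (\<open>kappa_horizontal\<close>, \<open>bracket_trace\<close>).

  For basic \<open>X\<close> and \<open>Y\<close> the operators \<open>[X, _]\<close> and \<open>[Y, _]\<close> map vertical fields to vertical fields.  By the Jacobi
  identity, and because a commutator of matrices has trace 0, the trace of \<open>[[X, Y], _]\<close> is
  \<open>X \<kappa>(Y) - Y \<kappa>(X)\<close> (\<open>bracket_trace_basic\<close>).  Split \<open>[X, Y]\<close> into its vertical part \<open>W\<close> and its horizontal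
  part: the same trace is \<open>\<kappa>([X, Y]) - div W\<close>.  Hence \<open>d\<kappa>(X, Y) = - div W\<close> (\<open>dkappa_basic\<close>).  As \<open>d\<kappa>\<close> is
  linear over functions and every horizontal field is locally a combination of basic ones, the leaf divergences
  vanish for all basic fields if and only if \<open>\<kappa>\<close> is horizontally closed (\<open>divergence_free_iff\<close>).

  Now let \<open>\<omega> = \<kappa> \<and> \<chi>\<close>.  The form \<open>\<kappa>\<close> kills vertical vectors and \<open>\<chi>\<close> kills horizontal ones, so few summands
  of \<open>d\<omega>(X, Y, V\<^sub>1, \<dots>, V\<^sub>p)\<close> are left, and these add up to \<open>d\<kappa>(X, Y)\<close> (\<open>ext_deriv_omega_basic\<close>).  So
  \<open>d\<omega> = 0\<close> implies \<open>d\<kappa>(X, Y) = 0\<close>.  If \<open>q = 2\<close>, then \<open>d\<omega>\<close> is a form of top degree, it is determined by its value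
  on one frame \<open>X, Y, V\<^sub>1, \<dots>, V\<^sub>p\<close> with basic \<open>X\<close> and \<open>Y\<close>, and the converse follows
  (\<open>horizontally_closed_imp_closed\<close>).

  Two bodies of preparation are needed.  Near every point there are a positively oriented orthonormal vertical
  frame and horizontal lifts of the coordinate fields of the leaf space, which are basic
  (\<open>adapted_frame_exists\<close>, \<open>horizontal_lifts_basic\<close>), and \<open>\<kappa>\<close> and \<open>\<chi>\<close>, which are defined by choosing a frame at each
  point, can be computed in any such frame.  And the invariant formula for the exterior derivative
  is shown to be alternating and linear over functions (\<open>ext_deriv_adj_swap\<close>, \<open>ext_deriv_linear\<close>).
\<close>

section \<open>Calculus of smooth maps on open sets\<close>

lemma frechet_derivative_cong:
  assumes "open S" "x \<in> S" "\<And>y. y \<in> S \<Longrightarrow> f y = g y"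
  shows "frechet_derivative f (at x) = frechet_derivative g (at x)"
proof -
  have "(f has_derivative f') (at x) \<longleftrightarrow> (g has_derivative f') (at x)" for f'
    using assms has_derivative_transform_within_open[of f f' x UNIV S g]
      has_derivative_transform_within_open[of g f' x UNIV S f] by metis
  then show ?thesis unfolding frechet_derivative_def by simp
qed

lemma differentiable_cong:
  assumes "open S" "x \<in> S" "\<And>y. y \<in> S \<Longrightarrow> f y = g y" "f differentiable (at x)"
  shows "g differentiable (at x)"
  using assms has_derivative_transform_within_open[of f _ x UNIV S g]
  unfolding differentiable_def by metis

lemma Ck_on_cong:
  assumes "open S" "\<And>x. x \<in> S \<Longrightarrow> f x = g x" "Ck_on k S f"
  shows "Ck_on k S g"
  using assms(2,3)
proof (induction k arbitrary: f g)
  case 0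
  then show ?case using continuous_on_cong[of S S f g] by simp
next
  case (Suc k)
  have "frechet_derivative f (at x) = frechet_derivative g (at x)" if "x \<in> S" for x
    using frechet_derivative_cong[OF assms(1) that] Suc.prems(1) by blast
  then have "Ck_on k S (\<lambda>x. frechet_derivative g (at x) v)" for v
    using Suc.IH[of "\<lambda>x. frechet_derivative f (at x) v" "\<lambda>x. frechet_derivative g (at x) v"] Suc.prems(2)
    by simp
  moreover have "g differentiable (at x)" if "x \<in> S" for x
    using differentiable_cong[OF assms(1) that] Suc.prems that by (metis Ck_on.simps(2))
  ultimately show ?case by simp
qed

lemma Ck_on_subset: "Ck_on k S f \<Longrightarrow> T \<subseteq> S \<Longrightarrow> Ck_on k T f"
  by (induction k arbitrary: f) (auto intro: continuous_on_subset)

lemma Ck_on_Suc_D: "Ck_on (Suc k) S f \<Longrightarrow> Ck_on k S f"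
proof (induction k arbitrary: f)
  case 0
  then show ?case
    by (auto intro!: differentiable_imp_continuous_on differentiable_at_imp_differentiable_on)
next
  case (Suc k)
  then show ?case by (metis Ck_on.simps(2))
qed

lemma Ck_on_const: "Ck_on k S (\<lambda>x. c)"
  by (induction k arbitrary: c) (auto simp: frechet_derivative_const)

lemma Ck_on_add:
  assumes "open S" "Ck_on k S f" "Ck_on k S g"
  shows "Ck_on k S (\<lambda>x. f x + g x)"
  using assms(2,3)
proof (induction k arbitrary: f g)
  case 0
  then show ?case by (auto intro: continuous_on_add)
next
  case (Suc k)
  have "frechet_derivative (\<lambda>x. f x + g x) (at x) v
      = frechet_derivative f (at x) v + frechet_derivative g (at x) v" if "x \<in> S" for x v
    using frechet_derivative_at[OF has_derivative_add[of f "frechet_derivative f (at x)" "at x"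
      g "frechet_derivative g (at x)"]] Suc.prems that
    by (simp add: frechet_derivative_works[symmetric] fun_eq_iff)
  then have "Ck_on k S (\<lambda>x. frechet_derivative (\<lambda>x. f x + g x) (at x) v)" for v
    using Ck_on_cong[OF assms(1) _ Suc.IH[of "\<lambda>x. frechet_derivative f (at x) v" "\<lambda>x. frechet_derivative g (at x) v"]]
      Suc.prems by simp
  then show ?case using Suc.prems by (auto intro: differentiable_add)
qed

lemma Ck_on_scaleR:
  fixes f :: "'a::real_normed_vector \<Rightarrow> real" and g :: "'a \<Rightarrow> 'b::real_normed_vector"
  assumes "open S" "Ck_on k S f" "Ck_on k S g"
  shows "Ck_on k S (\<lambda>x. f x *\<^sub>R g x)"
  using assms(2,3)
proof (induction k arbitrary: f g)
  case 0
  then show ?case by (auto intro: continuous_on_scaleR)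
next
  case (Suc k)
  have d: "((\<lambda>x. f x *\<^sub>R g x) has_derivative
      (\<lambda>v. f x *\<^sub>R frechet_derivative g (at x) v + frechet_derivative f (at x) v *\<^sub>R g x)) (at x)"
    if "x \<in> S" for x
    using Suc.prems that by (intro has_derivative_scaleR) (auto simp: frechet_derivative_works)
  have "Ck_on k S (\<lambda>x. f x *\<^sub>R frechet_derivative g (at x) v + frechet_derivative f (at x) v *\<^sub>R g x)" for v
    using Suc.prems Suc.prems[THEN Ck_on_Suc_D] by (intro Ck_on_add assms(1) Suc.IH) auto
  then have "Ck_on k S (\<lambda>x. frechet_derivative (\<lambda>x. f x *\<^sub>R g x) (at x) v)" for v
    by (rule Ck_on_cong[OF assms(1), rotated]) (simp add: frechet_derivative_at[OF d, symmetric])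
  moreover have "(\<lambda>x. f x *\<^sub>R g x) differentiable (at x)" if "x \<in> S" for x
    using d[OF that] by (auto simp: differentiable_def)
  ultimately show ?case by simp
qed

lemma Ck_on_bounded_linear:
  assumes "open S" "bounded_linear L" "Ck_on k S f"
  shows "Ck_on k S (\<lambda>x. L (f x))"
  using assms(3)
proof (induction k arbitrary: f)
  case 0
  then show ?case using assms(2) by (auto intro: bounded_linear.continuous_on)
next
  case (Suc k)
  have d: "((\<lambda>x. L (f x)) has_derivative (\<lambda>v. L (frechet_derivative f (at x) v))) (at x)"
    if "x \<in> S" for x
    using Suc.prems that assms(2)
    by (intro bounded_linear.has_derivative[OF assms(2)]) (auto simp: frechet_derivative_works[symmetric])
  have "Ck_on k S (\<lambda>x. L (frechet_derivative f (at x) v))" for v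
    using Suc.prems by (intro Suc.IH) auto
  then have "Ck_on k S (\<lambda>x. frechet_derivative (\<lambda>x. L (f x)) (at x) v)" for v
    by (rule Ck_on_cong[OF assms(1), rotated]) (simp add: frechet_derivative_at[OF d, symmetric])
  moreover have "(\<lambda>x. L (f x)) differentiable (at x)" if "x \<in> S" for x
    using d[OF that] by (auto simp: differentiable_def)
  ultimately show ?case by simp
qed

lemma Ck_on_sum:
  assumes "open S" "\<And>i. i \<in> I \<Longrightarrow> Ck_on k S (f i)"
  shows "Ck_on k S (\<lambda>x. \<Sum>i\<in>I. f i x)"
  using assms(2)
proof (induction I rule: infinite_finite_induct)
  case (insert i I)
  then show ?case using Ck_on_add[OF assms(1), of k "f i" "\<lambda>x. \<Sum>i\<in>I. f i x"] by simp
qed (simp_all add: Ck_on_const)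

text \<open>By the chain rule the partial derivatives of a composition are sums of products of maps that
  are one degree less smooth, one factor again being a composition; so the smoothness degree can be
  used as induction variable.\<close>

lemma Ck_on_compose:
  fixes g :: "'a::real_normed_vector \<Rightarrow> 'b::euclidean_space" and f :: "'b \<Rightarrow> 'c::real_normed_vector"
  assumes "open S" "open T" "Ck_on k S g" "Ck_on k T f" "g ` S \<subseteq> T"
  shows "Ck_on k S (\<lambda>x. f (g x))"
  using assms(3,4)
proof (induction k arbitrary: f)
  case 0
  then show ?case using continuous_on_compose2[of T f S g] assms(5) by auto
next
  case (Suc k)
  let ?Df = "\<lambda>x. frechet_derivative f (at x)" and ?Dg = "\<lambda>x. frechet_derivative g (at x)"
  have df: "(f has_derivative ?Df (g x)) (at (g x))" and dg: "(g has_derivative ?Dg x) (at x)"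
    if "x \<in> S" for x
    using Suc.prems that assms(5) by (auto simp: frechet_derivative_works[symmetric])
  have d: "((\<lambda>x. f (g x)) has_derivative (\<lambda>v. ?Df (g x) (?Dg x v))) (at x)" if "x \<in> S" for x
    using has_derivative_compose[OF dg df] that by (simp add: o_def)
  have e: "?Df (g x) (?Dg x v) = (\<Sum>b\<in>Basis. (inner (?Dg x v) b) *\<^sub>R ?Df (g x) b)" if "x \<in> S" for x v
  proof -
    have "linear (?Df (g x))" using df[OF that] has_derivative_linear by blast
    then have "?Df (g x) (\<Sum>b\<in>Basis. (inner (?Dg x v) b) *\<^sub>R b) = (\<Sum>b\<in>Basis. (inner (?Dg x v) b) *\<^sub>R ?Df (g x) b)"
      by (simp add: linear_sum linear_scale)
    then show ?thesis by (simp add: euclidean_representation)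
  qed
  have "Ck_on k S (\<lambda>x. \<Sum>b\<in>Basis. (inner (?Dg x v) b) *\<^sub>R ?Df (g x) b)" for v
    using Suc.prems Ck_on_Suc_D[OF Suc.prems(1)]
    by (intro Ck_on_sum Ck_on_scaleR assms(1) Suc.IH
        Ck_on_bounded_linear[OF assms(1) bounded_linear_inner_left]) auto
  then have "Ck_on k S (\<lambda>x. frechet_derivative (\<lambda>x. f (g x)) (at x) v)" for v
    by (rule Ck_on_cong[OF assms(1), rotated]) (simp add: frechet_derivative_at[OF d, symmetric] e)
  moreover have "(\<lambda>x. f (g x)) differentiable (at x)" if "x \<in> S" for x
    using d[OF that] by (auto simp: differentiable_def)
  ultimately show ?case by simp
qed

lemma Ck_on_local:
  assumes "\<And>x. x \<in> S \<Longrightarrow> \<exists>T. open T \<and> x \<in> T \<and> T \<subseteq> S \<and> Ck_on k T f"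
  shows "Ck_on k S f"
  using assms
proof (induction k arbitrary: f)
  case 0
  then obtain T where T: "\<And>x. x \<in> S \<Longrightarrow> open (T x) \<and> x \<in> T x \<and> T x \<subseteq> S \<and> continuous_on (T x) f"
    by (metis Ck_on.simps(1))
  have "continuous_on (\<Union>x\<in>S. T x) f"
    using T by (intro continuous_on_open_UN) auto
  moreover have "(\<Union>x\<in>S. T x) = S" using T by blast
  ultimately show ?case by simp
next
  case (Suc k)
  then show ?case by simp (metis)
qed

lemma Ck_on_powr: "Ck_on k {0<..} (\<lambda>t::real. c * t powr a)"
proof (induction k arbitrary: c a)
  case 0
  then show ?case by (auto intro!: continuous_intros)
next
  case (Suc k)
  have d: "((\<lambda>t::real. c * t powr a) has_derivative (\<lambda>v. (c * a * v) * x powr (a - 1))) (at x)"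
    if "x \<in> {0<..}" for x
    using that by (auto intro!: derivative_eq_intros simp: powr_diff field_simps)
  have "Ck_on k {0<..} (\<lambda>x. frechet_derivative (\<lambda>t. c * t powr a) (at x) v)" for v
    by (rule Ck_on_cong[OF _ _ Suc.IH[of "c * a * v" "a - 1"]])
      (simp_all add: frechet_derivative_at[OF d, symmetric])
  moreover have "(\<lambda>t. c * t powr a) differentiable (at x)" if "x \<in> {0<..}" for x
    using d[OF that] by (auto simp: differentiable_def)
  ultimately show ?case by simp
qed

lemma smooth_on_subset: "smooth_on S f \<Longrightarrow> T \<subseteq> S \<Longrightarrow> smooth_on T f"
  unfolding smooth_on_def using Ck_on_subset by blast

lemma smooth_on_cong: "open S \<Longrightarrow> (\<And>x. x \<in> S \<Longrightarrow> f x = g x) \<Longrightarrow> smooth_on S f \<Longrightarrow> smooth_on S g"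
  unfolding smooth_on_def using Ck_on_cong by blast

lemma smooth_on_const: "smooth_on S (\<lambda>x. c)"
  unfolding smooth_on_def using Ck_on_const by blast

lemma smooth_on_add: "open S \<Longrightarrow> smooth_on S f \<Longrightarrow> smooth_on S g \<Longrightarrow> smooth_on S (\<lambda>x. f x + g x)"
  unfolding smooth_on_def using Ck_on_add by blast

lemma smooth_on_mult:
  fixes f g :: "_ \<Rightarrow> real"
  shows "open S \<Longrightarrow> smooth_on S f \<Longrightarrow> smooth_on S g \<Longrightarrow> smooth_on S (\<lambda>x. f x * g x)"
  unfolding smooth_on_def using Ck_on_scaleR[of S _ f g] by simp

lemma smooth_on_bounded_linear:
  "open S \<Longrightarrow> bounded_linear L \<Longrightarrow> smooth_on S f \<Longrightarrow> smooth_on S (\<lambda>x. L (f x))"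
  unfolding smooth_on_def using Ck_on_bounded_linear by blast

lemma smooth_on_compose:
  fixes g :: "'a::real_normed_vector \<Rightarrow> 'b::euclidean_space"
  shows "open S \<Longrightarrow> open T \<Longrightarrow> smooth_on S g \<Longrightarrow> smooth_on T f \<Longrightarrow> g ` S \<subseteq> T
    \<Longrightarrow> smooth_on S (\<lambda>x. f (g x))"
  unfolding smooth_on_def using Ck_on_compose by blast

lemma smooth_on_local:
  "(\<And>x. x \<in> S \<Longrightarrow> \<exists>T. open T \<and> x \<in> T \<and> T \<subseteq> S \<and> smooth_on T f) \<Longrightarrow> smooth_on S f"
  unfolding smooth_on_def using Ck_on_local by metis

lemma smooth_on_derivative: "smooth_on S f \<Longrightarrow> smooth_on S (\<lambda>x. frechet_derivative f (at x) v)"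
  unfolding smooth_on_def using Ck_on.simps(2) by blast

lemma smooth_on_differentiable: "smooth_on S f \<Longrightarrow> x \<in> S \<Longrightarrow> f differentiable (at x)"
  unfolding smooth_on_def using Ck_on.simps(2) by blast

lemma smooth_on_imp_continuous_on: "smooth_on S f \<Longrightarrow> continuous_on S f"
  unfolding smooth_on_def using Ck_on.simps(1) by blast

lemma smooth_on_powr: "smooth_on {0<..} (\<lambda>t::real. t powr a)"
  unfolding smooth_on_def using Ck_on_powr[of _ 1 a] by simp

section \<open>Smooth functions, tangent vectors and vector fields on a manifold\<close>

locale smooth_manifold =
  fixes A :: "('m::{t2_space,second_countable_topology}, 'n::finite) chart set"
  assumes atlas: "smooth_atlas A"
begin

abbreviation smooth :: "'m set \<Rightarrow> ('m \<Rightarrow> 'b::real_normed_vector) \<Rightarrow> bool" where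
  "smooth U f \<equiv> smooth_map_on A U f"

abbreviation T :: "'m \<Rightarrow> 'm tvec set" where
  "T x \<equiv> tangent_space A x"

abbreviation vf :: "'m set \<Rightarrow> 'm vfield \<Rightarrow> bool" where
  "vf U X \<equiv> vector_field_on A U X"

lemma chart_exists: obtains W c where "(W, c) \<in> A" "x \<in> W"
proof -
  have "x \<in> (\<Union>(W, c)\<in>A. W)" using atlas unfolding smooth_atlas_def by simp
  then show ?thesis using that by blast
qed

lemma chart_open: "(W, c) \<in> A \<Longrightarrow> open W"
  and chart_homeomorphism: "(W, c) \<in> A \<Longrightarrow> homeomorphism W (c ` W) c (inv_into W c)"
  and chart_transition: "(W, c) \<in> A \<Longrightarrow> (W', c') \<in> A \<Longrightarrow>
    smooth_on (c ` (W \<inter> W')) (\<lambda>z. c' (inv_into W c z))"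
proof -
  have a: "\<forall>(W, c)\<in>A. open W \<and> open (c ` W) \<and> homeomorphism W (c ` W) c (inv_into W c)"
    "\<forall>(W, c)\<in>A. \<forall>(W', c')\<in>A. smooth_on (c ` (W \<inter> W')) (c' \<circ> inv_into W c)"
    using atlas unfolding smooth_atlas_def by blast+
  show "(W, c) \<in> A \<Longrightarrow> open W" "(W, c) \<in> A \<Longrightarrow> homeomorphism W (c ` W) c (inv_into W c)"
    using a(1) by auto
  show "(W, c) \<in> A \<Longrightarrow> (W', c') \<in> A \<Longrightarrow> smooth_on (c ` (W \<inter> W')) (\<lambda>z. c' (inv_into W c z))"
    using a(2) by (fastforce simp: o_def)
qed

lemma chart_inv: "(W, c) \<in> A \<Longrightarrow> x \<in> W \<Longrightarrow> inv_into W c (c x) = x"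
  using chart_homeomorphism unfolding homeomorphism_def by blast

lemma chart_image_open: "(W, c) \<in> A \<Longrightarrow> open U \<Longrightarrow> open (c ` (U \<inter> W))"
proof -
  assume A: "(W, c) \<in> A" and "open U"
  have "open (c ` W)" using A atlas unfolding smooth_atlas_def by fastforce
  moreover have "openin (top_of_set W) (U \<inter> W)" using \<open>open U\<close> by (auto simp: openin_open)
  ultimately show ?thesis
    using homeomorphism_imp_open_map[OF chart_homeomorphism[OF A]] openin_open_trans by blast
qed

lemma smoothD: "smooth U f \<Longrightarrow> (W, c) \<in> A \<Longrightarrow> smooth_on (c ` (U \<inter> W)) (\<lambda>z. f (inv_into W c z))"
  unfolding smooth_map_on_def by (fastforce simp: o_def)

lemma smoothI:
  "(\<And>W c. (W, c) \<in> A \<Longrightarrow> smooth_on (c ` (U \<inter> W)) (\<lambda>z. f (inv_into W c z))) \<Longrightarrow> smooth U f"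
  unfolding smooth_map_on_def by (auto simp: o_def)

lemma smooth_cong: "open U \<Longrightarrow> (\<And>x. x \<in> U \<Longrightarrow> f x = h x) \<Longrightarrow> smooth U f \<Longrightarrow> smooth U h"
  by (intro smoothI, rule smooth_on_cong[OF chart_image_open _ smoothD]) (auto simp: chart_inv)

lemma smooth_subset: "smooth U f \<Longrightarrow> U' \<subseteq> U \<Longrightarrow> smooth U' f"
  by (intro smoothI, rule smooth_on_subset[OF smoothD]) auto

lemma smooth_local:
  assumes "open U" "\<And>x. x \<in> U \<Longrightarrow> \<exists>U'. open U' \<and> x \<in> U' \<and> smooth U' f"
  shows "smooth U f"
proof (intro smoothI smooth_on_local)
  fix W c z assume A: "(W, c) \<in> A" and "z \<in> c ` (U \<inter> W)"
  then obtain x where x: "x \<in> U" "x \<in> W" "z = c x" by blast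
  obtain U' where U': "open U'" "x \<in> U'" "smooth U' f" using assms(2) x by blast
  show "\<exists>T. open T \<and> z \<in> T \<and> T \<subseteq> c ` (U \<inter> W) \<and> smooth_on T (\<lambda>z. f (inv_into W c z))"
    using x U' smoothD[OF smooth_subset[OF U'(3)] A, of "U' \<inter> U"] chart_image_open[OF A, of "U' \<inter> U"] assms(1)
    by (intro exI[of _ "c ` (U' \<inter> U \<inter> W)"]) auto
qed

text \<open>A transition map is smooth, so smoothness in one chart that contains the domain gives smoothness in all.\<close>

lemma smooth_in_chart:
  assumes A: "(W, c) \<in> A" and U: "open U" "U \<subseteq> W" and f: "smooth_on (c ` U) (\<lambda>z. f (inv_into W c z))"
  shows "smooth U f"
proof (rule smoothI)
  fix W' c' assume A': "(W', c') \<in> A"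
  have "smooth_on (c' ` (U \<inter> W')) (\<lambda>z. f (inv_into W c (c (inv_into W' c' z))))"
    using U chart_inv[OF A'] chart_image_open[OF A U(1)] chart_image_open[OF A' U(1)]
    by (intro smooth_on_compose[OF _ _ smooth_on_subset[OF chart_transition[OF A' A]] f])
      (auto simp: Int_absorb2)
  then show "smooth_on (c' ` (U \<inter> W')) (\<lambda>z. f (inv_into W' c' z))"
    by (rule smooth_on_cong[rotated 2]) (use U A A' chart_image_open in \<open>auto simp: chart_inv subset_iff\<close>)
qed

lemma smooth_chart: "(W, c) \<in> A \<Longrightarrow> smooth W c"
  by (rule smoothI) (auto simp: Int_commute intro: chart_transition)

lemma smooth_const: "smooth U (\<lambda>x. c)"
  by (intro smoothI smooth_on_const)

lemma smooth_add: "open U \<Longrightarrow> smooth U f \<Longrightarrow> smooth U h \<Longrightarrow> smooth U (\<lambda>x. f x + h x)"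
  by (rule smoothI, rule smooth_on_add) (blast intro: smoothD chart_image_open)+

lemma smooth_mult:
  fixes f h :: "'m \<Rightarrow> real"
  shows "open U \<Longrightarrow> smooth U f \<Longrightarrow> smooth U h \<Longrightarrow> smooth U (\<lambda>x. f x * h x)"
  by (rule smoothI, rule smooth_on_mult) (blast intro: smoothD chart_image_open)+

lemma smooth_bounded_linear: "open U \<Longrightarrow> bounded_linear L \<Longrightarrow> smooth U f \<Longrightarrow> smooth U (\<lambda>x. L (f x))"
  by (rule smoothI, rule smooth_on_bounded_linear[of _ L]) (blast intro: smoothD chart_image_open)+

lemma smooth_component: "open U \<Longrightarrow> smooth U f \<Longrightarrow> smooth U (\<lambda>x. vec_nth (f x) j)"
  by (rule smooth_bounded_linear[OF _ bounded_linear_vec_nth])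

lemma smooth_uminus: "open U \<Longrightarrow> smooth U f \<Longrightarrow> smooth U (\<lambda>x. - f x)"
  by (rule smooth_bounded_linear) (auto intro: bounded_linear_minus bounded_linear_ident)

lemma smooth_sum: "open U \<Longrightarrow> (\<And>i. i \<in> I \<Longrightarrow> smooth U (f i)) \<Longrightarrow> smooth U (\<lambda>x. \<Sum>i\<in>I. f i x)"
  by (induction I rule: infinite_finite_induct) (simp_all add: smooth_const smooth_add)

lemma smooth_prod:
  fixes f :: "'i \<Rightarrow> 'm \<Rightarrow> real"
  shows "open U \<Longrightarrow> (\<And>i. i \<in> I \<Longrightarrow> smooth U (f i)) \<Longrightarrow> smooth U (\<lambda>x. \<Prod>i\<in>I. f i x)"
  by (induction I rule: infinite_finite_induct) (simp_all add: smooth_const smooth_mult)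

lemma smooth_powr:
  fixes f :: "'m \<Rightarrow> real"
  assumes "open U" "smooth U f" "\<And>x. x \<in> U \<Longrightarrow> f x > 0"
  shows "smooth U (\<lambda>x. f x powr a)"
proof (rule smoothI)
  fix W c assume A: "(W, c) \<in> A"
  show "smooth_on (c ` (U \<inter> W)) (\<lambda>z. f (inv_into W c z) powr a)"
    by (rule smooth_on_compose[OF chart_image_open[OF A assms(1)] _ smoothD[OF assms(2) A] smooth_on_powr])
      (auto simp: chart_inv[OF A] assms(3))
qed

lemma smooth_det:
  fixes M :: "nat \<Rightarrow> nat \<Rightarrow> 'm \<Rightarrow> real"
  assumes "open U" "\<And>i j. i < k \<Longrightarrow> j < k \<Longrightarrow> smooth U (M i j)"
  shows "smooth U (\<lambda>y. Determinant.det (mat k k (\<lambda>(i, j). M i j y)))"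
proof (rule smooth_cong[OF assms(1)])
  show "smooth U (\<lambda>y. \<Sum>p\<in>{p. p permutes {0..<k}}. signof p * (\<Prod>i=0..<k. M i (p i) y))"
    using assms by (intro smooth_sum smooth_mult smooth_const smooth_prod) (auto simp: permutes_in_image)
  show "(\<Sum>p\<in>{p. p permutes {0..<k}}. signof p * (\<Prod>i=0..<k. M i (p i) y))
      = Determinant.det (mat k k (\<lambda>(i, j). M i j y))" for y
    by (subst det_def'[of _ k]) (auto simp: permutes_in_image intro!: sum.cong prod.cong)
qed

lemma smooth_imp_continuous_on:
  assumes "open U" "smooth U f"
  shows "continuous_on U f"
proof -
  have "continuous_on (\<Union>(W, c)\<in>A. U \<inter> W) f"
  proof (rule continuous_on_open_UN)
    fix p assume "p \<in> A"
    then obtain W c where p: "p = (W, c)" "(W, c) \<in> A" by (cases p) auto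
    have "continuous_on (U \<inter> W) (\<lambda>x. f (inv_into W c (c x)))"
      using smooth_on_imp_continuous_on[OF smoothD[OF assms(2) p(2)]] chart_homeomorphism[OF p(2)]
      by (intro continuous_on_compose2[of "c ` (U \<inter> W)" "\<lambda>z. f (inv_into W c z)" "U \<inter> W" c])
        (auto simp: homeomorphism_def intro: continuous_on_subset)
    then have "continuous_on (U \<inter> W) f"
      by (rule continuous_on_cong[THEN iffD1, rotated 2]) (auto simp: chart_inv[OF p(2)])
    then show "continuous_on (case p of (W, c) \<Rightarrow> U \<inter> W) f" using p by simp
  qed (use chart_open assms in auto)
  moreover have "(\<Union>(W, c)\<in>A. U \<inter> W) = U"
  proof
    show "U \<subseteq> (\<Union>(W, c)\<in>A. U \<inter> W)"
    proof
      fix x assume "x \<in> U"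
      moreover obtain W c where "(W, c) \<in> A" "x \<in> W" using chart_exists .
      ultimately show "x \<in> (\<Union>(W, c)\<in>A. U \<inter> W)" by blast
    qed
  qed auto
  ultimately show ?thesis by simp
qed

lemma positive_nearby:
  fixes f :: "'m \<Rightarrow> real"
  assumes "open U" "smooth U f" "x \<in> U" "f x > 0"
  obtains U' where "open U'" "x \<in> U'" "U' \<subseteq> U" "\<And>y. y \<in> U' \<Longrightarrow> f y > 0"
proof -
  have "open (U \<inter> f -` {0<..})"
    using continuous_open_preimage[OF smooth_imp_continuous_on[OF assms(1,2)] assms(1)] by simp
  then show ?thesis using assms that[of "U \<inter> f -` {0<..}"] by auto
qed

subsection \<open>Tangent vectors\<close>

lemma smooth_nearI: "open U \<Longrightarrow> x \<in> U \<Longrightarrow> smooth U f \<Longrightarrow> smooth_near A x f"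
  unfolding smooth_near_def by blast

lemma smooth_near2:
  assumes "smooth_near A x f" "smooth_near A x h"
  obtains U where "open U" "x \<in> U" "smooth U f" "smooth U h"
proof -
  obtain U U' where "open U" "x \<in> U" "smooth U f" "open U'" "x \<in> U'" "smooth U' h"
    using assms unfolding smooth_near_def by blast
  then show ?thesis
    using that[of "U \<inter> U'"] smooth_subset[of U f "U \<inter> U'"] smooth_subset[of U' h "U \<inter> U'"] by auto
qed

lemma smooth_near_cong:
  assumes "open U" "x \<in> U" "\<And>y. y \<in> U \<Longrightarrow> f y = h y"
  shows "smooth_near A x f \<longleftrightarrow> smooth_near A x h"
proof -
  have "smooth_near A x h" if f: "smooth_near A x f" and eq: "\<And>y. y \<in> U \<Longrightarrow> f y = h y" for f h
  proof -
    obtain U' where U': "open U'" "x \<in> U'" "smooth U' f" using f unfolding smooth_near_def by blast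
    have "smooth (U \<inter> U') h"
      by (rule smooth_cong[of _ f]) (use assms(1) U' eq smooth_subset[of U' f "U \<inter> U'"] in auto)
    then show ?thesis using smooth_nearI[of "U \<inter> U'"] assms(1,2) U' by auto
  qed
  then show ?thesis using assms(3) by metis
qed

lemma chart_differentiable:
  assumes "(W, c) \<in> A" "x \<in> W" "open U" "x \<in> U" "smooth U f"
  shows "(\<lambda>z. f (inv_into W c z)) differentiable (at (c x))"
  using smooth_on_differentiable[OF smoothD[OF assms(5,1)]] assms by blast

lemma coord_vector_eq:
  "smooth_near A x f \<Longrightarrow>
    coord_vector A (W, c) x v f = frechet_derivative (\<lambda>z. f (inv_into W c z)) (at (c x)) v"
  unfolding coord_vector_def by (simp add: o_def)

text \<open>The chain rule for the transition map: every tangent vector can be written in any chart around its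
  base point.\<close>

lemma coord_vector_change:
  assumes A: "(W, c) \<in> A" "(W', c') \<in> A" and x: "x \<in> W" "x \<in> W'"
  shows "coord_vector A (W, c) x v =
    coord_vector A (W', c') x (frechet_derivative (\<lambda>z. c' (inv_into W c z)) (at (c x)) v)"
proof
  fix f
  let ?g = "\<lambda>z. c' (inv_into W c z)"
  show "coord_vector A (W, c) x v f = coord_vector A (W', c') x (frechet_derivative ?g (at (c x)) v) f"
  proof (cases "smooth_near A x f")
    case True
    then obtain U where U: "open U" "x \<in> U" "smooth U f" unfolding smooth_near_def by blast
    let ?f = "\<lambda>z. f (inv_into W' c' z)"
    have "?g differentiable (at (c x))"
      using chart_differentiable[OF A(1) x(1) chart_open[OF A(2)] x(2) smooth_chart[OF A(2)]] .
    moreover have "?f differentiable (at (?g (c x)))"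
      using chart_differentiable[OF A(2) x(2) U] chart_inv[OF A(1) x(1)] by simp
    ultimately have "frechet_derivative (\<lambda>z. ?f (?g z)) (at (c x))
        = frechet_derivative ?f (at (?g (c x))) \<circ> frechet_derivative ?g (at (c x))"
      using frechet_derivative_compose[of ?g "c x" ?f] by (simp add: o_def)
    moreover have "frechet_derivative (\<lambda>z. ?f (?g z)) (at (c x))
        = frechet_derivative (\<lambda>z. f (inv_into W c z)) (at (c x))"
      by (rule frechet_derivative_cong[of "c ` (W' \<inter> W)"])
        (use chart_image_open[OF A(1) chart_open[OF A(2)]] A x in \<open>auto simp: chart_inv\<close>)
    ultimately show ?thesis using True A x by (simp add: coord_vector_eq chart_inv)
  qed (simp add: coord_vector_def)
qed

lemma tangent_space_chart:
  assumes "(W, c) \<in> A" "x \<in> W"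
  shows "T x = range (coord_vector A (W, c) x)"
proof -
  have "T x \<subseteq> range (coord_vector A (W, c) x)"
  proof
    fix u assume "u \<in> T x"
    then obtain W' c' v where "(W', c') \<in> A" "x \<in> W'" "u = coord_vector A (W', c') x v"
      unfolding tangent_space_def by force
    then show "u \<in> range (coord_vector A (W, c) x)"
      using coord_vector_change[of W' c' W c x v] assms by blast
  qed
  then show ?thesis using assms unfolding tangent_space_def by force
qed

lemma tangentE:
  assumes "u \<in> T x" "(W, c) \<in> A" "x \<in> W"
  obtains v where "u = coord_vector A (W, c) x v"
  using assms tangent_space_chart by blast

lemma tangent_not_smooth: "u \<in> T x \<Longrightarrow> \<not> smooth_near A x f \<Longrightarrow> u f = 0"
  unfolding tangent_space_def coord_vector_def by auto

lemma tangent_cong: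
  assumes u: "u \<in> T x" and U: "open U" "x \<in> U" "\<And>y. y \<in> U \<Longrightarrow> f y = h y"
  shows "u f = u h"
proof (cases "smooth_near A x f")
  case True
  then have h: "smooth_near A x h" using smooth_near_cong[OF U] by simp
  obtain W c where c: "(W, c) \<in> A" "x \<in> W" using chart_exists .
  obtain v where v: "u = coord_vector A (W, c) x v" using tangentE[OF u c] .
  have "frechet_derivative (\<lambda>z. f (inv_into W c z)) (at (c x)) = frechet_derivative (\<lambda>z. h (inv_into W c z)) (at (c x))"
    by (rule frechet_derivative_cong[of "c ` (U \<inter> W)"]) (use chart_image_open c U in \<open>auto simp: chart_inv\<close>)
  then show ?thesis using True h by (simp add: v coord_vector_eq)
next
  case False
  then show ?thesis using smooth_near_cong[OF U] tangent_not_smooth[OF u] by simp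
qed

lemma tangent_const: "u \<in> T x \<Longrightarrow> u (\<lambda>y. a) = 0"
proof -
  assume u: "u \<in> T x"
  obtain W c where c: "(W, c) \<in> A" "x \<in> W" using chart_exists .
  obtain v where v: "u = coord_vector A (W, c) x v" using tangentE[OF u c] .
  show ?thesis using smooth_nearI[OF open_UNIV _ smooth_const] by (simp add: v coord_vector_eq)
qed

lemma tangent_add:
  assumes u: "u \<in> T x" and "smooth_near A x f" "smooth_near A x h"
  shows "u (\<lambda>y. f y + h y) = u f + u h"
proof -
  obtain U where U: "open U" "x \<in> U" "smooth U f" "smooth U h" using smooth_near2[OF assms(2,3)] .
  obtain W c where c: "(W, c) \<in> A" "x \<in> W" using chart_exists .
  obtain v where v: "u = coord_vector A (W, c) x v" using tangentE[OF u c] .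
  have d: "((\<lambda>z. f (inv_into W c z) + h (inv_into W c z)) has_derivative
     (\<lambda>v. frechet_derivative (\<lambda>z. f (inv_into W c z)) (at (c x)) v
       + frechet_derivative (\<lambda>z. h (inv_into W c z)) (at (c x)) v)) (at (c x))"
    using chart_differentiable[OF c U(1,2)] U
    by (intro has_derivative_add) (auto simp: frechet_derivative_works[symmetric])
  show ?thesis
    using assms smooth_nearI[OF U(1,2) smooth_add[OF U(1,3,4)]]
    by (simp add: v coord_vector_eq frechet_derivative_at[OF d, symmetric])
qed

lemma tangent_mult:
  assumes u: "u \<in> T x" and "smooth_near A x f" "smooth_near A x h"
  shows "u (\<lambda>y. f y * h y) = f x * u h + u f * h x"
proof -
  obtain U where U: "open U" "x \<in> U" "smooth U f" "smooth U h" using smooth_near2[OF assms(2,3)] .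
  obtain W c where c: "(W, c) \<in> A" "x \<in> W" using chart_exists .
  obtain v where v: "u = coord_vector A (W, c) x v" using tangentE[OF u c] .
  let ?f = "\<lambda>z. f (inv_into W c z)" and ?h = "\<lambda>z. h (inv_into W c z)"
  have d: "((\<lambda>z. ?f z * ?h z) has_derivative
     (\<lambda>v. ?f (c x) * frechet_derivative ?h (at (c x)) v + frechet_derivative ?f (at (c x)) v * ?h (c x))) (at (c x))"
    using chart_differentiable[OF c U(1,2)] U
    by (intro has_derivative_mult) (auto simp: frechet_derivative_works[symmetric])
  show ?thesis
    using assms smooth_nearI[OF U(1,2) smooth_mult[OF U(1,3,4)]] c
    by (simp add: v coord_vector_eq frechet_derivative_at[OF d, symmetric] chart_inv)
qed

lemma smooth_near_const: "smooth_near A x (\<lambda>y. a)"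
  using smooth_nearI[OF open_UNIV _ smooth_const] by blast

lemma smooth_near_mult: "smooth_near A x f \<Longrightarrow> smooth_near A x h \<Longrightarrow> smooth_near A x (\<lambda>y. f y * h y)"
  by (erule smooth_near2, assumption) (rule smooth_nearI, assumption+, rule smooth_mult)

lemma smooth_near_sum: "(\<And>i. i \<in> I \<Longrightarrow> smooth_near A x (f i)) \<Longrightarrow> smooth_near A x (\<lambda>y. \<Sum>i\<in>I. f i y)"
proof (induction I rule: infinite_finite_induct)
  case (insert i I)
  obtain U where "open U" "x \<in> U" "smooth U (f i)" "smooth U (\<lambda>y. \<Sum>i\<in>I. f i y)"
    using smooth_near2[OF insert.prems[OF insertI1] insert.IH] insert.prems by blast
  then show ?case using insert smooth_nearI[OF _ _ smooth_add] by simp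
qed (simp_all add: smooth_near_const)

lemma tangent_cmult:
  assumes "u \<in> T x" "smooth_near A x f"
  shows "u (\<lambda>y. a * f y) = a * u f"
  using tangent_mult[OF assms(1) smooth_near_const assms(2), of a] tangent_const[OF assms(1)] by simp

lemma tangent_diff:
  assumes "u \<in> T x" "smooth_near A x f" "smooth_near A x h"
  shows "u (\<lambda>y. f y - h y) = u f - u h"
  using tangent_add[OF assms(1,2) smooth_near_mult[OF smooth_near_const assms(3)], of "-1"]
    tangent_cmult[OF assms(1,3), of "-1"] by simp

lemma tangent_sum:
  assumes "u \<in> T x" "\<And>i. i \<in> I \<Longrightarrow> smooth_near A x (f i)"
  shows "u (\<lambda>y. \<Sum>i\<in>I. f i y) = (\<Sum>i\<in>I. u (f i))"
  using assms(2)
proof (induction I rule: infinite_finite_induct)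
  case (insert i I)
  then show ?case using tangent_add[OF assms(1) _ smooth_near_sum, of "f i" I f] by simp
qed (simp_all add: tangent_const[OF assms(1)])

lemma coord_vector_lincomb:
  assumes c: "(W, c) \<in> A" "x \<in> W"
  shows "coord_vector A (W, c) x (a *\<^sub>R v + b *\<^sub>R w)
    = (\<lambda>f. a * coord_vector A (W, c) x v f + b * coord_vector A (W, c) x w f)"
proof
  fix f
  show "coord_vector A (W, c) x (a *\<^sub>R v + b *\<^sub>R w) f
    = a * coord_vector A (W, c) x v f + b * coord_vector A (W, c) x w f"
  proof (cases "smooth_near A x f")
    case True
    then have "linear (frechet_derivative (\<lambda>z. f (inv_into W c z)) (at (c x)))"
      using chart_differentiable[OF c] linear_frechet_derivative unfolding smooth_near_def by blast
    then show ?thesis using True by (simp add: coord_vector_eq linear_add linear_scale)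
  qed (simp add: coord_vector_def)
qed

lemma tangent_lincomb: "u \<in> T x \<Longrightarrow> v \<in> T x \<Longrightarrow> (\<lambda>f. a * u f + b * v f) \<in> T x"
proof -
  assume uv: "u \<in> T x" "v \<in> T x"
  obtain W c where c: "(W, c) \<in> A" "x \<in> W" using chart_exists .
  obtain u' where u': "u = coord_vector A (W, c) x u'" using tangentE[OF uv(1) c] .
  obtain v' where v': "v = coord_vector A (W, c) x v'" using tangentE[OF uv(2) c] .
  show ?thesis unfolding u' v' coord_vector_lincomb[OF c, symmetric] tangent_space_chart[OF c] by blast
qed

lemma tangent_zero: "(\<lambda>f. 0) \<in> T x"
proof -
  obtain W c where c: "(W, c) \<in> A" "x \<in> W" using chart_exists .
  have "coord_vector A (W, c) x 0 \<in> T x" using tangent_space_chart[OF c] by blast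
  from tangent_lincomb[OF this this, of 0 0] show ?thesis by simp
qed

lemma tangent_scale: "u \<in> T x \<Longrightarrow> (\<lambda>f. a * u f) \<in> T x"
  using tangent_lincomb[of u x u a 0] by simp

lemma tangent_minus: "u \<in> T x \<Longrightarrow> v \<in> T x \<Longrightarrow> (\<lambda>f. u f - v f) \<in> T x"
  using tangent_lincomb[of u x v 1 "-1"] by simp

lemma tangent_plus: "u \<in> T x \<Longrightarrow> v \<in> T x \<Longrightarrow> (\<lambda>f. u f + v f) \<in> T x"
  using tangent_lincomb[of u x v 1 1] by simp

lemma tangent_lincomb_sum: "(\<And>i. i \<in> I \<Longrightarrow> u i \<in> T x) \<Longrightarrow> (\<lambda>f. \<Sum>i\<in>I. a i * u i f) \<in> T x"
proof (induction I rule: infinite_finite_induct)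
  case (insert i I)
  then show ?case using tangent_lincomb[of "u i" x "\<lambda>f. \<Sum>i\<in>I. a i * u i f" "a i" 1] by simp
qed (simp_all add: tangent_zero)

lemma differential_coord_vector:
  assumes c: "(W, c) \<in> A" "x \<in> W"
  shows "differential c (coord_vector A (W, c) x v) = v"
proof -
  have "coord_vector A (W, c) x v (\<lambda>y. vec_nth (c y) j) = vec_nth v j" for j
  proof -
    have "smooth_near A x (\<lambda>y. vec_nth (c y) j)"
      using smooth_nearI[OF chart_open[OF c(1)] c(2) smooth_component[OF chart_open[OF c(1)] smooth_chart[OF c(1)]]] .
    moreover have "frechet_derivative (\<lambda>z. vec_nth (c (inv_into W c z)) j) (at (c x))
       = frechet_derivative (\<lambda>z. vec_nth z j) (at (c x))"
      by (rule frechet_derivative_cong[of "c ` (W \<inter> W)"])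
        (use chart_image_open[OF c(1) chart_open[OF c(1)]] c in \<open>auto simp: chart_inv\<close>)
    moreover have "((\<lambda>z. vec_nth z j) has_derivative (\<lambda>v. vec_nth v j)) (at (c x))"
      by (rule bounded_linear_imp_has_derivative[OF bounded_linear_vec_nth])
    ultimately show ?thesis by (simp add: coord_vector_eq frechet_derivative_at[symmetric])
  qed
  then show ?thesis unfolding differential_def by (simp add: Finite_Cartesian_Product.vec_eq_iff)
qed

lemma tangent_eqI:
  assumes "u \<in> T x" "v \<in> T x" "(W, c) \<in> A" "x \<in> W" "differential c u = differential c v"
  shows "u = v"
  using tangentE[OF assms(1,3,4)] tangentE[OF assms(2,3,4)] differential_coord_vector[OF assms(3,4)] assms(5)
  by metis

lemma differential_lincomb:
  "differential s (\<lambda>f. \<Sum>i\<in>I. a i * u i f) = (\<Sum>i\<in>I. a i *\<^sub>R differential s (u i))"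
  unfolding differential_def by (simp add: Finite_Cartesian_Product.vec_eq_iff)

text \<open>Differentiability of \<open>h\<close> is asked for at \<open>s x\<close> only, and smoothness of the composition is a separate
  hypothesis: in this form the rule applies to a map \<open>h\<close> on the leaf space that is known on the image of \<open>s\<close> alone.\<close>

lemma tangent_chain_rule:
  fixes s :: "'m \<Rightarrow> real^'k" and h :: "real^'k \<Rightarrow> real"
  assumes u: "u \<in> T x" and U: "open U" "x \<in> U" "smooth U s"
    and h: "h differentiable (at (s x))" "smooth_near A x (\<lambda>y. h (s y))"
  shows "u (\<lambda>y. h (s y)) = frechet_derivative h (at (s x)) (differential s u)"
proof -
  obtain W c where c: "(W, c) \<in> A" "x \<in> W" using chart_exists .
  obtain v where v: "u = coord_vector A (W, c) x v" using tangentE[OF u c] .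
  let ?s = "\<lambda>z. s (inv_into W c z)"
  let ?Ds = "frechet_derivative ?s (at (c x))"
  have s: "?s differentiable (at (c x))" using chart_differentiable[OF c U] .
  have sj: "smooth_near A x (\<lambda>y. vec_nth (s y) j)" for j
    using smooth_nearI[OF U(1,2) smooth_component[OF U(1,3)]] .
  have "((\<lambda>z. vec_nth (?s z) j) has_derivative (\<lambda>v. vec_nth (?Ds v) j)) (at (c x))" for j
    by (rule bounded_linear.has_derivative[OF bounded_linear_vec_nth])
      (use s frechet_derivative_works in blast)
  then have "frechet_derivative (\<lambda>z. vec_nth (?s z) j) (at (c x)) = (\<lambda>v. vec_nth (?Ds v) j)" for j
    using frechet_derivative_at by metis
  then have ds: "differential s u = ?Ds v"
    unfolding differential_def v using sj by (simp add: coord_vector_eq Finite_Cartesian_Product.vec_eq_iff)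
  have "frechet_derivative (\<lambda>z. h (?s z)) (at (c x)) = frechet_derivative h (at (?s (c x))) \<circ> ?Ds"
    using frechet_derivative_compose[OF s, of h] h(1) c by (simp add: o_def chart_inv)
  then show ?thesis using h(2) c by (simp add: ds) (simp add: v coord_vector_eq chart_inv)
qed

subsection \<open>Vector fields\<close>

lemma vf_tangent: "vf U X \<Longrightarrow> x \<in> U \<Longrightarrow> X x \<in> T x"
  unfolding vector_field_on_def by blast

lemma vf_smooth: "vf U X \<Longrightarrow> open U' \<Longrightarrow> U' \<subseteq> U \<Longrightarrow> smooth U' f \<Longrightarrow> smooth U' (\<lambda>y. X y f)"
  unfolding vector_field_on_def by blast

lemma vf_subset: "vf U X \<Longrightarrow> U' \<subseteq> U \<Longrightarrow> vf U' X"
  unfolding vector_field_on_def by (meson subset_iff)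

lemma vf_cong: "(\<And>x. x \<in> U \<Longrightarrow> X x = Y x) \<Longrightarrow> vf U X \<Longrightarrow> vf U Y"
  unfolding vector_field_on_def
proof (intro conjI ballI allI impI)
  fix U' and f :: "'m \<Rightarrow> real"
  assume eq: "\<And>x. x \<in> U \<Longrightarrow> X x = Y x"
    and X: "(\<forall>x\<in>U. X x \<in> T x) \<and> (\<forall>U' f. open U' \<and> U' \<subseteq> U \<and> smooth U' f \<longrightarrow> smooth U' (\<lambda>y. X y f))"
    and U': "open U' \<and> U' \<subseteq> U \<and> smooth U' f"
  show "smooth U' (\<lambda>y. Y y f)"
    by (rule smooth_cong[of U' "\<lambda>y. X y f"]) (use eq X U' in auto)
qed auto

lemma vf_lincomb:
  assumes "open U" "\<And>i. i \<in> I \<Longrightarrow> vf U (X i)" "\<And>i. i \<in> I \<Longrightarrow> smooth U (h i)"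
  shows "vf U (\<lambda>y f. \<Sum>i\<in>I. h i y * X i y f)"
  unfolding vector_field_on_def
proof (intro conjI ballI allI impI)
  show "(\<lambda>f. \<Sum>i\<in>I. h i x * X i x f) \<in> T x" if "x \<in> U" for x
    using assms(2) that by (intro tangent_lincomb_sum) (auto intro: vf_tangent)
  show "smooth U' (\<lambda>y. \<Sum>i\<in>I. h i y * X i y f)" if "open U' \<and> U' \<subseteq> U \<and> smooth U' f" for U' f
    using assms that by (intro smooth_sum smooth_mult) (auto intro: smooth_subset vf_smooth)
qed

lemma vf_scale: "open U \<Longrightarrow> smooth U h \<Longrightarrow> vf U X \<Longrightarrow> vf U (\<lambda>y f. h y * X y f)"
  using vf_lincomb[of U "{()}" "\<lambda>_. X" "\<lambda>_. h"] by simp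

lemma vf_add: "open U \<Longrightarrow> vf U X \<Longrightarrow> vf U Y \<Longrightarrow> vf U (\<lambda>y f. X y f + Y y f)"
  using vf_lincomb[of U "UNIV :: bool set" "\<lambda>b. if b then X else Y" "\<lambda>_ _. 1"]
  by (simp add: UNIV_bool smooth_const add.commute)

lemma vf_diff: "open U \<Longrightarrow> vf U X \<Longrightarrow> vf U Y \<Longrightarrow> vf U (\<lambda>y f. X y f - Y y f)"
  using vf_add[of U X "\<lambda>y f. -1 * Y y f"] vf_scale[of U "\<lambda>_. -1" Y] by (simp add: smooth_const)

lemma vf_coordinate:
  assumes "(W, c) \<in> A"
  shows "vf W (\<lambda>x. coord_vector A (W, c) x v)"
  unfolding vector_field_on_def
proof (intro conjI ballI allI impI)
  show "coord_vector A (W, c) x v \<in> T x" if "x \<in> W" for x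
    using tangent_space_chart[OF assms that] by blast
  fix U and f :: "'m \<Rightarrow> real" assume U: "open U \<and> U \<subseteq> W \<and> smooth U f"
  let ?D = "\<lambda>z. frechet_derivative (\<lambda>z. f (inv_into W c z)) (at z) v"
  have "smooth_on (c ` U) ?D"
    using smooth_on_derivative[OF smoothD[OF _ assms], of U f] U by (simp add: Int_absorb2)
  then have "smooth_on (c ` U) (\<lambda>z. ?D (c (inv_into W c z)))"
    by (rule smooth_on_cong[rotated 2])
      (use U chart_image_open[OF assms, of U] in \<open>auto simp: chart_inv[OF assms] subset_iff Int_absorb2\<close>)
  then have "smooth U (\<lambda>y. ?D (c y))"
    using smooth_in_chart[OF assms, of U "\<lambda>y. ?D (c y)"] U by blast
  then show "smooth U (\<lambda>y. coord_vector A (W, c) y v f)"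
    by (rule smooth_cong[rotated 2]) (use U in \<open>auto simp: coord_vector_eq smooth_nearI\<close>)
qed

lemma tangent_extend:
  assumes "u \<in> T x"
  obtains W X where "open W" "x \<in> W" "vf W X" "X x = u"
proof -
  obtain W c where c: "(W, c) \<in> A" "x \<in> W" using chart_exists .
  obtain v where v: "u = coord_vector A (W, c) x v" using tangentE[OF assms c] .
  then show ?thesis using that[OF chart_open[OF c(1)] c(2) vf_coordinate[OF c(1)]] by blast
qed

lemma vf_smooth_near: "open U \<Longrightarrow> x \<in> U \<Longrightarrow> vf U X \<Longrightarrow> smooth_near A x f \<Longrightarrow> smooth_near A x (\<lambda>y. X y f)"
proof -
  assume U: "open U" "x \<in> U" "vf U X" and "smooth_near A x f"
  then obtain U' where U': "open U'" "x \<in> U'" "smooth U' f" unfolding smooth_near_def by blast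
  have "smooth (U \<inter> U') (\<lambda>y. X y f)"
    using vf_smooth[OF U(3), of "U \<inter> U'" f] smooth_subset[OF U'(3), of "U \<inter> U'"] U(1) U'(1) by auto
  then show ?thesis using smooth_nearI[of "U \<inter> U'" x] U(1,2) U'(1,2) by auto
qed

subsection \<open>The Lie bracket\<close>

lemma bracket_eq: "smooth_near A x f \<Longrightarrow> lie_bracket A X Y x f = X x (\<lambda>y. Y y f) - Y x (\<lambda>y. X y f)"
  unfolding lie_bracket_def by simp

lemma bracket_cong:
  assumes "open U" "x \<in> U" "vf U X" "vf U Y" "\<And>y. y \<in> U \<Longrightarrow> X y = X' y" "\<And>y. y \<in> U \<Longrightarrow> Y y = Y' y"
  shows "lie_bracket A X Y x = lie_bracket A X' Y' x"
proof -
  have "X x (\<lambda>y. Y y f) = X' x (\<lambda>y. Y' y f)" "Y x (\<lambda>y. X y f) = Y' x (\<lambda>y. X' y f)" for f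
    using assms tangent_cong[OF vf_tangent[OF assms(3,2)] assms(1,2), of "\<lambda>y. Y y f" "\<lambda>y. Y' y f"]
      tangent_cong[OF vf_tangent[OF assms(4,2)] assms(1,2), of "\<lambda>y. X y f" "\<lambda>y. X' y f"] by auto
  then show ?thesis unfolding lie_bracket_def by auto
qed

lemma bracket_antisym: "lie_bracket A Y X x = (\<lambda>f. - lie_bracket A X Y x f)"
  unfolding lie_bracket_def by auto

lemma bracket_lincomb_right:
  assumes U: "open U" "x \<in> U" "vf U X" and Y: "\<And>i. i \<in> I \<Longrightarrow> vf U (Y i)" "\<And>i. i \<in> I \<Longrightarrow> smooth U (h i)"
  shows "lie_bracket A X (\<lambda>y f. \<Sum>i\<in>I. h i y * Y i y f) x
    = (\<lambda>f. \<Sum>i\<in>I. X x (h i) * Y i x f + h i x * lie_bracket A X (Y i) x f)"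
proof
  fix f
  show "lie_bracket A X (\<lambda>y f. \<Sum>i\<in>I. h i y * Y i y f) x f
    = (\<Sum>i\<in>I. X x (h i) * Y i x f + h i x * lie_bracket A X (Y i) x f)"
  proof (cases "smooth_near A x f")
    case True
    have Xx: "X x \<in> T x" using U vf_tangent by blast
    have s: "smooth_near A x (h i)" "smooth_near A x (\<lambda>y. Y i y f)" if "i \<in> I" for i
      using Y[OF that] U vf_smooth_near[OF U(1,2) Y(1)[OF that] True] smooth_nearI by blast+
    have "X x (\<lambda>y. \<Sum>i\<in>I. h i y * Y i y f) = (\<Sum>i\<in>I. X x (\<lambda>y. h i y * Y i y f))"
      using s by (intro tangent_sum[OF Xx]) (auto intro: smooth_near_mult)
    also have "\<dots> = (\<Sum>i\<in>I. h i x * X x (\<lambda>y. Y i y f) + X x (h i) * Y i x f)"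
      using s by (intro sum.cong refl tangent_mult[OF Xx])
    finally show ?thesis
      using True by (simp add: bracket_eq sum_subtractf[symmetric] algebra_simps)
  next
    case False
    then have "Y i x f = 0" if "i \<in> I" for i
      using tangent_not_smooth[OF vf_tangent[OF Y(1)[OF that] U(2)]] by simp
    then show ?thesis using False by (simp add: lie_bracket_def)
  qed
qed

lemma bracket_lincomb_left:
  assumes U: "open U" "x \<in> U" "vf U X" and Y: "\<And>i. i \<in> I \<Longrightarrow> vf U (Y i)" "\<And>i. i \<in> I \<Longrightarrow> smooth U (h i)"
  shows "lie_bracket A (\<lambda>y f. \<Sum>i\<in>I. h i y * Y i y f) X x
    = (\<lambda>f. \<Sum>i\<in>I. h i x * lie_bracket A (Y i) X x f - X x (h i) * Y i x f)"
proof -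
  have "lie_bracket A (Y i) X x f = - lie_bracket A X (Y i) x f" for i f
    by (simp add: bracket_antisym[of "Y i" X])
  then show ?thesis
    unfolding bracket_antisym[of "\<lambda>y f. \<Sum>i\<in>I. h i y * Y i y f" X]
    by (subst bracket_lincomb_right[OF assms])
      (auto simp: fun_eq_iff sum_negf[symmetric] algebra_simps intro!: sum.cong)
qed

text \<open>On a smooth germ all three brackets expand into iterated derivatives, which cancel.\<close>

lemma bracket_jacobi:
  assumes U: "open U" "x \<in> U" and X: "vf U X" "vf U Y" "vf U Z"
    and B: "vf U (lie_bracket A X Y)" "vf U (lie_bracket A Y Z)" "vf U (lie_bracket A X Z)"
  shows "lie_bracket A (lie_bracket A X Y) Z x
    = (\<lambda>f. lie_bracket A X (lie_bracket A Y Z) x f - lie_bracket A Y (lie_bracket A X Z) x f)"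
proof
  fix f
  show "lie_bracket A (lie_bracket A X Y) Z x f
    = lie_bracket A X (lie_bracket A Y Z) x f - lie_bracket A Y (lie_bracket A X Z) x f"
  proof (cases "smooth_near A x f")
    case True
    then obtain U' where U': "open U'" "x \<in> U'" "smooth U' f" unfolding smooth_near_def by blast
    have near: "smooth_near A y f" if "y \<in> U'" for y using that U' smooth_nearI by blast
    have *: "E x (\<lambda>y. lie_bracket A P Q y f) = E x (\<lambda>y. P y (\<lambda>z. Q z f)) - E x (\<lambda>y. Q y (\<lambda>z. P z f))"
      if "vf U E" "vf U P" "vf U Q" for E P Q
    proof -
      have "E x (\<lambda>y. lie_bracket A P Q y f) = E x (\<lambda>y. P y (\<lambda>z. Q z f) - Q y (\<lambda>z. P z f))"
        using near by (intro tangent_cong[OF vf_tangent[OF that(1) U(2)] U'(1,2)]) (simp add: bracket_eq)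
      also have "\<dots> = E x (\<lambda>y. P y (\<lambda>z. Q z f)) - E x (\<lambda>y. Q y (\<lambda>z. P z f))"
        by (rule tangent_diff[OF vf_tangent[OF that(1) U(2)]])
          (rule vf_smooth_near[OF U that(2) vf_smooth_near[OF U that(3) True]]
            vf_smooth_near[OF U that(3) vf_smooth_near[OF U that(2) True]])+
      finally show ?thesis .
    qed
    have **: "smooth_near A x (\<lambda>y. E y f)" if "vf U E" for E
      using vf_smooth_near[OF U that True] .
    show ?thesis using True X by (simp add: bracket_eq * **)
  next
    case False
    then show ?thesis by (simp add: lie_bracket_def)
  qed
qed

end

section \<open>Riemannian metrics and the Levi-Civita connection\<close>

locale riemannian_manifold = smooth_manifold A
  for A :: "('m::{t2_space,second_countable_topology}, 'n::finite) chart set" +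
  fixes g :: "'m metric" and D :: "'m vfield \<Rightarrow> 'm vfield \<Rightarrow> 'm vfield"
  assumes metric: "riemannian_metric A g" and connection: "levi_civita A g D"
begin

lemma g_sym: "u \<in> T x \<Longrightarrow> v \<in> T x \<Longrightarrow> g x u v = g x v u"
  and g_pos: "u \<in> T x \<Longrightarrow> u \<noteq> (\<lambda>f. 0) \<Longrightarrow> g x u u > 0"
  and g_lincomb: "u \<in> T x \<Longrightarrow> v \<in> T x \<Longrightarrow> w \<in> T x \<Longrightarrow>
    g x (\<lambda>f. a * u f + b * v f) w = a * g x u w + b * g x v w"
  and g_smooth: "open U \<Longrightarrow> vf U X \<Longrightarrow> vf U Y \<Longrightarrow> smooth U (\<lambda>x. g x (X x) (Y x))"
  using metric unfolding riemannian_metric_def by blast+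

lemma g_zero_left: "w \<in> T x \<Longrightarrow> g x (\<lambda>f. 0) w = 0"
  using g_lincomb[OF tangent_zero tangent_zero, of w x 0 0] by simp

lemma g_eq_zero: "u \<in> T x \<Longrightarrow> g x u u = 0 \<Longrightarrow> u = (\<lambda>f. 0)"
  using g_pos by fastforce

lemma g_sum_left:
  assumes "\<And>i. i \<in> I \<Longrightarrow> u i \<in> T x" "w \<in> T x"
  shows "g x (\<lambda>f. \<Sum>i\<in>I. a i * u i f) w = (\<Sum>i\<in>I. a i * g x (u i) w)"
  using assms(1)
proof (induction I rule: infinite_finite_induct)
  case (insert i I)
  then show ?case
    using g_lincomb[of "u i" x "\<lambda>f. \<Sum>i\<in>I. a i * u i f" w "a i" 1] tangent_lincomb_sum[of I u x a] assms(2)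
    by simp
qed (simp_all add: g_zero_left assms(2))

lemma g_sum_right:
  assumes "\<And>i. i \<in> I \<Longrightarrow> u i \<in> T x" "w \<in> T x"
  shows "g x w (\<lambda>f. \<Sum>i\<in>I. a i * u i f) = (\<Sum>i\<in>I. a i * g x w (u i))"
proof -
  have "(\<lambda>f. \<Sum>i\<in>I. a i * u i f) \<in> T x" by (rule tangent_lincomb_sum) (rule assms(1))
  then have "g x w (\<lambda>f. \<Sum>i\<in>I. a i * u i f) = (\<Sum>i\<in>I. a i * g x (u i) w)"
    using g_sum_left[of I u x w a, OF assms] g_sym assms(2) by simp
  also have "\<dots> = (\<Sum>i\<in>I. a i * g x w (u i))"
    by (rule sum.cong) (auto simp: g_sym[OF assms(1) assms(2)])
  finally show ?thesis .
qed

lemma g_scale: "u \<in> T x \<Longrightarrow> w \<in> T x \<Longrightarrow> g x (\<lambda>f. a * u f) w = a * g x u w"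
  using g_lincomb[of u x u w a 0] by simp

lemma g_plus: "u \<in> T x \<Longrightarrow> v \<in> T x \<Longrightarrow> w \<in> T x \<Longrightarrow> g x (\<lambda>f. u f + v f) w = g x u w + g x v w"
  using g_lincomb[of u x v w 1 1] by simp

lemma g_minus: "u \<in> T x \<Longrightarrow> v \<in> T x \<Longrightarrow> w \<in> T x \<Longrightarrow> g x (\<lambda>f. u f - v f) w = g x u w - g x v w"
  using g_lincomb[of u x v w 1 "-1"] by simp

context
  fixes U :: "'m set"
  assumes U: "open U"
begin

lemma D_vf: "vf U X \<Longrightarrow> vf U Y \<Longrightarrow> vf U (D X Y)"
  using connection U smooth_const[of U "0::real"] unfolding levi_civita_def by blast

lemma D_add_left: "vf U X \<Longrightarrow> vf U Y \<Longrightarrow> vf U Z \<Longrightarrow> x \<in> U \<Longrightarrow>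
    D (\<lambda>y f. X y f + Y y f) Z x = (\<lambda>f. D X Z x f + D Y Z x f)"
  using connection U smooth_const[of U "0::real"] unfolding levi_civita_def by blast

lemma D_scale_left: "vf U X \<Longrightarrow> vf U Z \<Longrightarrow> smooth U h \<Longrightarrow> x \<in> U \<Longrightarrow>
    D (\<lambda>y f. h y * X y f) Z x = (\<lambda>f. h x * D X Z x f)"
  using connection U unfolding levi_civita_def by blast

lemma D_add_right: "vf U X \<Longrightarrow> vf U Y \<Longrightarrow> vf U Z \<Longrightarrow> x \<in> U \<Longrightarrow>
    D X (\<lambda>y f. Y y f + Z y f) x = (\<lambda>f. D X Y x f + D X Z x f)"
  using connection U smooth_const[of U "0::real"] unfolding levi_civita_def by blast

lemma D_torsion_free: "vf U X \<Longrightarrow> vf U Y \<Longrightarrow> x \<in> U \<Longrightarrow>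
    lie_bracket A X Y x = (\<lambda>f. D X Y x f - D Y X x f)"
  using connection U smooth_const[of U "0::real"] unfolding levi_civita_def by blast

lemma D_metric: "vf U X \<Longrightarrow> vf U Y \<Longrightarrow> vf U Z \<Longrightarrow> x \<in> U \<Longrightarrow>
    X x (\<lambda>y. g y (Y y) (Z y)) = g x (D X Y x) (Z x) + g x (Y x) (D X Z x)"
  using connection U smooth_const[of U "0::real"] unfolding levi_civita_def by blast

text \<open>Since \<open>D X Y\<close> is a vector field, so is the bracket: it is a difference of two covariant
  derivatives.\<close>

lemma bracket_vf: "vf U X \<Longrightarrow> vf U Y \<Longrightarrow> vf U (lie_bracket A X Y)"
  by (rule vf_cong[OF D_torsion_free[symmetric] vf_diff[OF U D_vf D_vf]])

text \<open>The connection acts on total functions, so its locality has to be derived.  If \<open>X = X'\<close> on \<open>U\<close>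
  and \<open>h\<close> is the indicator function of the complement of \<open>U\<close>, then \<open>X - X' = h (X - X')\<close> holds
  everywhere, whereas \<open>h\<close> and its derivatives vanish on \<open>U\<close>.\<close>

lemma D_cong_left:
  assumes X: "vf U X" "vf U Z" "\<And>y. y \<in> U \<Longrightarrow> X' y = X y" and x: "x \<in> U"
  shows "D X' Z x = D X Z x"
proof -
  define h :: "'m \<Rightarrow> real" where "h = (\<lambda>y. if y \<in> U then 0 else 1)"
  define N :: "'m vfield" where "N = (\<lambda>y f. X' y f + (-1) * X y f)"
  have X': "vf U X'" using vf_cong[of U X X'] X by metis
  have h: "smooth U h" by (rule smooth_cong[OF U _ smooth_const[of U 0]]) (simp add: h_def)
  have m: "vf U (\<lambda>y f. (-1) * X y f)" using vf_scale[OF U smooth_const X(1), of "-1"] .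
  have N: "vf U N" unfolding N_def using vf_add[OF U X' m] .
  have "N = (\<lambda>y f. h y * N y f)" using X(3) by (auto simp: N_def h_def fun_eq_iff)
  then have "D N Z x = (\<lambda>f. 0)" using D_scale_left[OF N X(2) h x] x by (simp add: h_def)
  moreover have "D N Z x = (\<lambda>f. D X' Z x f + (-1) * D X Z x f)"
    unfolding N_def D_add_left[OF X' m X(2) x] D_scale_left[OF X(1,2) smooth_const x] ..
  ultimately show ?thesis by (simp add: fun_eq_iff)
qed

lemma D_lincomb_left:
  assumes "finite I" "\<And>i. i \<in> I \<Longrightarrow> vf U (X i)" "\<And>i. i \<in> I \<Longrightarrow> smooth U (h i)" "vf U Z" "x \<in> U"
  shows "D (\<lambda>y f. \<Sum>i\<in>I. h i y * X i y f) Z x = (\<lambda>f. \<Sum>i\<in>I. h i x * D (X i) Z x f)"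
  using assms(1-3)
proof (induction I rule: finite_induct)
  case empty
  have "vf U (\<lambda>y f. 0 :: real)" using vf_lincomb[of U "{}"] U by simp
  from D_scale_left[OF this assms(4) smooth_const assms(5), of 0] show ?case by simp
next
  case (insert i I)
  have "vf U (\<lambda>y f. \<Sum>i\<in>I. h i y * X i y f)" using insert by (intro vf_lincomb U) auto
  moreover have "vf U (\<lambda>y f. h i y * X i y f)" using insert by (intro vf_scale U) auto
  ultimately show ?case
    using insert D_add_left[of "\<lambda>y f. h i y * X i y f" "\<lambda>y f. \<Sum>i\<in>I. h i y * X i y f" Z x]
      D_scale_left[of "X i" Z "h i" x] assms(4,5) by simp
qed

end

end

section \<open>Vertical and horizontal vectors, adapted frames\<close>

text \<open>Linear independence of a family rather than of a set: it includes that the members are distinct.\<close>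

lemma independent_family_bound:
  fixes e :: "'i \<Rightarrow> real^'n"
  assumes I: "finite I" and ind: "\<And>c i. (\<Sum>i\<in>I. c i *\<^sub>R e i) = 0 \<Longrightarrow> i \<in> I \<Longrightarrow> c i = 0"
  shows "card I \<le> CARD('n)"
proof -
  have inj: "inj_on e I"
  proof (rule inj_onI, rule ccontr)
    fix i j assume ij: "i \<in> I" "j \<in> I" "e i = e j" "i \<noteq> j"
    let ?c = "\<lambda>l. (if l = i then 1 else 0) - (if l = j then 1 else 0) :: real"
    have "(\<Sum>l\<in>I. ?c l *\<^sub>R e l) = (\<Sum>l\<in>I. if l = i then e l else 0) - (\<Sum>l\<in>I. if l = j then e l else 0)"
      unfolding sum_subtractf[symmetric] by (rule sum.cong) auto
    also have "\<dots> = 0" using ij I by simp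
    finally show False using ind[of ?c i] ij by simp
  qed
  have "independent (e ` I)"
  proof (rule independent_if_scalars_zero)
    fix f x assume s: "(\<Sum>x\<in>e ` I. f x *\<^sub>R x) = 0" and x: "x \<in> e ` I"
    have "(\<Sum>i\<in>I. f (e i) *\<^sub>R e i) = 0" using s by (simp add: sum.reindex[OF inj])
    then show "f x = 0" using ind[of "\<lambda>i. f (e i)"] x by blast
  qed (use I in simp)
  then have "card (e ` I) \<le> DIM(real^'n)" using independent_bound by blast
  then show ?thesis by (simp add: card_image[OF inj])
qed

text \<open>The notation \<open>real^'k\<close> fixes the sort of \<open>'k\<close>, while the index types of charts and submersions below are
  also linearly ordered.\<close>

type_synonym 'k rvec = "(real, 'k) Finite_Cartesian_Product.vec"

locale foliated_manifold = riemannian_manifold A g D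
  for A :: "('m::{t2_space,second_countable_topology}, 'n::{finite,linorder}) chart set"
    and g :: "'m metric" and D :: "'m vfield \<Rightarrow> 'm vfield \<Rightarrow> 'm vfield" +
  fixes F :: "('m, 'q::{finite,linorder}) submersion set" and p :: nat
  assumes oriented: "oriented_atlas A"
    and foliation: "foliation A F"
    and transverse: "transversely_oriented F"
    and dim_split: "CARD('n) = p + CARD('q)" and p_pos: "p \<ge> 1"
begin

abbreviation vert_sp :: "'m \<Rightarrow> 'm tvec set" where "vert_sp \<equiv> vert_space A F"

abbreviation hor_sp :: "'m \<Rightarrow> 'm tvec set" where "hor_sp \<equiv> hor_space A F g"

lemma submersion_exists: obtains U s where "(U, s) \<in> F" "x \<in> U"
proof -
  have "x \<in> (\<Union>(U, s)\<in>F. U)" using foliation unfolding foliation_def by simp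
  then show ?thesis using that by blast
qed

lemma submersion_open: "(U, s) \<in> F \<Longrightarrow> open U"
  and submersion_smooth: "(U, s) \<in> F \<Longrightarrow> smooth U s"
  and submersion_onto: "(U, s) \<in> F \<Longrightarrow> x \<in> U \<Longrightarrow> \<exists>u\<in>T x. differential s u = w"
proof -
  have a: "\<forall>(U, s)\<in>F. open U \<and> smooth U s \<and> (\<forall>x\<in>U. differential s ` T x = UNIV)"
    using foliation unfolding foliation_def by blast
  show "(U, s) \<in> F \<Longrightarrow> open U" "(U, s) \<in> F \<Longrightarrow> smooth U s" using a by auto
  assume "(U, s) \<in> F" "x \<in> U"
  then have "differential s ` T x = UNIV" using a by auto
  then show "\<exists>u\<in>T x. differential s u = w" by (metis UNIV_I imageE)
qed

lemma submersion_component: "(U, s) \<in> F \<Longrightarrow> smooth U (\<lambda>y. vec_nth (s y) j)"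
  using smooth_component submersion_open submersion_smooth by blast

lemma lifts_at_point:
  assumes "(U, s) \<in> F" "x \<in> U"
  obtains X where "\<And>a. X a \<in> T x" "\<And>a. differential s (X a) = axis a 1"
proof -
  have "\<exists>u\<in>T x. differential s u = axis a 1" for a using submersion_onto[OF assms] .
  then show ?thesis using that by metis
qed

lemma differential_smooth:
  assumes "(U0, s) \<in> F" "open U" "U \<subseteq> U0" "vf U E"
  shows "smooth U (\<lambda>y. vec_nth (differential s (E y)) a)"
  using vf_smooth[OF assms(4,2) subset_refl smooth_subset[OF submersion_component[OF assms(1)] assms(3)]]
  unfolding differential_def by simp

lemma transition_exists:
  assumes "(U, s) \<in> F" "(U', s') \<in> F" "x \<in> U" "x \<in> U'"
  obtains P \<gamma> W where "transition_near x (U, s) (U', s') P \<gamma>" "open P" "smooth_on P \<gamma>"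
    "inj_on \<gamma> P" "open (\<gamma> ` P)" "smooth_on (\<gamma> ` P) (inv_into P \<gamma>)"
    "open W" "x \<in> W" "W \<subseteq> U \<inter> U'" "s ` W \<subseteq> P" "\<And>y. y \<in> W \<Longrightarrow> s' y = \<gamma> (s y)"
proof -
  have "\<forall>S\<in>F. \<forall>S'\<in>F. \<forall>x\<in>fst S \<inter> fst S'. \<exists>P \<gamma>. transition_near x S S' P \<gamma>"
    using foliation unfolding foliation_def by blast
  then obtain P \<gamma> where t: "transition_near x (U, s) (U', s') P \<gamma>" using assms by fastforce
  then obtain W where "open W" "x \<in> W" "W \<subseteq> U \<inter> U'" "s ` W \<subseteq> P" "\<forall>y\<in>W. s' y = \<gamma> (s y)"
    unfolding transition_near_def by auto
  then show ?thesis using that[of P \<gamma> W] t unfolding transition_near_def diffeo_onto_open_def by auto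
qed

text \<open>The chain rule for \<open>s' = \<gamma> \<circ> s\<close>, one component at a time.\<close>

lemma transition_differential:
  assumes F: "(U, s) \<in> F" "(U', s') \<in> F" and P: "open P" "smooth_on P \<gamma>"
    and W: "open W" "W \<subseteq> U \<inter> U'" "s ` W \<subseteq> P" "\<And>y. y \<in> W \<Longrightarrow> s' y = \<gamma> (s y)"
    and x: "x \<in> W" "u \<in> T x"
  shows "differential s' u = frechet_derivative \<gamma> (at (s x)) (differential s u)"
proof -
  have d: "\<gamma> differentiable (at (s x))" using smooth_on_differentiable[OF P(2)] W x by blast
  have "u (\<lambda>y. vec_nth (s' y) j) = vec_nth (frechet_derivative \<gamma> (at (s x)) (differential s u)) j" for j
  proof -
    have g: "((\<lambda>z. vec_nth (\<gamma> z) j) has_derivative (\<lambda>v. vec_nth (frechet_derivative \<gamma> (at (s x)) v) j)) (at (s x))"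
      by (rule bounded_linear.has_derivative[OF bounded_linear_vec_nth])
        (use d frechet_derivative_works in blast)
    have "smooth W (\<lambda>y. vec_nth (s' y) j)"
      using smooth_subset[OF submersion_component[OF F(2)]] W by blast
    then have "smooth W (\<lambda>y. vec_nth (\<gamma> (s y)) j)"
      by (rule smooth_cong[rotated 2]) (use W in auto)
    then have "smooth_near A x (\<lambda>y. vec_nth (\<gamma> (s y)) j)" using smooth_nearI W x by blast
    moreover have "u (\<lambda>y. vec_nth (s' y) j) = u (\<lambda>y. vec_nth (\<gamma> (s y)) j)"
      by (rule tangent_cong[OF x(2) W(1) x(1)]) (simp add: W)
    moreover have "(\<lambda>z. vec_nth (\<gamma> z) j) differentiable (at (s x))" using g differentiableI by blast
    ultimately show ?thesis
      using tangent_chain_rule[OF x(2) submersion_open[OF F(1)] _ submersion_smooth[OF F(1)], of "\<lambda>z. vec_nth (\<gamma> z) j"]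
        W x fun_cong[OF frechet_derivative_at[OF g], of "differential s u"] by auto
  qed
  then show ?thesis unfolding differential_def by (simp add: Finite_Cartesian_Product.vec_eq_iff)
qed

text \<open>A single submersion decides verticality, because the differential of any other one factors through its
  differential.\<close>

lemma vert_space_iff:
  assumes "(U, s) \<in> F" "x \<in> U"
  shows "u \<in> vert_sp x \<longleftrightarrow> u \<in> T x \<and> differential s u = 0"
proof (intro iffI conjI)
  assume "u \<in> vert_sp x"
  then show "u \<in> T x" "differential s u = 0" using assms unfolding vert_space_def by auto
next
  assume u: "u \<in> T x \<and> differential s u = 0"
  have "differential s' u = 0" if F': "(U', s') \<in> F" "x \<in> U'" for U' s'
  proof -
    obtain P \<gamma> W where t: "open P" "smooth_on P \<gamma>" "open W" "x \<in> W" "W \<subseteq> U \<inter> U'" "s ` W \<subseteq> P"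
        "\<And>y. y \<in> W \<Longrightarrow> s' y = \<gamma> (s y)"
      by (rule transition_exists[OF assms(1) F'(1) assms(2) F'(2)]) blast
    have "\<gamma> differentiable (at (s x))" using smooth_on_differentiable[OF t(2)] t by blast
    then have "frechet_derivative \<gamma> (at (s x)) 0 = 0" using linear_frechet_derivative linear_0 by blast
    then show ?thesis
      using transition_differential[OF assms(1) F'(1) t(1,2,3,5,6,7,4)] u by simp
  qed
  then show "u \<in> vert_sp x" using u unfolding vert_space_def by auto
qed

lemma vert_tangent: "u \<in> vert_sp x \<Longrightarrow> u \<in> T x"
  unfolding vert_space_def by blast

lemma hor_tangent: "u \<in> hor_sp x \<Longrightarrow> u \<in> T x"
  unfolding hor_space_def by blast

lemma hor_vert_orthogonal: "u \<in> hor_sp x \<Longrightarrow> v \<in> vert_sp x \<Longrightarrow> g x u v = 0"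
  unfolding hor_space_def by blast

lemma vert_hor_orthogonal: "u \<in> hor_sp x \<Longrightarrow> v \<in> vert_sp x \<Longrightarrow> g x v u = 0"
  using hor_vert_orthogonal g_sym hor_tangent vert_tangent by metis

lemma vert_lincomb_sum: "(\<And>i. i \<in> I \<Longrightarrow> u i \<in> vert_sp x) \<Longrightarrow> (\<lambda>f. \<Sum>i\<in>I. a i * u i f) \<in> vert_sp x"
proof -
  assume u: "\<And>i. i \<in> I \<Longrightarrow> u i \<in> vert_sp x"
  obtain U s where s: "(U, s) \<in> F" "x \<in> U" using submersion_exists .
  show ?thesis using u tangent_lincomb_sum[of I u x a]
    by (simp add: vert_space_iff[OF s] differential_lincomb)
qed

lemma differential_lincomb2:
  "differential s (\<lambda>f. a * u f + b * v f) = a *\<^sub>R differential s u + b *\<^sub>R differential s v"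
  unfolding differential_def by (simp add: Finite_Cartesian_Product.vec_eq_iff)

lemma differential_minus: "differential s (\<lambda>f. u f - v f) = differential s u - differential s v"
  unfolding differential_def by (simp add: Finite_Cartesian_Product.vec_eq_iff)

lemma vert_scale: "u \<in> vert_sp x \<Longrightarrow> (\<lambda>f. a * u f) \<in> vert_sp x"
  using vert_lincomb_sum[of "{()}" "\<lambda>_. u" x "\<lambda>_. a"] by simp

lemma vert_minus: "u \<in> vert_sp x \<Longrightarrow> v \<in> vert_sp x \<Longrightarrow> (\<lambda>f. u f - v f) \<in> vert_sp x"
  using vert_lincomb_sum[of "UNIV :: bool set" "\<lambda>b. if b then u else v" x "\<lambda>b. if b then 1 else - 1"]
  by (simp add: UNIV_bool)

lemma hor_lincomb_sum: "(\<And>i. i \<in> I \<Longrightarrow> u i \<in> hor_sp x) \<Longrightarrow> (\<lambda>f. \<Sum>i\<in>I. a i * u i f) \<in> hor_sp x"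
  unfolding hor_space_def using vert_tangent by (auto simp: g_sum_left intro!: tangent_lincomb_sum)

lemma hor_minus: "u \<in> hor_sp x \<Longrightarrow> v \<in> hor_sp x \<Longrightarrow> (\<lambda>f. u f - v f) \<in> hor_sp x"
  using hor_lincomb_sum[of "UNIV :: bool set" "\<lambda>b. if b then u else v" x "\<lambda>b. if b then 1 else - 1"]
  by (simp add: UNIV_bool)

lemma vert_hor_zero: "u \<in> vert_sp x \<Longrightarrow> u \<in> hor_sp x \<Longrightarrow> u = (\<lambda>f. 0)"
  using hor_vert_orthogonal g_eq_zero vert_tangent by blast

lemma vert_zero: "(\<lambda>f. 0) \<in> vert_sp x"
  using vert_lincomb_sum[of "{}"] by simp

subsection \<open>Lifts of the coordinate fields of the leaf space\<close>

definition lifts :: "('m \<Rightarrow> 'q rvec) \<Rightarrow> 'm set \<Rightarrow> ('q \<Rightarrow> 'm vfield) \<Rightarrow> bool" where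
  "lifts s U X \<longleftrightarrow> (\<forall>a. vf U (X a)) \<and> (\<forall>x\<in>U. \<forall>a. differential s (X a x) = axis a 1)"

text \<open>Extend preimages of the standard basis at \<open>x\<close> to vector fields \<open>E a\<close>.  The matrix of the
  differential in these fields is the identity at \<open>x\<close>, so it can be inverted nearby by Cramer's rule,
  which shows that the inverse is smooth.\<close>

lemma lifts_exist:
  assumes s: "(U0, s) \<in> F" "x \<in> U0"
  obtains U X where "open U" "x \<in> U" "U \<subseteq> U0" "lifts s U X"
proof -
  obtain u where u: "\<And>a. u a \<in> T x" "\<And>a. differential s (u a) = axis a 1"
    by (rule lifts_at_point[OF s]) blast
  have "\<exists>W E. open W \<and> x \<in> W \<and> vf W E \<and> E x = u a" for a using tangent_extend[OF u(1)] by metis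
  then obtain W E where E: "\<And>a. open (W a)" "\<And>a. x \<in> W a" "\<And>a. vf (W a) (E a)" "\<And>a. E a x = u a"
    by metis
  define U1 where "U1 = U0 \<inter> (\<Inter>a. W a)"
  have "open U1" unfolding U1_def using E(1) submersion_open[OF s(1)] by (intro open_Int open_INT) auto
  moreover have "vf U1 (E a)" for a by (rule vf_subset[OF E(3)]) (auto simp: U1_def)
  ultimately have U1: "open U1" "x \<in> U1" "U1 \<subseteq> U0" "\<And>a. vf U1 (E a)"
    using E(2) s(2) by (auto simp: U1_def)
  define M :: "'m \<Rightarrow> 'q rvec^'q::{finite,linorder}" where "M y = (\<chi> j a. vec_nth (differential s (E a y)) j)" for y
  have M: "smooth U1 (\<lambda>y. vec_nth (vec_nth (M y) j) a)" for j a
    using differential_smooth[OF s(1) U1(1,3,4)] by (simp add: M_def)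
  have sdet: "smooth U1 (\<lambda>y. Determinants.det (K y))"
    if "\<And>i j. smooth U1 (\<lambda>y. vec_nth (vec_nth (K y) i) j)" for K :: "'m \<Rightarrow> 'q rvec^'q::{finite,linorder}"
    unfolding Determinants.det_def using that
    by (intro smooth_sum smooth_mult smooth_const smooth_prod U1)
  have "M x = Finite_Cartesian_Product.mat 1"
    by (simp add: M_def E u axis_def Finite_Cartesian_Product.mat_def Finite_Cartesian_Product.vec_eq_iff)
  then have "Determinants.det (M x) > 0" by simp
  then obtain U where U: "open U" "x \<in> U" "U \<subseteq> U1" "\<And>y. y \<in> U \<Longrightarrow> Determinants.det (M y) > 0"
    using positive_nearby[OF U1(1) sdet[OF M] U1(2)] by blast
  define h where "h b k y = Determinants.det (\<chi> i j. if j = k then vec_nth (axis b 1) i else vec_nth (vec_nth (M y) i) j)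
    * Determinants.det (M y) powr (-1)" for b k y
  have h: "smooth U (h b k)" for b k
  proof -
    have "smooth U1 (\<lambda>y. vec_nth (vec_nth (\<chi> i j. if j = k then vec_nth (axis b 1) i
        else vec_nth (vec_nth (M y) i) j) i) j)" for i j
      by (cases "j = k") (simp_all add: M smooth_const)
    from smooth_subset[OF sdet[OF this] U(3)] show ?thesis
      unfolding h_def by (intro smooth_mult U smooth_powr smooth_subset[OF sdet[OF M] U(3)])
  qed
  have inv: "M y *v (\<chi> k. h b k y) = axis b 1" if "y \<in> U" for y b
  proof -
    have "(\<chi> k. h b k y) = (\<chi> k. Determinants.det (\<chi> i j. if j = k then vec_nth (axis b 1) i else vec_nth (vec_nth (M y) i) j)
        / Determinants.det (M y))"
      using U(4)[OF that] by (simp add: h_def powr_minus divide_inverse)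
    then show ?thesis using cramer[of "M y" "\<chi> k. h b k y" "axis b 1"] U(4)[OF that] by simp
  qed
  define X where "X b = (\<lambda>y f. \<Sum>a\<in>UNIV. h b a y * E a y f)" for b
  have "vf U (X b)" for b
    unfolding X_def by (intro vf_lincomb U h) (use U1 U vf_subset in blast)
  moreover have "differential s (X b y) = axis b 1" if "y \<in> U" for b y
  proof -
    have "differential s (X b y) = (\<Sum>a\<in>UNIV. h b a y *\<^sub>R differential s (E a y))"
      unfolding X_def by (rule differential_lincomb)
    also have "\<dots> = M y *v (\<chi> k. h b k y)"
      by (simp add: M_def matrix_vector_mult_def Finite_Cartesian_Product.vec_eq_iff mult.commute)
    finally show ?thesis using inv[OF that] by simp
  qed
  ultimately show ?thesis using that[of U X] U U1 unfolding lifts_def by blast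
qed

subsection \<open>Orthonormal vertical frames\<close>

definition vertical_orthonormal :: "nat \<Rightarrow> 'm \<Rightarrow> (nat \<Rightarrow> 'm tvec) \<Rightarrow> bool" where
  "vertical_orthonormal k x v \<longleftrightarrow> (\<forall>i<k. v i \<in> vert_sp x) \<and>
     (\<forall>i<k. \<forall>j<k. g x (v i) (v j) = (if i = j then 1 else 0))"

definition vertical_frame :: "nat \<Rightarrow> 'm set \<Rightarrow> (nat \<Rightarrow> 'm vfield) \<Rightarrow> bool" where
  "vertical_frame k U V \<longleftrightarrow> (\<forall>i<k. vf U (V i)) \<and> (\<forall>x\<in>U. vertical_orthonormal k x (\<lambda>i. V i x))"

lemma vertical_orthonormalD:
  assumes "vertical_orthonormal k x v"
  shows "i < k \<Longrightarrow> v i \<in> vert_sp x" "i < k \<Longrightarrow> v i \<in> T x"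
    "i < k \<Longrightarrow> j < k \<Longrightarrow> g x (v i) (v j) = (if i = j then 1 else 0)"
  using assms vert_tangent unfolding vertical_orthonormal_def by auto

text \<open>Subtracting the lift of \<open>differential s u\<close> makes a vector vertical, and subtracting its components along the
  orthonormal vectors \<open>v\<close> is one step of the Gram-Schmidt process.\<close>

definition remainder :: "('m \<Rightarrow> 'q rvec) \<Rightarrow> 'm \<Rightarrow> nat \<Rightarrow> ('q \<Rightarrow> 'm tvec) \<Rightarrow> (nat \<Rightarrow> 'm tvec) \<Rightarrow> 'm tvec \<Rightarrow> 'm tvec" where
  "remainder s x k X v u =
    (let w = (\<lambda>f. u f - (\<Sum>a\<in>UNIV. vec_nth (differential s u) a * X a f))
     in (\<lambda>f. w f - (\<Sum>i<k. g x w (v i) * v i f)))"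

lemma remainder_props:
  assumes s: "(U, s) \<in> F" "x \<in> U" and v: "vertical_orthonormal k x v"
    and X: "\<And>a. X a \<in> T x" "\<And>a. differential s (X a) = axis a 1" and u: "u \<in> T x"
  shows "remainder s x k X v u \<in> vert_sp x" "i < k \<Longrightarrow> g x (remainder s x k X v u) (v i) = 0"
proof -
  define w where "w = (\<lambda>f. u f - (\<Sum>a\<in>UNIV. vec_nth (differential s u) a * X a f))"
  have r: "remainder s x k X v u = (\<lambda>f. w f - (\<Sum>i<k. g x w (v i) * v i f))"
    unfolding remainder_def w_def Let_def ..
  have "(\<Sum>a\<in>UNIV. vec_nth (differential s u) a *\<^sub>R axis a 1) = differential s u"
    using basis_expansion[of "differential s u"] by (simp add: scalar_mult_eq_scaleR)
  then have "differential s w = 0"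
    unfolding w_def differential_minus differential_lincomb by (simp add: X)
  moreover have "w \<in> T x"
    unfolding w_def by (intro tangent_minus u tangent_lincomb_sum X)
  ultimately have w: "w \<in> vert_sp x" using vert_space_iff[OF s] by blast
  have S: "(\<lambda>f. \<Sum>i<k. g x w (v i) * v i f) \<in> vert_sp x"
    by (rule vert_lincomb_sum) (use vertical_orthonormalD[OF v] in auto)
  then show "remainder s x k X v u \<in> vert_sp x" unfolding r using vert_minus w by blast
  assume i: "i < k"
  have "g x (\<lambda>f. \<Sum>j<k. g x w (v j) * v j f) (v i) = (\<Sum>j<k. g x w (v j) * g x (v j) (v i))"
    by (rule g_sum_left) (use vertical_orthonormalD[OF v] i in auto)
  also have "\<dots> = (\<Sum>j<k. if j = i then g x w (v i) else 0)"
    using vertical_orthonormalD(3)[OF v] i by (intro sum.cong) auto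
  also have "\<dots> = g x w (v i)" using i by simp
  finally show "g x (remainder s x k X v u) (v i) = 0"
    unfolding r using g_minus[OF vert_tangent[OF w] vert_tangent[OF S]] vertical_orthonormalD(2)[OF v i] by simp
qed

lemma remainder_id:
  assumes "u \<in> vert_sp x" "(U, s) \<in> F" "x \<in> U" "\<And>i. i < k \<Longrightarrow> g x u (v i) = 0"
  shows "remainder s x k X v u = u"
proof -
  have "differential s u = 0" using assms vert_space_iff by blast
  then show ?thesis unfolding remainder_def Let_def using assms(4) by simp
qed

text \<open>Otherwise the remainder of every vector would vanish, and the \<open>n\<close>-dimensional tangent space would be
  spanned by the \<open>k + q < p + q\<close> vectors \<open>v\<close> and \<open>X\<close>.\<close>

lemma vertical_orthonormal_extend:
  assumes v: "vertical_orthonormal k x v" and k: "k < p"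
  obtains u where "u \<in> vert_sp x" "u \<noteq> (\<lambda>f. 0)" "\<And>i. i < k \<Longrightarrow> g x u (v i) = 0"
proof (rule ccontr)
  assume no: "\<not> thesis"
  obtain U s where s: "(U, s) \<in> F" "x \<in> U" using submersion_exists .
  obtain W c where c: "(W, c) \<in> A" "x \<in> W" using chart_exists .
  obtain X where X: "\<And>a. X a \<in> T x" "\<And>a. differential s (X a) = axis a 1" by (rule lifts_at_point[OF s]) blast
  let ?B = "(\<lambda>i. differential c (v i)) ` {..<k} \<union> range (\<lambda>a. differential c (X a))"
  have "z \<in> span ?B" for z
  proof -
    define u where "u = coord_vector A (W, c) x z"
    have u: "u \<in> T x" "differential c u = z"
      unfolding u_def using tangent_space_chart[OF c] differential_coord_vector[OF c] by auto
    have "remainder s x k X v u = (\<lambda>f. 0)"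
      using no that remainder_props[OF s v X u(1)] by blast
    then obtain w where w: "w = (\<lambda>f. u f - (\<Sum>a\<in>UNIV. vec_nth (differential s u) a * X a f))"
      "(\<lambda>f. w f - (\<Sum>i<k. g x w (v i) * v i f)) = (\<lambda>f. 0)"
      unfolding remainder_def Let_def by blast
    have "w = (\<lambda>f. \<Sum>i<k. g x w (v i) * v i f)" using w(2) by (simp add: fun_eq_iff)
    from arg_cong[OF this, of "differential c"]
    have "differential c w = (\<Sum>i<k. g x w (v i) *\<^sub>R differential c (v i))"
      by (simp only: differential_lincomb)
    moreover have "differential c w = z - (\<Sum>a\<in>UNIV. vec_nth (differential s u) a *\<^sub>R differential c (X a))"
      unfolding w(1) differential_minus differential_lincomb u ..
    ultimately have z: "z = (\<Sum>i<k. g x w (v i) *\<^sub>R differential c (v i))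
        + (\<Sum>a\<in>UNIV. vec_nth (differential s u) a *\<^sub>R differential c (X a))"
      by (metis diff_add_cancel)
    show ?thesis by (subst z) (intro span_add span_sum span_scale span_base; blast)
  qed
  then have "dim (UNIV :: ('n rvec) set) \<le> card ?B" by (intro dim_le_card) auto
  also have "card ?B \<le> k + CARD('q)"
    by (intro order_trans[OF card_Un_le] add_mono order_trans[OF card_image_le]) auto
  finally show False using k dim_split by (simp add: dim_UNIV)
qed

text \<open>A further orthogonal vector \<open>u\<close> would make the \<open>p + 1 + q\<close> vectors \<open>v\<close>, \<open>u\<close> and \<open>X\<close> independent in a
  space of dimension \<open>p + q\<close>.\<close>

lemma vertical_orthonormal_complete:
  assumes v: "vertical_orthonormal p x v" and u: "u \<in> vert_sp x" "\<And>i. i < p \<Longrightarrow> g x u (v i) = 0"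
  shows "u = (\<lambda>f. 0)"
proof (rule ccontr)
  assume u0: "u \<noteq> (\<lambda>f. 0)"
  obtain U s where s: "(U, s) \<in> F" "x \<in> U" using submersion_exists .
  obtain W c where c: "(W, c) \<in> A" "x \<in> W" using chart_exists .
  obtain X where X: "\<And>a. X a \<in> T x" "\<And>a. differential s (X a) = axis a 1" by (rule lifts_at_point[OF s]) blast
  define e where "e i = (if i < p then v i else u)" for i
  have e: "e i \<in> vert_sp x" "e i \<in> T x" for i
    using u vert_tangent vertical_orthonormalD[OF v] unfolding e_def by auto
  have eo: "g x (e i) (e j) = 0" if "i \<le> p" "j \<le> p" "i \<noteq> j" for i j
  proof -
    have "g x (v i) u = 0" if "i < p" for i
      using u(2)[OF that] g_sym[OF vert_tangent[OF u(1)]] vertical_orthonormalD(2)[OF v that] by metis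
    then show ?thesis using that u(2) vertical_orthonormalD(3)[OF v] unfolding e_def by auto
  qed
  have en: "g x (e i) (e i) \<noteq> 0" for i
    using g_pos[OF vert_tangent[OF u(1)] u0] vertical_orthonormalD(3)[OF v] unfolding e_def by auto
  let ?I = "{..p} <+> (UNIV :: 'q set)"
  let ?e = "case_sum (\<lambda>i. differential c (e i)) (\<lambda>a. differential c (X a))"
  have "card ?I \<le> CARD('n)"
  proof (rule independent_family_bound[of _ ?e])
    fix z i assume z: "(\<Sum>i\<in>?I. z i *\<^sub>R ?e i) = 0" and i: "i \<in> ?I"
    define w where "w = (\<lambda>f. (\<Sum>i\<le>p. z (Inl i) * e i f) + (\<Sum>a\<in>UNIV. z (Inr a) * X a f))"
    have wT: "w \<in> T x" unfolding w_def by (intro tangent_plus tangent_lincomb_sum e X)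
    have dw: "differential t w = (\<Sum>i\<le>p. z (Inl i) *\<^sub>R differential t (e i))
        + (\<Sum>a\<in>UNIV. z (Inr a) *\<^sub>R differential t (X a))" for t :: "'m \<Rightarrow> real^'k"
      unfolding w_def using differential_lincomb2[of t 1 _ 1] by (simp add: differential_lincomb)
    have "differential c w = 0" using z by (simp add: dw sum.Plus)
    then have "differential c w = differential c (\<lambda>f. 0 :: real)"
      by (simp add: differential_def Finite_Cartesian_Product.vec_eq_iff)
    then have w0: "w = (\<lambda>f. 0)" using tangent_eqI[OF wT tangent_zero c] by blast
    have "differential s w = (\<Sum>a\<in>UNIV. z (Inr a) *\<^sub>R axis a 1)"
      using e vert_space_iff[OF s] by (simp add: dw X)
    also have "\<dots> = (\<chi> a. z (Inr a))"
      using basis_expansion[of "\<chi> a. z (Inr a)"] by (simp add: scalar_mult_eq_scaleR)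
    finally have "(\<chi> a. z (Inr a)) = 0"
      by (simp add: w0 differential_def Finite_Cartesian_Product.vec_eq_iff)
    then have za: "z (Inr a) = 0" for a by (simp add: Finite_Cartesian_Product.vec_eq_iff)
    then have w1: "(\<lambda>f. \<Sum>i\<le>p. z (Inl i) * e i f) = (\<lambda>f. 0)" using w0 unfolding w_def by simp
    have "z (Inl j) = 0" if j: "j \<le> p" for j
    proof -
      have "0 = g x (\<lambda>f. \<Sum>i\<le>p. z (Inl i) * e i f) (e j)" using w1 g_zero_left e by simp
      also have "\<dots> = (\<Sum>i\<le>p. z (Inl i) * g x (e i) (e j))" by (rule g_sum_left) (use e in auto)
      also have "\<dots> = (\<Sum>i\<le>p. if i = j then z (Inl j) * g x (e j) (e j) else 0)"
        using eo j by (intro sum.cong) auto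
      finally show ?thesis using j en by simp
    qed
    then show "z i = 0" using i za by auto
  qed simp
  then show False using dim_split by (simp add: card_Plus)
qed

lemma vertical_expansion:
  assumes v: "vertical_orthonormal p x v" and u: "u \<in> vert_sp x"
  shows "u = (\<lambda>f. \<Sum>i<p. g x u (v i) * v i f)"
proof -
  obtain U s where s: "(U, s) \<in> F" "x \<in> U" using submersion_exists .
  obtain X where X: "\<And>a. X a \<in> T x" "\<And>a. differential s (X a) = axis a 1" by (rule lifts_at_point[OF s]) blast
  have "remainder s x p X v u = (\<lambda>f. 0)"
    using vertical_orthonormal_complete[OF v remainder_props[OF s v X vert_tangent[OF u]]] .
  moreover have "differential s u = 0" using u vert_space_iff[OF s] by blast
  ultimately show ?thesis unfolding remainder_def Let_def by (simp add: fun_eq_iff)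
qed

text \<open>The Gram-Schmidt process: a vertical vector orthogonal to the frame at \<open>x\<close> is extended to a field, whose
  remainder is vertical and orthogonal to the frame, still nonzero near \<open>x\<close>, and can be normalised there.\<close>

lemma vertical_frame_exists:
  assumes s: "(U0, s) \<in> F" and U0: "open U1" "x \<in> U1" "U1 \<subseteq> U0" and X: "lifts s U1 X" and k: "k \<le> p"
  shows "\<exists>U V. open U \<and> x \<in> U \<and> U \<subseteq> U1 \<and> vertical_frame k U V"
  using k
proof (induction k)
  case 0
  then show ?case using U0 by (auto simp: vertical_frame_def vertical_orthonormal_def)
next
  case (Suc k)
  then obtain U V where U: "open U" "x \<in> U" "U \<subseteq> U1" and V: "vertical_frame k U V" by auto
  have Vx: "vertical_orthonormal k y (\<lambda>i. V i y)" if "y \<in> U" for y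
    using V that unfolding vertical_frame_def by blast
  have Vv: "vf U (V i)" if "i < k" for i using V that unfolding vertical_frame_def by blast
  obtain u where u: "u \<in> vert_sp x" "u \<noteq> (\<lambda>f. 0)" "\<And>i. i < k \<Longrightarrow> g x u (V i x) = 0"
    using vertical_orthonormal_extend[OF Vx[OF U(2)]] Suc.prems by (metis Suc_le_eq)
  obtain W E where E: "open W" "x \<in> W" "vf W E" "E x = u" using tangent_extend[OF vert_tangent[OF u(1)]] .
  define U' where "U' = U \<inter> W"
  have U': "open U'" "x \<in> U'" "U' \<subseteq> U" "U' \<subseteq> U1" "vf U' E" "U' \<subseteq> U0"
    using U U0 E vf_subset[OF E(3)] by (auto simp: U'_def)
  have X': "vf U' (X a)" for a using X U'(4) vf_subset unfolding lifts_def by blast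
  have V': "vf U' (V i)" if "i < k" for i using Vv[OF that] U'(3) vf_subset by blast
  define E1 where "E1 = (\<lambda>y f. E y f - (\<Sum>a\<in>UNIV. vec_nth (differential s (E y)) a * X a y f))"
  define E2 where "E2 = (\<lambda>y f. E1 y f - (\<Sum>i<k. g y (E1 y) (V i y) * V i y f))"
  have d: "smooth U' (\<lambda>y. vec_nth (differential s (E y)) a)" for a
    using differential_smooth[OF s U'(1,6,5)] .
  have E1: "vf U' E1" unfolding E1_def by (intro vf_diff vf_lincomb U' X' d)
  have E2: "vf U' E2" unfolding E2_def
    by (intro vf_diff vf_lincomb U'(1) E1 g_smooth) (auto intro: V')
  have rem: "E2 y = remainder s y k (\<lambda>a. X a y) (\<lambda>i. V i y) (E y)" for y
    unfolding E2_def E1_def remainder_def Let_def ..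
  have E2v: "E2 y \<in> vert_sp y" "i < k \<Longrightarrow> g y (E2 y) (V i y) = 0" if "y \<in> U'" for y i
    unfolding rem
    using remainder_props[OF s _ Vx _ _ vf_tangent[OF U'(5)], of y "\<lambda>a. X a y"] that U' X X'[THEN vf_tangent]
    unfolding lifts_def by blast+
  have "E2 x = u" unfolding rem E(4) using remainder_id[of u x U0 s k "\<lambda>i. V i x"] u s U'(2,6) by blast
  then have "g x (E2 x) (E2 x) > 0" using g_pos[OF vert_tangent[OF u(1)] u(2)] by simp
  then obtain U'' where U'': "open U''" "x \<in> U''" "U'' \<subseteq> U'" "\<And>y. y \<in> U'' \<Longrightarrow> g y (E2 y) (E2 y) > 0"
    using positive_nearby[OF U'(1) g_smooth[OF U'(1) E2 E2] U'(2)] by blast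
  define h where "h y = g y (E2 y) (E2 y) powr (-1/2)" for y
  have "smooth U'' h" unfolding h_def
    by (intro smooth_powr U'' g_smooth vf_subset[OF E2])
  then have nv: "vf U'' (\<lambda>y f. h y * E2 y f)" using vf_scale[OF U''(1)] vf_subset[OF E2 U''(3)] by blast
  define V2 where "V2 = V(k := (\<lambda>y f. h y * E2 y f))"
  have "vertical_orthonormal (Suc k) y (\<lambda>i. V2 i y)" if y: "y \<in> U''" for y
  proof -
    have yU: "y \<in> U" "y \<in> U'" using y U'' U' by auto
    note vy = vertical_orthonormalD[OF Vx[OF yU(1)]]
    have e: "E2 y \<in> T y" "(\<lambda>f. h y * E2 y f) \<in> T y"
      using E2v(1)[OF yU(2)] vert_tangent tangent_scale by blast+
    have 1: "g y (\<lambda>f. h y * E2 y f) (V i y) = 0" if "i < k" for i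
      using g_scale[OF e(1) vy(2)[OF that]] E2v(2)[OF yU(2) that] by simp
    then have 2: "g y (V i y) (\<lambda>f. h y * E2 y f) = 0" if "i < k" for i
      using g_sym[OF e(2) vy(2)[OF that]] that by simp
    have "h y * h y * g y (E2 y) (E2 y) = 1"
      using U''(4)[OF y] unfolding h_def powr_add[symmetric] by (simp add: powr_minus)
    then have 3: "g y (\<lambda>f. h y * E2 y f) (\<lambda>f. h y * E2 y f) = 1"
      using g_scale[OF e(1,2)] g_scale[OF e(1,1)] g_sym[OF e] by simp
    show ?thesis
      unfolding vertical_orthonormal_def V2_def
      using vy 1 2 3 vert_scale[OF E2v(1)[OF yU(2)]] by (auto simp: less_Suc_eq)
  qed
  moreover have "vf U'' (V2 i)" if "i < Suc k" for i
    using that nv V' vf_subset[OF _ U''(3)] unfolding V2_def by (auto simp: less_Suc_eq)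
  ultimately have "vertical_frame (Suc k) U'' V2" unfolding vertical_frame_def by blast
  then show ?case using U'' U' by blast
qed

subsection \<open>Orthogonal projections\<close>

lemma vert_hor_decomposition:
  assumes v: "vertical_orthonormal p x v" and u: "u \<in> T x"
  shows "(\<lambda>f. \<Sum>i<p. g x u (v i) * v i f) \<in> vert_sp x"
    "(\<lambda>f. u f - (\<Sum>i<p. g x u (v i) * v i f)) \<in> hor_sp x"
proof -
  note v' = vertical_orthonormalD[OF v]
  show S: "(\<lambda>f. \<Sum>i<p. g x u (v i) * v i f) \<in> vert_sp x"
    by (rule vert_lincomb_sum) (use v' in auto)
  have "g x (\<lambda>f. u f - (\<Sum>i<p. g x u (v i) * v i f)) w = 0" if w: "w \<in> vert_sp x" for w
  proof -
    have wT: "w \<in> T x" using vert_tangent[OF w] .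
    have "g x u w = g x u (\<lambda>f. \<Sum>i<p. g x w (v i) * v i f)" using vertical_expansion[OF v w] by simp
    also have "\<dots> = (\<Sum>i<p. g x w (v i) * g x u (v i))" by (rule g_sum_right) (use v' u in auto)
    also have "\<dots> = (\<Sum>i<p. g x u (v i) * g x (v i) w)"
      by (rule sum.cong) (use g_sym[OF wT v'(2)] in auto)
    also have "\<dots> = g x (\<lambda>f. \<Sum>i<p. g x u (v i) * v i f) w" by (rule g_sum_left[symmetric]) (use v' wT in auto)
    finally show ?thesis using g_minus[OF u vert_tangent[OF S] wT] by simp
  qed
  then show "(\<lambda>f. u f - (\<Sum>i<p. g x u (v i) * v i f)) \<in> hor_sp x"
    unfolding hor_space_def using tangent_minus[OF u vert_tangent[OF S]] by blast
qed

text \<open>Vertical and horizontal vectors meet in 0 only, which makes the description in the definition of the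
  projection unique.\<close>

lemma vert_eqI:
  assumes "u \<in> vert_sp x" "(\<lambda>f. E x f - u f) \<in> hor_sp x"
  shows "vert A F g E x = u"
  unfolding vert_def
proof (rule the_equality)
  fix w assume w: "w \<in> vert_sp x \<and> (\<lambda>f. E x f - w f) \<in> hor_sp x"
  have "(\<lambda>f. (E x f - w f) - (E x f - u f)) \<in> hor_sp x" using hor_minus w assms by blast
  moreover have "(\<lambda>f. u f - w f) \<in> vert_sp x" using vert_minus w assms by blast
  ultimately have "(\<lambda>f. u f - w f) = (\<lambda>f. 0)" by (intro vert_hor_zero) auto
  then show "w = u" by (simp add: fun_eq_iff)
qed (use assms in blast)

lemma vert_eq:
  assumes "vertical_orthonormal p x v" "E x \<in> T x"
  shows "vert A F g E x = (\<lambda>f. \<Sum>i<p. g x (E x) (v i) * v i f)"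
  using vert_eqI vert_hor_decomposition[OF assms] by blast

end

section \<open>Determinants of matrices given by their entries\<close>

abbreviation ndet :: "nat \<Rightarrow> (nat \<Rightarrow> nat \<Rightarrow> real) \<Rightarrow> real" where
  "ndet n M \<equiv> Determinant.det (mat n n (\<lambda>(i, j). M i j))"

lemma ndet_cong: "(\<And>i j. i < n \<Longrightarrow> j < n \<Longrightarrow> M i j = N i j) \<Longrightarrow> ndet n M = ndet n N"
  by (rule arg_cong[where f = Determinant.det]) (auto intro!: eq_matI)

lemma ndet_mult: "ndet n (\<lambda>i j. \<Sum>l<n. M i l * N l j) = ndet n M * ndet n N"
proof -
  have "mat n n (\<lambda>(i, j). \<Sum>l<n. M i l * N l j) = mat n n (\<lambda>(i, j). M i j) * mat n n (\<lambda>(i, j). N i j)"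
    by (rule eq_matI) (auto simp: scalar_prod_def atLeast0LessThan)
  then show ?thesis using det_mult[of "mat n n (\<lambda>(i, j). M i j)" n "mat n n (\<lambda>(i, j). N i j)"] by simp
qed

lemma ndet_transpose: "ndet n (\<lambda>i j. M j i) = ndet n M"
proof -
  have "mat n n (\<lambda>(i, j). M j i) = transpose_mat (mat n n (\<lambda>(i, j). M i j))"
    by (rule eq_matI) auto
  then show ?thesis using det_transpose[of "mat n n (\<lambda>(i, j). M i j)" n] by simp
qed

lemma ndet_id: "ndet n (\<lambda>i j. if i = j then 1 else 0) = 1"
proof -
  have "mat n n (\<lambda>(i, j). if i = j then 1 else 0) = (1\<^sub>m n :: real mat)" by (rule eq_matI) auto
  then show ?thesis by simp
qed

text \<open>The shape of the change of basis below: vertical vectors have no components along the lifts.\<close>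

lemma ndet_block:
  "ndet (m + k) (\<lambda>i j. if i < m then if j < m then M i j else 0 else if j < m then N i j else K (i - m) (j - m))
    = ndet m M * ndet k K"
proof -
  let ?B = "four_block_mat (mat m m (\<lambda>(i, j). M i j)) (0\<^sub>m m k) (mat k m (\<lambda>(i, j). N (i + m) j)) (mat k k (\<lambda>(i, j). K i j))"
  have "mat (m + k) (m + k) (\<lambda>(i, j). if i < m then if j < m then M i j else 0
      else if j < m then N i j else K (i - m) (j - m)) = ?B"
    by (rule eq_matI) auto
  moreover have "Determinant.det ?B = ndet m M * ndet k K"
    by (rule det_four_block_mat_upper_right_zero) auto
  ultimately show ?thesis by simp
qed

lemma ndet_scale_row: "k < n \<Longrightarrow> ndet n (\<lambda>i j. if i = k then a * M i j else M i j) = a * ndet n M"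
proof -
  assume k: "k < n"
  have "mat n n (\<lambda>(i, j). if i = k then a * M i j else M i j) = multrow k a (mat n n (\<lambda>(i, j). M i j))"
    by (rule eq_matI) auto
  then show ?thesis using det_multrow[OF k, of "mat n n (\<lambda>(i, j). M i j)" a] by simp
qed

lemma bij_coord_index: "bij_betw (coord_index :: nat \<Rightarrow> 'k::{finite,linorder}) {0..<CARD('k)} UNIV"
proof -
  let ?l = "sorted_list_of_set (UNIV :: 'k set)"
  have "bij_betw ((!) ?l) {..<length ?l} (set ?l)"
    by (rule bij_betw_nth) auto
  then show ?thesis by (simp add: coord_index_def[abs_def] atLeast0LessThan)
qed

lemma sum_coord_index: "(\<Sum>i<CARD('k). f (coord_index i :: 'k::{finite,linorder})) = (\<Sum>a\<in>UNIV. f a)"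
  using sum.reindex_bij_betw[OF bij_coord_index, of f] by (simp add: atLeast0LessThan)

lemma coord_index_eq_iff: "i < CARD('k) \<Longrightarrow> j < CARD('k) \<Longrightarrow>
    (coord_index i :: 'k::{finite,linorder}) = coord_index j \<longleftrightarrow> i = j"
  using bij_betw_imp_inj_on[OF bij_coord_index, THEN inj_onD, of i j] by auto

text \<open>Jacobians are determinants of matrices indexed by types, orientations are given by matrices indexed by
  numbers.  The enumeration \<open>coord_index\<close> conjugates the permutations of one index set into those of the other
  and preserves their signs.\<close>

lemma det_eq_ndet:
  fixes M :: "real^'k::{finite,linorder}^'k::{finite,linorder}"
  shows "Determinants.det M = ndet CARD('k) (\<lambda>i j. vec_nth (vec_nth M (coord_index i)) (coord_index j))"
proof -
  let ?A = "{0..<CARD('k)}" and ?c = "coord_index :: nat \<Rightarrow> 'k"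
  let ?\<phi> = "\<lambda>\<pi> x. if x \<in> (UNIV :: 'k set) then ?c (\<pi> (inv_into ?A ?c x)) else x"
  have bij: "bij_betw ?\<phi> {\<pi>. \<pi> permutes ?A} {\<pi>. \<pi> permutes UNIV}"
    by (rule bij_betw_permutations[OF bij_coord_index])
  have inv: "inv_into ?A ?c (?c i) = i" if "i \<in> ?A" for i
    using that inv_into_f_f[of ?c ?A i] bij_betw_imp_inj_on[OF bij_coord_index[where 'k='k]] by simp
  have "Determinants.det M
      = (\<Sum>P\<in>{\<pi>. \<pi> permutes UNIV}. of_int (sign P) * (\<Prod>i\<in>UNIV. vec_nth (vec_nth M i) (P i)))"
    unfolding Determinants.det_def ..
  also have "\<dots> = (\<Sum>\<pi>\<in>{\<pi>. \<pi> permutes ?A}. of_int (sign (?\<phi> \<pi>)) * (\<Prod>i\<in>UNIV. vec_nth (vec_nth M i) (?\<phi> \<pi> i)))"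
    by (rule sum.reindex_bij_betw[OF bij, symmetric])
  also have "\<dots> = (\<Sum>\<pi>\<in>{\<pi>. \<pi> permutes ?A}. of_int (sign \<pi>) *
      (\<Prod>i=0..<CARD('k). vec_nth (vec_nth M (?c i)) (?c (\<pi> i))))"
  proof (rule sum.cong[OF refl])
    fix \<pi> assume "\<pi> \<in> {\<pi>. \<pi> permutes ?A}"
    then have \<pi>: "\<pi> permutes ?A" by simp
    have "?\<phi> \<pi> = map_permutation ?A ?c \<pi>"
      using bij_coord_index[where 'k='k] unfolding map_permutation_def by (auto simp: bij_betw_def restrict_id_def)
    then have "sign (?\<phi> \<pi>) = sign \<pi>"
      using sign_map_permutation[OF bij_betw_imp_inj_on[OF bij_coord_index] \<pi>] by simp
    moreover have "(\<Prod>i\<in>UNIV. vec_nth (vec_nth M i) (?\<phi> \<pi> i))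
        = (\<Prod>i\<in>?A. vec_nth (vec_nth M (?c i)) (?\<phi> \<pi> (?c i)))"
      by (rule prod.reindex_bij_betw[OF bij_coord_index, symmetric])
    moreover have "\<dots> = (\<Prod>i\<in>?A. vec_nth (vec_nth M (?c i)) (?c (\<pi> i)))"
      by (rule prod.cong) (simp_all add: inv)
    ultimately show "of_int (sign (?\<phi> \<pi>)) * (\<Prod>i\<in>UNIV. vec_nth (vec_nth M i) (?\<phi> \<pi> i))
      = of_int (sign \<pi>) * (\<Prod>i=0..<CARD('k). vec_nth (vec_nth M (?c i)) (?c (\<pi> i)))" by simp
  qed
  also have "\<dots> = ndet CARD('k) (\<lambda>i j. vec_nth (vec_nth M (?c i)) (?c j))"
    by (subst det_def'[of _ "CARD('k)"]) (auto simp: permutes_in_image intro!: sum.cong prod.cong)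
  finally show ?thesis .
qed

lemma ndet_linear:
  fixes f :: "real^'k::{finite,linorder} \<Rightarrow> real^'k::{finite,linorder}"
  assumes "linear f"
  shows "ndet CARD('k) (\<lambda>i j. vec_nth (f (w i)) (coord_index j))
    = ndet CARD('k) (\<lambda>i j. vec_nth (w i) (coord_index j)) * Determinants.det (matrix f)"
proof -
  let ?c = "coord_index :: nat \<Rightarrow> 'k"
  have "vec_nth (f z) j = (\<Sum>l<CARD('k). vec_nth z (?c l) * vec_nth (vec_nth (matrix f) j) (?c l))" for z j
  proof -
    have "f z = matrix f *v z" using matrix_works[of f z] assms by simp
    then have "vec_nth (f z) j = (\<Sum>a\<in>UNIV. vec_nth (vec_nth (matrix f) j) a * vec_nth z a)"
      by (simp add: matrix_vector_mult_def)
    then show ?thesis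
      using sum_coord_index[of "\<lambda>a. vec_nth z a * vec_nth (vec_nth (matrix f) j) a"] by (simp add: mult.commute)
  qed
  then show ?thesis
    using ndet_mult[of "CARD('k)" "\<lambda>i l. vec_nth (w i) (?c l)" "\<lambda>l j. vec_nth (vec_nth (matrix f) (?c j)) (?c l)"]
      ndet_transpose[of "CARD('k)" "\<lambda>i j. vec_nth (vec_nth (matrix f) (?c i)) (?c j)"]
    by (simp add: det_eq_ndet)
qed

abbreviation frame_det :: "('m \<Rightarrow> real^'k::{finite,linorder}) \<Rightarrow> (nat \<Rightarrow> 'm tvec) \<Rightarrow> real" where
  "frame_det s e \<equiv> ndet CARD('k) (\<lambda>i j. vec_nth (differential s (e i)) (coord_index j))"

lemma sum_lessThan_add: "(\<Sum>l<m + (k::nat). f l) = (\<Sum>l<m. f l) + (\<Sum>l<k. f (m + l) :: 'a::comm_monoid_add)"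
  by (induction k) (simp_all add: add.assoc)

section \<open>Orientations\<close>

context foliated_manifold
begin

text \<open>Passing to another chart multiplies the determinant by the Jacobian of the transition map, which is
  positive in an oriented atlas.\<close>

lemma positive_basis_iff:
  assumes c: "(W, c) \<in> A" "x \<in> W" and e: "\<And>i. i < CARD('n) \<Longrightarrow> e i \<in> T x"
  shows "positive_basis A x e \<longleftrightarrow> frame_det c e > 0"
    (is "_ \<longleftrightarrow> ?d c > 0")
proof
  assume "positive_basis A x e"
  then obtain W' c' where c': "(W', c') \<in> A" "x \<in> W'" "?d c' > 0"
    unfolding positive_basis_def by blast
  let ?f = "frechet_derivative (\<lambda>z. c (inv_into W' c' z)) (at (c' x))"
  have de: "differential c (e i) = ?f (differential c' (e i))" if i: "i < CARD('n)" for i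
  proof -
    obtain v where v: "e i = coord_vector A (W', c') x v" using tangentE[OF e[OF i] c'(1,2)] .
    then have "e i = coord_vector A (W, c) x (?f v)"
      using coord_vector_change[OF c'(1) c(1) c'(2) c(2), of v] by simp
    then have "differential c (e i) = ?f v" using differential_coord_vector[OF c] by simp
    then show ?thesis using v differential_coord_vector[OF c'(1,2), of v] by simp
  qed
  have "linear ?f"
    using chart_differentiable[OF c'(1,2) chart_open[OF c(1)] c(2) smooth_chart[OF c(1)]]
      linear_frechet_derivative by blast
  have "?d c = ndet CARD('n) (\<lambda>i j. vec_nth (?f (differential c' (e i))) (coord_index j))"
    by (rule ndet_cong) (simp add: de)
  also have "\<dots> = ?d c' * Determinants.det (matrix ?f)"
    by (rule ndet_linear[OF \<open>linear ?f\<close>])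
  also have "Determinants.det (matrix ?f) > 0"
  proof -
    have "\<forall>(W, c)\<in>A. \<forall>(W', c')\<in>A. \<forall>x\<in>W \<inter> W'. jacobian (c' \<circ> inv_into W c) (c x) > 0"
      using oriented unfolding oriented_atlas_def by blast
    then show ?thesis using c c'(1,2) unfolding jacobian_def by (fastforce simp: o_def)
  qed
  then have "?d c' * Determinants.det (matrix ?f) > 0" using c'(3) by simp
  finally show "?d c > 0" .
next
  assume "?d c > 0"
  then show "positive_basis A x e" unfolding positive_basis_def using c by blast
qed

text \<open>The same for the transition maps between the submersions.\<close>

lemma transversely_positive_iff:
  assumes s: "(U, s) \<in> F" "x \<in> U" and z: "\<And>i. i < CARD('q) \<Longrightarrow> z i \<in> T x"
  shows "transversely_positive F x z \<longleftrightarrow>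
    frame_det s z > 0" (is "_ \<longleftrightarrow> ?d s > 0")
proof
  assume "transversely_positive F x z"
  then obtain U' s' where s': "(U', s') \<in> F" "x \<in> U'" "?d s' > 0"
    unfolding transversely_positive_def by blast
  obtain P \<gamma> W where t: "transition_near x (U', s') (U, s) P \<gamma>" "open P" "smooth_on P \<gamma>" "open W" "x \<in> W"
      "W \<subseteq> U' \<inter> U" "s' ` W \<subseteq> P" "\<And>y. y \<in> W \<Longrightarrow> s y = \<gamma> (s' y)"
    by (rule transition_exists[OF s'(1) s(1) s'(2) s(2)]) blast
  let ?f = "frechet_derivative \<gamma> (at (s' x))"
  have "\<gamma> differentiable (at (s' x))" using smooth_on_differentiable[OF t(3)] t by blast
  then have "linear ?f" using linear_frechet_derivative by blast
  have "?d s = ndet CARD('q) (\<lambda>i j. vec_nth (?f (differential s' (z i))) (coord_index j))"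
    using transition_differential[OF s'(1) s(1) t(2,3,4,6,7,8,5)] z by (intro ndet_cong) simp
  also have "\<dots> = ?d s' * Determinants.det (matrix ?f)"
    by (rule ndet_linear[OF \<open>linear ?f\<close>])
  also have "Determinants.det (matrix ?f) > 0"
  proof -
    have "jacobian \<gamma> (snd (U', s') x) > 0"
      using transverse s(1) s'(1) t(1) unfolding transversely_oriented_def by blast
    then show ?thesis unfolding jacobian_def by simp
  qed
  then have "?d s' * Determinants.det (matrix ?f) > 0" using s'(3) by simp
  finally show "?d s > 0" .
next
  assume "?d s > 0"
  then show "transversely_positive F x z" unfolding transversely_positive_def using s by blast
qed

text \<open>The leaf directions come first, as in the orientation convention for the leaves.\<close>

definition full_basis :: "(nat \<Rightarrow> 'm tvec) \<Rightarrow> ('q \<Rightarrow> 'm tvec) \<Rightarrow> nat \<Rightarrow> 'm tvec" where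
  "full_basis v X l = (if l < p then v l else X (coord_index (l - p)))"

lemma full_basis_expansion:
  assumes s: "(U, s) \<in> F" "x \<in> U" and v: "vertical_orthonormal p x v"
    and X: "\<And>a. X a \<in> T x" "\<And>a. differential s (X a) = axis a 1" and u: "u \<in> T x"
  obtains b where "u = (\<lambda>f. \<Sum>l<CARD('n). (if l < p then b l else vec_nth (differential s u) (coord_index (l - p)))
      * full_basis v X l f)"
    "u \<in> vert_sp x \<Longrightarrow> (\<And>l. l < p \<Longrightarrow> b l = g x u (v l))"
proof -
  define w where "w = (\<lambda>f. u f - (\<Sum>a\<in>UNIV. vec_nth (differential s u) a * X a f))"
  have "remainder s x p X v u = (\<lambda>f. 0)"
    using vertical_orthonormal_complete[OF v remainder_props[OF s v X u]] .
  then have w: "w f = (\<Sum>i<p. g x w (v i) * v i f)" for f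
    unfolding remainder_def Let_def w_def[symmetric] by (simp add: fun_eq_iff)
  have "u f = (\<Sum>l<CARD('n). (if l < p then g x w (v l) else vec_nth (differential s u) (coord_index (l - p)))
      * full_basis v X l f)" (is "_ = (\<Sum>l<_. ?t l)") for f
  proof -
    have "(\<Sum>l<CARD('n). ?t l) = (\<Sum>l<p. ?t l) + (\<Sum>l<CARD('q). ?t (p + l))"
      unfolding dim_split by (rule sum_lessThan_add)
    also have "(\<Sum>l<CARD('q). ?t (p + l)) = (\<Sum>a\<in>UNIV. vec_nth (differential s u) a * X a f)"
      using sum_coord_index[of "\<lambda>a. vec_nth (differential s u) a * X a f"] by (simp add: full_basis_def)
    also have "(\<Sum>l<p. ?t l) = (\<Sum>i<p. g x w (v i) * v i f)" by (rule sum.cong) (simp_all add: full_basis_def)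
    also have "\<dots> = w f" by (rule w[symmetric])
    finally show ?thesis by (simp add: w_def)
  qed
  moreover have "w = u" if "u \<in> vert_sp x"
  proof -
    have "differential s u = 0" using that vert_space_iff[OF s] by blast
    then show ?thesis unfolding w_def by simp
  qed
  ultimately show ?thesis by (intro that[of "\<lambda>l. g x w (v l)"] ext) simp_all
qed

lemma ndet_change_of_basis:
  fixes c :: "'m \<Rightarrow> 'n rvec"
  assumes "\<And>i. i < CARD('n) \<Longrightarrow> u i = (\<lambda>f. \<Sum>l<CARD('n). C i l * B l f)"
  shows "frame_det c u
    = ndet CARD('n) C * frame_det c B"
proof -
  have "vec_nth (differential c (u i)) j = (\<Sum>l<CARD('n). C i l * vec_nth (differential c (B l)) j)"
    if "i < CARD('n)" for i j
    using assms[OF that] by (simp add: differential_def)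
  then show ?thesis
    using ndet_mult[of "CARD('n)" C "\<lambda>l j. vec_nth (differential c (B l)) (coord_index j)"]
    by (simp cong: ndet_cong)
qed

text \<open>In the basis of \<open>v\<close> and the lifts the vectors \<open>v'\<close>, \<open>z\<close> have a block triangular matrix, whose diagonal blocks
  are the matrix from \<open>v\<close> to \<open>v'\<close> and the matrix of the differential of \<open>s\<close> on \<open>z\<close>.\<close>

lemma full_basis_det:
  fixes c :: "'m \<Rightarrow> 'n rvec"
  assumes s: "(U, s) \<in> F" "x \<in> U" and v: "vertical_orthonormal p x v"
    and X: "\<And>a. X a \<in> T x" "\<And>a. differential s (X a) = axis a 1"
    and v': "\<And>i. i < p \<Longrightarrow> v' i \<in> vert_sp x" and z: "\<And>i. i < CARD('q) \<Longrightarrow> z i \<in> T x"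
  shows "frame_det c (\<lambda>i. if i < p then v' i else z (i - p))
    = ndet p (\<lambda>i j. g x (v' i) (v j))
      * frame_det s z
      * frame_det c (full_basis v X)"
proof -
  define u where "u i = (if i < p then v' i else z (i - p))" for i
  have uT: "u i \<in> T x" if "i < CARD('n)" for i
    using that v' z vert_tangent dim_split unfolding u_def by auto
  define expands where "expands i b \<longleftrightarrow>
      u i = (\<lambda>f. \<Sum>l<CARD('n). (if l < p then b l else vec_nth (differential s (u i)) (coord_index (l - p)))
        * full_basis v X l f) \<and> (u i \<in> vert_sp x \<longrightarrow> (\<forall>l<p. b l = g x (u i) (v l)))" for i b
  have "\<exists>b. expands i b" if "i < CARD('n)" for i
    by (rule full_basis_expansion[OF s v X uT[OF that]]) (auto simp: expands_def)
  then have "\<forall>i. \<exists>b. i < CARD('n) \<longrightarrow> expands i b" by blast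
  from choice[OF this] obtain b where "\<forall>i<CARD('n). expands i (b i)" by blast
  then have b: "\<And>i. i < CARD('n) \<Longrightarrow> u i = (\<lambda>f. \<Sum>l<CARD('n). (if l < p then b i l
      else vec_nth (differential s (u i)) (coord_index (l - p))) * full_basis v X l f)"
    "\<And>i l. i < CARD('n) \<Longrightarrow> u i \<in> vert_sp x \<Longrightarrow> l < p \<Longrightarrow> b i l = g x (u i) (v l)"
    unfolding expands_def by blast+
  have uv: "differential s (u i) = 0" "u i = v' i" "u i \<in> vert_sp x" if "i < p" for i
    using that v' vert_space_iff[OF s] unfolding u_def by auto
  have "ndet CARD('n) (\<lambda>i l. if l < p then b i l else vec_nth (differential s (u i)) (coord_index (l - p)))
     = ndet (p + CARD('q)) (\<lambda>i j. if i < p then if j < p then g x (v' i) (v j) else 0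
         else if j < p then b i j else vec_nth (differential s (z (i - p))) (coord_index (j - p)))"
    unfolding dim_split
  proof (rule ndet_cong)
    fix i j assume ij: "i < p + CARD('q)" "j < p + CARD('q)"
    show "(if j < p then b i j else vec_nth (differential s (u i)) (coord_index (j - p)))
      = (if i < p then if j < p then g x (v' i) (v j) else 0
         else if j < p then b i j else vec_nth (differential s (z (i - p))) (coord_index (j - p)))"
    proof (cases "i < p")
      case True
      then show ?thesis using b(2)[of i j] uv[OF True] ij dim_split by simp
    next
      case False
      then show ?thesis by (simp add: u_def)
    qed
  qed
  also have "\<dots> = ndet p (\<lambda>i j. g x (v' i) (v j))
      * frame_det s z"
    by (rule ndet_block)
  finally show ?thesis
    using ndet_change_of_basis[where u = u and c = c, OF b(1)] by (simp add: u_def)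
qed

text \<open>The coordinate vectors are combinations of the full basis, so its matrix has an inverse.\<close>

lemma full_basis_det_nonzero:
  assumes s: "(U, s) \<in> F" "x \<in> U" and v: "vertical_orthonormal p x v"
    and X: "\<And>a. X a \<in> T x" "\<And>a. differential s (X a) = axis a 1" and c: "(W, c) \<in> A" "x \<in> W"
  shows "frame_det c (full_basis v X) \<noteq> 0"
proof -
  define u where "u i = coord_vector A (W, c) x (axis (coord_index i) 1)" for i
  have u: "u i \<in> T x" "differential c (u i) = axis (coord_index i) 1" for i
    unfolding u_def using tangent_space_chart[OF c] differential_coord_vector[OF c] by auto
  have "\<exists>b. u i = (\<lambda>f. \<Sum>l<CARD('n). b l * full_basis v X l f)" for i
    by (rule full_basis_expansion[OF s v X u(1)[of i]], rule exI, assumption)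
  then obtain b where b: "\<And>i. u i = (\<lambda>f. \<Sum>l<CARD('n). b i l * full_basis v X l f)" by metis
  have "frame_det c u
      = ndet CARD('n) (\<lambda>i j. if i = j then 1 else 0)"
    by (rule ndet_cong) (auto simp: u axis_def coord_index_eq_iff)
  then show ?thesis using ndet_change_of_basis[where u = u and c = c, OF b] by (auto simp: ndet_id)
qed

text \<open>The quantifier over the transverse vectors in the definition disappears: their
  contribution to the determinant is a positive factor.\<close>

lemma leaf_positive_iff:
  assumes s: "(U, s) \<in> F" "x \<in> U" and v: "vertical_orthonormal p x v"
    and X: "\<And>a. X a \<in> T x" "\<And>a. differential s (X a) = axis a 1" and c: "(W, c) \<in> A" "x \<in> W"
    and v': "\<And>i. i < p \<Longrightarrow> v' i \<in> vert_sp x"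
  shows "leaf_positive A F p x v' \<longleftrightarrow> ndet p (\<lambda>i j. g x (v' i) (v j))
      * frame_det c (full_basis v X) > 0"
    (is "_ \<longleftrightarrow> ?a * ?d > 0")
proof -
  have *: "positive_basis A x (\<lambda>i. if i < p then v' i else z (i - p)) \<longleftrightarrow>
      ?a * frame_det s z * ?d > 0"
    if z: "\<And>i. i < CARD('q) \<Longrightarrow> z i \<in> T x" for z
    using full_basis_det[where v' = v' and z = z and c = c, OF s v X v' z] v' z vert_tangent dim_split
    by (subst positive_basis_iff[OF c]) auto
  show ?thesis
  proof
    assume L: "leaf_positive A F p x v'"
    define z where "z i = X (coord_index i)" for i
    have z: "z i \<in> T x" for i using X by (simp add: z_def)
    have "frame_det s z
      = ndet CARD('q) (\<lambda>i j. if i = j then 1 else 0)"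
      by (rule ndet_cong) (auto simp: z_def X axis_def coord_index_eq_iff)
    then have 1: "frame_det s z = 1"
      by (simp add: ndet_id)
    then have "transversely_positive F x z" using transversely_positive_iff[OF s z] by simp
    then have "positive_basis A x (\<lambda>i. if i < p then v' i else z (i - p))"
      using L z unfolding leaf_positive_def by blast
    then show "?a * ?d > 0" using *[of z] z 1 by simp
  next
    assume ad: "?a * ?d > 0"
    show "leaf_positive A F p x v'"
      unfolding leaf_positive_def
    proof (intro allI impI)
      fix z assume z: "(\<forall>i<CARD('q). z i \<in> T x) \<and> transversely_positive F x z"
      then have "frame_det s z > 0"
        using transversely_positive_iff[OF s] by blast
      then have "?a * ?d * frame_det s z > 0"
        using ad by simp
      then show "positive_basis A x (\<lambda>i. if i < p then v' i else z (i - p))"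
        using *[of z] z by (simp add: ac_simps)
    qed
  qed
qed

end

context foliated_manifold
begin

subsection \<open>Adapted frames\<close>

lemma adapted_frame_iff:
  "adapted_frame_on A F g p U V \<longleftrightarrow> vertical_frame p U V \<and> (\<forall>x\<in>U. leaf_positive A F p x (\<lambda>i. V i x))"
  unfolding adapted_frame_on_def vertical_frame_def vertical_orthonormal_def by blast

lemma vertical_frameD:
  assumes "vertical_frame k U V"
  shows "i < k \<Longrightarrow> vf U (V i)" "x \<in> U \<Longrightarrow> vertical_orthonormal k x (\<lambda>i. V i x)"
  using assms unfolding vertical_frame_def by auto

lemma vertical_frame_subset: "vertical_frame k U V \<Longrightarrow> U' \<subseteq> U \<Longrightarrow> vertical_frame k U' V"
  unfolding vertical_frame_def using vf_subset by blast

definition horizontal_lifts :: "('m \<Rightarrow> 'q rvec) \<Rightarrow> 'm set \<Rightarrow> ('q \<Rightarrow> 'm vfield) \<Rightarrow> bool" where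
  "horizontal_lifts s U X \<longleftrightarrow> lifts s U X \<and> (\<forall>x\<in>U. \<forall>a. X a x \<in> hor_sp x)"

lemma horizontal_projection_vf:
  assumes U: "open U" and V: "vertical_frame p U V" and E: "vf U E"
  shows "vf U (\<lambda>y f. E y f - (\<Sum>i<p. g y (E y) (V i y) * V i y f))"
    "y \<in> U \<Longrightarrow> (\<lambda>f. E y f - (\<Sum>i<p. g y (E y) (V i y) * V i y f)) \<in> hor_sp y"
proof -
  show "vf U (\<lambda>y f. E y f - (\<Sum>i<p. g y (E y) (V i y) * V i y f))"
    by (intro vf_diff vf_lincomb U E g_smooth) (auto intro: vertical_frameD[OF V])
  show "(\<lambda>f. E y f - (\<Sum>i<p. g y (E y) (V i y) * V i y f)) \<in> hor_sp y" if "y \<in> U"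
    using vert_hor_decomposition(2)[OF vertical_frameD(2)[OF V that] vf_tangent[OF E that]] .
qed

text \<open>The determinant comparing a vertical frame with the orientation is continuous and nonzero, so
  near a point a change of sign of one frame vector makes the frame positive.\<close>

lemma adapted_frame_exists:
  assumes U1: "open U1" "x \<in> U1"
  obtains U0 s U V X where "(U0, s) \<in> F" "open U" "x \<in> U" "U \<subseteq> U0" "U \<subseteq> U1"
    "adapted_frame_on A F g p U V" "horizontal_lifts s U X"
proof -
  obtain U0 s where s: "(U0, s) \<in> F" "x \<in> U0" using submersion_exists .
  obtain U2 X0 where U2: "open U2" "x \<in> U2" "U2 \<subseteq> U0" "lifts s U2 X0" using lifts_exist[OF s] .
  define U3 where "U3 = U2 \<inter> U1"
  have U3: "open U3" "x \<in> U3" "U3 \<subseteq> U0" "U3 \<subseteq> U1" using U1 U2 by (auto simp: U3_def)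
  have X3: "lifts s U3 X0"
    using U2(4) vf_subset[of U2 _ U3] unfolding lifts_def by (auto simp: U3_def)
  obtain U4 V0 where U4: "open U4" "x \<in> U4" "U4 \<subseteq> U3" "vertical_frame p U4 V0"
    using vertical_frame_exists[OF s(1) U3(1-3) X3 order_refl] by blast
  obtain W c where c: "(W, c) \<in> A" "x \<in> W" using chart_exists .
  define U5 where "U5 = U4 \<inter> W"
  have U5: "open U5" "x \<in> U5" "U5 \<subseteq> W" "U5 \<subseteq> U4" "U5 \<subseteq> U0" "U5 \<subseteq> U1"
    using U4 U3 chart_open[OF c(1)] c(2) by (auto simp: U5_def)
  have V0: "vertical_frame p U5 V0" using vertical_frame_subset[OF U4(4) U5(4)] .
  have X0: "vf U5 (X0 a)" "y \<in> U5 \<Longrightarrow> differential s (X0 a y) = axis a 1" for a y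
    using X3 U5(4) U4(3) vf_subset[of U3 "X0 a" U5] unfolding lifts_def by auto
  define B where "B l y = full_basis (\<lambda>i. V0 i y) (\<lambda>a. X0 a y) l" for l y
  define d where "d y = frame_det c (\<lambda>i. B i y)" for y
  have B: "vf U5 (B l)" if "l < CARD('n)" for l
    using that X0(1) vertical_frameD(1)[OF V0] dim_split
    by (cases "l < p") (simp_all add: B_def[abs_def] full_basis_def)
  have cs: "smooth U5 (\<lambda>y. vec_nth (c y) j)" for j
    using smooth_component[OF U5(1) smooth_subset[OF smooth_chart[OF c(1)] U5(3)]] .
  have "smooth U5 (\<lambda>y. vec_nth (differential c (B i y)) j)" if "i < CARD('n)" for i j
    using vf_smooth[OF B[OF that] U5(1) subset_refl cs] by (simp add: differential_def)
  then have d: "smooth U5 d" unfolding d_def by (intro smooth_det U5(1))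
  have "d x \<noteq> 0"
    unfolding d_def B_def using U5 X0 vf_tangent[OF X0(1)]
    by (intro full_basis_det_nonzero[OF s vertical_frameD(2)[OF V0] _ _ c]) auto
  \<comment> \<open>The sign by which the first frame vector is multiplied.\<close>
  define \<epsilon> :: real where "\<epsilon> = sgn (d x)"
  have \<epsilon>: "\<epsilon> * \<epsilon> = 1" "\<epsilon> * d x > 0"
    using \<open>d x \<noteq> 0\<close> by (auto simp: \<epsilon>_def sgn_real_def)
  obtain U where U: "open U" "x \<in> U" "U \<subseteq> U5" "\<And>y. y \<in> U \<Longrightarrow> \<epsilon> * d y > 0"
    using positive_nearby[OF U5(1) smooth_mult[OF U5(1) smooth_const d] U5(2) \<epsilon>(2)] by blast
  define V where "V i = (if i = 0 then (\<lambda>y f. \<epsilon> * V0 0 y f) else V0 i)" for i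
  have o: "vertical_orthonormal p y (\<lambda>i. V i y)"
    "ndet p (\<lambda>i j. g y (V i y) (V0 j y)) = \<epsilon>" if y: "y \<in> U" for y
  proof -
    have y5: "y \<in> U5" using y U by blast
    note v = vertical_orthonormalD[OF vertical_frameD(2)[OF V0 y5]]
    have gV: "g y (V i y) u = (if i = 0 then \<epsilon> * g y (V0 0 y) u else g y (V0 i y) u)" if "i < p" "u \<in> T y" for i u
      using g_scale v(2) that p_pos by (auto simp: V_def)
    have Vs: "V i y \<in> vert_sp y" if "i < p" for i
      using v(1) vert_scale that p_pos by (auto simp: V_def)
    have "g y (V i y) (V j y) = (if i = j then 1 else 0)" if "i < p" "j < p" for i j
    proof -
      have "g y (V0 i y) (V j y) = g y (V j y) (V0 i y)" if "i < p" for i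
        using g_sym v(2) that Vs \<open>j < p\<close> vert_tangent by blast
      then show ?thesis
        using gV[OF that(1) vert_tangent[OF Vs[OF that(2)]]] gV[OF that(2) v(2)] that v(3) \<epsilon>(1) p_pos by auto
    qed
    then show "vertical_orthonormal p y (\<lambda>i. V i y)"
      unfolding vertical_orthonormal_def using Vs by blast
    have "ndet p (\<lambda>i j. g y (V i y) (V0 j y))
        = ndet p (\<lambda>i j. if i = 0 then \<epsilon> * (if i = j then 1 else 0) else if i = j then 1 else 0)"
      using gV v p_pos by (intro ndet_cong) auto
    also have "\<dots> = \<epsilon> * ndet p (\<lambda>i j. if i = j then 1 else 0)"
      using p_pos by (intro ndet_scale_row) simp
    finally show "ndet p (\<lambda>i j. g y (V i y) (V0 j y)) = \<epsilon>" by (simp add: ndet_id)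
  qed
  have Vvf: "vf U (V i)" if "i < p" for i
    using vf_scale[OF U(1) smooth_const] vf_subset[OF vertical_frameD(1)[OF V0] U(3)] that p_pos
    by (auto simp: V_def)
  then have V: "vertical_frame p U V" using o unfolding vertical_frame_def by blast
  have "leaf_positive A F p y (\<lambda>i. V i y)" if y: "y \<in> U" for y
  proof -
    have y5: "y \<in> U5" using y U by blast
    have "leaf_positive A F p y (\<lambda>i. V i y) \<longleftrightarrow> ndet p (\<lambda>i j. g y (V i y) (V0 j y)) * d y > 0"
      unfolding d_def B_def
      by (rule leaf_positive_iff[OF s(1) _ vertical_frameD(2)[OF V0 y5] _ _ c(1)])
        (use y5 U5 X0 vf_tangent[OF X0(1) y5] vertical_orthonormalD(1)[OF o(1)[OF y]] in auto)
    then show ?thesis using o(2)[OF y] U(4)[OF y] by simp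
  qed
  then have "adapted_frame_on A F g p U V" using V unfolding adapted_frame_iff by blast
  define X where "X a = (\<lambda>y f. X0 a y f - (\<Sum>i<p. g y (X0 a y) (V i y) * V i y f))" for a
  have X0U: "vf U (X0 a)" for a using vf_subset[OF X0(1) U(3)] .
  have "differential s (X a y) = axis a 1" if y: "y \<in> U" for a y
  proof -
    have "y \<in> U0" using y U U5 by blast
    moreover have "(\<lambda>f. \<Sum>i<p. g y (X0 a y) (V i y) * V i y f) \<in> vert_sp y"
      by (rule vert_hor_decomposition(1)[OF vertical_frameD(2)[OF V y] vf_tangent[OF X0U y]])
    ultimately show ?thesis
      using vert_space_iff[OF s(1)] X0(2)[of y a] y U by (auto simp: X_def differential_minus)
  qed
  then have "horizontal_lifts s U X"
    unfolding horizontal_lifts_def lifts_def X_def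
    using horizontal_projection_vf[OF U(1) V X0U] by blast
  then show ?thesis using that[OF s(1) U(1,2)] U U5 \<open>adapted_frame_on A F g p U V\<close> by blast
qed

lemma frame_near_adapted:
  obtains U where "open U" "x \<in> U" "adapted_frame_on A F g p U (frame_near A F g p x)"
proof -
  have "\<exists>V U. open U \<and> x \<in> U \<and> adapted_frame_on A F g p U V"
    by (rule adapted_frame_exists[OF open_UNIV UNIV_I]) blast
  from someI_ex[OF this] show ?thesis using that unfolding frame_near_def by blast
qed

subsection \<open>Independence of the frame\<close>

text \<open>The matrix between two orthonormal frames is orthogonal also with respect to its columns, because each frame
  expands in the other.\<close>

lemma orthonormal_change:
  assumes v: "vertical_orthonormal p x v" and v': "vertical_orthonormal p x v'" and jk: "j < p" "k < p"
  shows "(\<Sum>i<p. g x (v' i) (v j) * g x (v' i) (v k)) = (if j = k then 1 else 0)"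
proof -
  note d = vertical_orthonormalD[OF v] and d' = vertical_orthonormalD[OF v']
  have "g x (v j) (v k) = g x (\<lambda>f. \<Sum>i<p. g x (v j) (v' i) * v' i f) (v k)"
    using vertical_expansion[OF v' d(1)[OF jk(1)]] by simp
  also have "\<dots> = (\<Sum>i<p. g x (v j) (v' i) * g x (v' i) (v k))"
    by (rule g_sum_left) (use d d' jk in auto)
  also have "\<dots> = (\<Sum>i<p. g x (v' i) (v j) * g x (v' i) (v k))"
    using g_sym[OF d(2)[OF jk(1)] d'(2)] by (intro sum.cong) auto
  finally show ?thesis using d(3)[OF jk] by simp
qed

text \<open>The determinant of an orthogonal matrix is \<open>1\<close> or \<open>-1\<close>, and the orientations exclude \<open>-1\<close>.\<close>

lemma frame_change_det:
  assumes v: "vertical_orthonormal p x v" "leaf_positive A F p x v"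
    and v': "vertical_orthonormal p x v'" "leaf_positive A F p x v'"
  shows "ndet p (\<lambda>i j. g x (v' i) (v j)) = 1"
proof -
  obtain U s where s: "(U, s) \<in> F" "x \<in> U" using submersion_exists .
  obtain W c where c: "(W, c) \<in> A" "x \<in> W" using chart_exists .
  obtain X where X: "\<And>a. X a \<in> T x" "\<And>a. differential s (X a) = axis a 1" by (rule lifts_at_point[OF s]) blast
  let ?d = "frame_det c (full_basis v X)"
  let ?a = "ndet p (\<lambda>i j. g x (v' i) (v j))"
  have "ndet p (\<lambda>i j. g x (v i) (v j)) = ndet p (\<lambda>i j. if i = j then 1 else 0)"
    using vertical_orthonormalD(3)[OF v(1)] by (intro ndet_cong) auto
  then have "?d > 0"
    using leaf_positive_iff[OF s v(1) X c vertical_orthonormalD(1)[OF v(1)]] v(2) by (simp add: ndet_id)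
  moreover have "?a * ?d > 0"
    using leaf_positive_iff[where v' = v', OF s v(1) X c vertical_orthonormalD(1)[OF v'(1)]] v'(2) by simp
  ultimately have "?a > 0" by (simp add: zero_less_mult_iff)
  moreover have "?a * ?a = 1"
  proof -
    have "?a * ?a = ndet p (\<lambda>i j. g x (v' j) (v i)) * ?a"
      using ndet_transpose[of p "\<lambda>i j. g x (v' i) (v j)"] by simp
    also have "\<dots> = ndet p (\<lambda>i j. \<Sum>l<p. g x (v' l) (v i) * g x (v' l) (v j))"
      by (rule ndet_mult[symmetric])
    also have "\<dots> = ndet p (\<lambda>i j. if i = j then 1 else 0)"
      using orthonormal_change[OF v(1) v'(1)] by (intro ndet_cong) auto
    finally show ?thesis by (simp add: ndet_id)
  qed
  ultimately show ?thesis using power2_eq_1_iff[of ?a] by (simp add: power2_eq_square)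
qed

text \<open>The frame chosen at \<open>x\<close> differs from \<open>V\<close> by a matrix of determinant 1.\<close>

lemma characteristic_form_eq:
  assumes V: "adapted_frame_on A F g p U V" "x \<in> U" and e: "\<And>i. i < p \<Longrightarrow> e i \<in> T x"
  shows "characteristic_form A F g p x e = ndet p (\<lambda>i j. g x (e i) (V j x))"
proof -
  let ?V' = "frame_near A F g p x"
  obtain U' where U': "x \<in> U'" "adapted_frame_on A F g p U' ?V'" using frame_near_adapted .
  have v: "vertical_orthonormal p x (\<lambda>i. V i x)" "leaf_positive A F p x (\<lambda>i. V i x)"
    using V vertical_frameD(2) unfolding adapted_frame_iff by blast+
  have v': "vertical_orthonormal p x (\<lambda>i. ?V' i x)" "leaf_positive A F p x (\<lambda>i. ?V' i x)"
    using U' vertical_frameD(2) unfolding adapted_frame_iff by blast+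
  note d = vertical_orthonormalD[OF v(1)] and d' = vertical_orthonormalD[OF v'(1)]
  have "g x (e i) (?V' j x) = (\<Sum>l<p. g x (e i) (V l x) * g x (?V' j x) (V l x))" if "i < p" "j < p" for i j
  proof -
    have "g x (e i) (?V' j x) = g x (e i) (\<lambda>f. \<Sum>l<p. g x (?V' j x) (V l x) * V l x f)"
      using vertical_expansion[OF v(1) d'(1)[OF that(2)]] by simp
    also have "\<dots> = (\<Sum>l<p. g x (?V' j x) (V l x) * g x (e i) (V l x))"
      by (rule g_sum_right) (use d e that in auto)
    finally show ?thesis by (simp add: mult.commute)
  qed
  then have "characteristic_form A F g p x e
      = ndet p (\<lambda>i j. \<Sum>l<p. g x (e i) (V l x) * g x (?V' j x) (V l x))"
    unfolding characteristic_form_def Let_def by (intro ndet_cong)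
  also have "\<dots> = ndet p (\<lambda>i l. g x (e i) (V l x)) * ndet p (\<lambda>l j. g x (?V' j x) (V l x))"
    by (rule ndet_mult)
  also have "ndet p (\<lambda>l j. g x (?V' j x) (V l x)) = 1"
    using frame_change_det[OF v v'] ndet_transpose[of p "\<lambda>i j. g x (?V' i x) (V j x)"] by simp
  finally show ?thesis by simp
qed

text \<open>The trace of \<open>v \<mapsto> D\<^sub>v Z\<close> over the leaf directions: a trace of a bilinear form does not depend on
  the orthonormal basis.\<close>

lemma leaf_trace_independent:
  assumes U: "open U" "x \<in> U" and V: "vertical_frame p U V" and V': "vertical_frame p U V'" and Z: "vf U Z"
  shows "(\<Sum>i<p. g x (D (V' i) Z x) (V' i x)) = (\<Sum>i<p. g x (D (V i) Z x) (V i x))"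
proof -
  have v: "vertical_orthonormal p y (\<lambda>i. V i y)" and v': "vertical_orthonormal p y (\<lambda>i. V' i y)"
    if "y \<in> U" for y using vertical_frameD(2) V V' that by blast+
  note d = vertical_orthonormalD[OF v] and d' = vertical_orthonormalD[OF v']
  define a where "a i j y = g y (V' i y) (V j y)" for i j y
  have as: "smooth U (a i j)" if "i < p" "j < p" for i j
    unfolding a_def using that vertical_frameD(1) V V' by (intro g_smooth U) auto
  have DT: "D (V j) Z x \<in> T x" if "j < p" for j
    using vf_tangent[OF D_vf[OF U(1) vertical_frameD(1)[OF V that] Z] U(2)] .
  have DV: "D (V' i) Z x = (\<lambda>f. \<Sum>j<p. a i j x * D (V j) Z x f)" if i: "i < p" for i
  proof -
    have "vf U (\<lambda>y f. \<Sum>j<p. a i j y * V j y f)"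
      using i by (intro vf_lincomb U as vertical_frameD(1)[OF V]) auto
    moreover have "V' i y = (\<lambda>f. \<Sum>j<p. a i j y * V j y f)" if "y \<in> U" for y
      unfolding a_def using vertical_expansion[OF v[OF that] d'(1)[OF that i]] .
    ultimately have "D (V' i) Z x = D (\<lambda>y f. \<Sum>j<p. a i j y * V j y f) Z x"
      using D_cong_left[OF U(1) _ Z _ U(2), of "\<lambda>y f. \<Sum>j<p. a i j y * V j y f" "V' i"] by blast
    also have "\<dots> = (\<lambda>f. \<Sum>j<p. a i j x * D (V j) Z x f)"
      using i by (intro D_lincomb_left[OF U(1)] as vertical_frameD(1)[OF V] Z U) auto
    finally show ?thesis .
  qed
  have "g x (D (V' i) Z x) (V' i x) = (\<Sum>j<p. \<Sum>k<p. a i j x * a i k x * g x (D (V j) Z x) (V k x))"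
    if i: "i < p" for i
  proof -
    have "g x (D (V' i) Z x) (V' i x) = (\<Sum>j<p. a i j x * g x (D (V j) Z x) (V' i x))"
      unfolding DV[OF i] by (rule g_sum_left) (use DT d'(2)[OF U(2) i] in auto)
    also have "\<dots> = (\<Sum>j<p. a i j x * (\<Sum>k<p. a i k x * g x (D (V j) Z x) (V k x)))"
    proof (rule sum.cong[OF refl])
      fix j assume "j \<in> {..<p}"
      then have j: "j < p" by simp
      have "g x (D (V j) Z x) (V' i x) = g x (D (V j) Z x) (\<lambda>f. \<Sum>k<p. a i k x * V k x f)"
        unfolding a_def using vertical_expansion[OF v[OF U(2)] d'(1)[OF U(2) i]] by simp
      also have "\<dots> = (\<Sum>k<p. a i k x * g x (D (V j) Z x) (V k x))"
        by (rule g_sum_right) (use DT[OF j] d(2)[OF U(2)] in auto)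
      finally show "a i j x * g x (D (V j) Z x) (V' i x) = a i j x * (\<Sum>k<p. a i k x * g x (D (V j) Z x) (V k x))"
        by simp
    qed
    finally show ?thesis by (simp add: sum_distrib_left mult.assoc)
  qed
  then have "(\<Sum>i<p. g x (D (V' i) Z x) (V' i x))
      = (\<Sum>i<p. \<Sum>j<p. \<Sum>k<p. a i j x * a i k x * g x (D (V j) Z x) (V k x))" by simp
  also have "\<dots> = (\<Sum>j<p. \<Sum>k<p. \<Sum>i<p. a i j x * a i k x * g x (D (V j) Z x) (V k x))"
    by (subst sum.swap) (rule sum.cong[OF refl], rule sum.swap)
  also have "\<dots> = (\<Sum>j<p. \<Sum>k<p. (if j = k then 1 else 0) * g x (D (V j) Z x) (V k x))"
    using orthonormal_change[OF v[OF U(2)] v'[OF U(2)]]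
    by (intro sum.cong refl) (simp add: sum_distrib_right[symmetric] a_def)
  also have "\<dots> = (\<Sum>j<p. g x (D (V j) Z x) (V j x))"
    by (intro sum.cong refl) (simp add: if_distrib[of "\<lambda>z. z * _"] cong: if_cong)
  finally show ?thesis .
qed

lemma leaf_div_eq:
  assumes U: "open U" "x \<in> U" and V: "vertical_frame p U V" and Z: "vf U Z"
  shows "leaf_div A F g D p Z x = (\<Sum>i<p. g x (D (V i) Z x) (V i x))"
proof -
  let ?V' = "frame_near A F g p x"
  obtain U' where U': "open U'" "x \<in> U'" "adapted_frame_on A F g p U' ?V'" using frame_near_adapted .
  have "vertical_frame p (U \<inter> U') V" "vertical_frame p (U \<inter> U') ?V'" "vf (U \<inter> U') Z"
    using V U'(3) Z vertical_frame_subset vf_subset unfolding adapted_frame_iff by blast+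
  from leaf_trace_independent[OF _ _ this] show ?thesis
    using U U' unfolding leaf_div_def Let_def by auto
qed

subsection \<open>The mean curvature form\<close>

abbreviation kappa :: "'m \<Rightarrow> 'm tvec \<Rightarrow> real" where
  "kappa \<equiv> mean_curvature A F g D p"

abbreviation chi :: "'m form" where
  "chi \<equiv> characteristic_form A F g p"

text \<open>Linearity and the vanishing on vertical vectors are read off from the mean curvature vector \<open>h\<close>.\<close>

lemma kappa_vector:
  obtains h where "h \<in> hor_sp x" "\<And>u. u \<in> T x \<Longrightarrow> kappa x u = g x u h"
proof -
  let ?V = "frame_near A F g p x"
  obtain U where U: "open U" "x \<in> U" "adapted_frame_on A F g p U ?V" using frame_near_adapted .
  have V: "vertical_frame p U ?V" using U unfolding adapted_frame_iff by blast
  let ?h = "\<lambda>i. hor A F g (D (?V i) (?V i)) x"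
  have h: "?h i \<in> hor_sp x" if "i < p" for i
  proof -
    have "D (?V i) (?V i) x \<in> T x"
      using vf_tangent[OF D_vf[OF U(1)] U(2)] vertical_frameD(1)[OF V that] by blast
    then show ?thesis
      unfolding hor_def
      using vert_eq[OF vertical_frameD(2)[OF V U(2)]] vert_hor_decomposition(2)[OF vertical_frameD(2)[OF V U(2)]]
      by simp
  qed
  have 1: "(\<lambda>f. \<Sum>i<p. 1 * ?h i f) \<in> hor_sp x" by (rule hor_lincomb_sum) (use h in auto)
  have "kappa x u = g x u (\<lambda>f. \<Sum>i<p. 1 * ?h i f)" if "u \<in> T x" for u
    unfolding mean_curvature_def Let_def
    by (subst g_sum_right) (use h hor_tangent that in auto)
  with 1 that show ?thesis by blast
qed

lemma kappa_lincomb: "u \<in> T x \<Longrightarrow> v \<in> T x \<Longrightarrow> kappa x (\<lambda>f. a * u f + b * v f) = a * kappa x u + b * kappa x v"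
  by (rule kappa_vector[of x]) (simp add: g_lincomb hor_tangent tangent_lincomb)

lemma kappa_minus: "u \<in> T x \<Longrightarrow> v \<in> T x \<Longrightarrow> kappa x (\<lambda>f. u f - v f) = kappa x u - kappa x v"
  using kappa_lincomb[of u x v 1 "-1"] by simp

lemma kappa_vert: "u \<in> vert_sp x \<Longrightarrow> kappa x u = 0"
  by (rule kappa_vector[of x]) (simp add: vert_hor_orthogonal vert_tangent)

text \<open>Differentiating \<open>g(Z, V\<^sub>i) = 0\<close> along \<open>V\<^sub>i\<close> turns the mean curvature into a trace.\<close>

lemma kappa_horizontal:
  assumes U: "open U" "x \<in> U" and V: "vertical_frame p U V"
    and Z: "vf U Z" "\<And>y. y \<in> U \<Longrightarrow> Z y \<in> hor_sp y"
  shows "kappa x (Z x) = - (\<Sum>i<p. g x (D (V i) Z x) (V i x))"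
proof -
  let ?V = "frame_near A F g p x"
  obtain U0 where U0: "open U0" "x \<in> U0" "adapted_frame_on A F g p U0 ?V" using frame_near_adapted .
  define U' where "U' = U \<inter> U0"
  have U': "open U'" "x \<in> U'" "U' \<subseteq> U" using U U0 by (auto simp: U'_def)
  have V': "vertical_frame p U' ?V" "vertical_frame p U' V"
    using U0(3) V vertical_frame_subset unfolding adapted_frame_iff U'_def by blast+
  note vv = vertical_orthonormalD[OF vertical_frameD(2)[OF V'(1)]]
  have Z': "vf U' Z" using Z(1) U'(3) vf_subset by blast
  have "g x (Z x) (hor A F g (D (?V i) (?V i)) x) = - g x (D (?V i) Z x) (?V i x)" if i: "i < p" for i
  proof -
    have Vi: "vf U' (?V i)" using vertical_frameD(1)[OF V'(1) i] .
    let ?E = "D (?V i) (?V i)"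
    have E: "?E x \<in> T x" using vf_tangent[OF D_vf[OF U'(1) Vi Vi] U'(2)] .
    have v: "vert A F g ?E x \<in> vert_sp x"
      using vert_eq[where E = ?E, OF vertical_frameD(2)[OF V'(1) U'(2)] E]
        vert_hor_decomposition(1)[OF vertical_frameD(2)[OF V'(1) U'(2)] E] by simp
    have Zx: "Z x \<in> hor_sp x" "Z x \<in> T x" using Z(2)[OF U(2)] hor_tangent by blast+
    have "g x (hor A F g ?E x) (Z x) = g x (?E x) (Z x) - g x (vert A F g ?E x) (Z x)"
      unfolding hor_def by (rule g_minus[OF E vert_tangent[OF v] Zx(2)])
    then have 1: "g x (Z x) (hor A F g ?E x) = g x (Z x) (?E x)"
      using vert_hor_orthogonal[OF Zx(1) v] g_sym[OF Zx(2)] E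
        tangent_minus[OF E vert_tangent[OF v]] unfolding hor_def by simp
    have "?V i x (\<lambda>y. g y (Z y) (?V i y)) = ?V i x (\<lambda>y. 0)"
      by (rule tangent_cong[OF vv(2)[OF U'(2) i] U'(1,2)])
        (use hor_vert_orthogonal Z(2) vv(1) i U'(3) in blast)
    also have "\<dots> = 0" using tangent_const[OF vv(2)[OF U'(2) i]] .
    finally show ?thesis
      using D_metric[OF U'(1) Vi Z' Vi U'(2)] 1 by simp
  qed
  then have "kappa x (Z x) = - (\<Sum>i<p. g x (D (?V i) Z x) (?V i x))"
    unfolding mean_curvature_def Let_def by (simp add: sum_negf)
  then show ?thesis using leaf_trace_independent[OF U'(1,2) V'(2,1) Z'] by simp
qed

text \<open>\<open>[B, V\<^sub>i] = D B V\<^sub>i - D V\<^sub>i B\<close>, and \<open>D B V\<^sub>i\<close> is orthogonal to the unit field \<open>V\<^sub>i\<close>.\<close>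

lemma bracket_trace:
  assumes U: "open U" "x \<in> U" and V: "vertical_frame p U V" and B: "vf U B"
  shows "(\<Sum>i<p. g x (lie_bracket A B (V i) x) (V i x)) = - (\<Sum>i<p. g x (D (V i) B x) (V i x))"
proof -
  have "g x (lie_bracket A B (V i) x) (V i x) = - g x (D (V i) B x) (V i x)" if i: "i < p" for i
  proof -
    have Vi: "vf U (V i)" using vertical_frameD(1)[OF V i] .
    have t: "D B (V i) x \<in> T x" "D (V i) B x \<in> T x" "V i x \<in> T x" "B x \<in> T x"
      using vf_tangent[OF _ U(2)] D_vf[OF U(1)] B Vi by blast+
    have "B x (\<lambda>y. g y (V i y) (V i y)) = B x (\<lambda>y. 1)"
      by (rule tangent_cong[OF t(4) U]) (use vertical_orthonormalD(3)[OF vertical_frameD(2)[OF V]] i in auto)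
    also have "\<dots> = 0" using tangent_const[OF t(4)] .
    finally have "g x (D B (V i) x) (V i x) = 0"
      using D_metric[OF U(1) B Vi Vi U(2)] g_sym[OF t(1,3)] by simp
    then show ?thesis
      using D_torsion_free[OF U(1) B Vi U(2)] g_minus[OF t(1-3)] by simp
  qed
  then show ?thesis by (simp add: sum_negf)
qed

text \<open>By definition \<open>\<kappa>\<close> uses a different frame at every point.  Locally all of them can be replaced by one smooth
  frame, in which the trace formula for the horizontal part of \<open>E\<close> is visibly smooth.\<close>

lemma kappa_smooth:
  assumes U: "open U" and E: "vf U E"
  shows "smooth U (\<lambda>y. kappa y (E y))"
proof (rule smooth_local[OF U])
  fix x assume x: "x \<in> U"
  obtain U0 s U' V X where U': "open U'" "x \<in> U'" "U' \<subseteq> U" and V: "adapted_frame_on A F g p U' V"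
    by (rule adapted_frame_exists[OF U x]) blast
  have V: "vertical_frame p U' V" using V unfolding adapted_frame_iff by blast
  have E': "vf U' E" using E U' vf_subset by blast
  define Z where "Z = (\<lambda>y f. E y f - (\<Sum>i<p. g y (E y) (V i y) * V i y f))"
  have Z: "vf U' Z" "\<And>y. y \<in> U' \<Longrightarrow> Z y \<in> hor_sp y"
    unfolding Z_def using horizontal_projection_vf[OF U'(1) V E'] by blast+
  have "smooth U' (\<lambda>y. - (\<Sum>i<p. g y (D (V i) Z y) (V i y)))"
    using vertical_frameD(1)[OF V] by (intro smooth_uminus smooth_sum U' g_smooth D_vf Z) auto
  then have "smooth U' (\<lambda>y. kappa y (E y))"
  proof (rule smooth_cong[OF U'(1), rotated])
    fix y assume y: "y \<in> U'"
    have v: "(\<lambda>f. \<Sum>i<p. g y (E y) (V i y) * V i y f) \<in> vert_sp y"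
      using vert_hor_decomposition(1)[OF vertical_frameD(2)[OF V y] vf_tangent[OF E' y]] .
    have "kappa y (Z y) = kappa y (E y)"
      unfolding Z_def using kappa_minus[OF vf_tangent[OF E' y] vert_tangent[OF v]] kappa_vert[OF v] by simp
    then show "- (\<Sum>i<p. g y (D (V i) Z y) (V i y)) = kappa y (E y)"
      using kappa_horizontal[OF U'(1) y V Z] by simp
  qed
  then show "\<exists>U'. open U' \<and> x \<in> U' \<and> smooth U' (\<lambda>y. kappa y (E y))" using U' by blast
qed

end

section \<open>Basic fields and the exterior derivative of the mean curvature\<close>

context foliated_manifold
begin

lemma horizontal_field_iff:
  "horizontal_field_on A F g U E \<longleftrightarrow> vf U E \<and> (\<forall>x\<in>U. E x \<in> hor_sp x)"
proof -
  have "hor A F g E x = E x \<longleftrightarrow> E x \<in> hor_sp x" if E: "E x \<in> T x" for x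
  proof
    obtain U where U: "open U" "x \<in> U" "adapted_frame_on A F g p U (frame_near A F g p x)"
      using frame_near_adapted .
    have v: "vertical_orthonormal p x (\<lambda>i. frame_near A F g p x i x)"
      using U vertical_frameD(2) unfolding adapted_frame_iff by blast
    assume "hor A F g E x = E x"
    then show "E x \<in> hor_sp x"
      unfolding hor_def using vert_hor_decomposition(2)[OF v E] vert_eq[where E = E, OF v E] by simp
  next
    assume "E x \<in> hor_sp x"
    then have "vert A F g E x = (\<lambda>f. 0)" by (intro vert_eqI vert_zero) simp
    then show "hor A F g E x = E x" unfolding hor_def by simp
  qed
  then show ?thesis unfolding horizontal_field_on_def using vf_tangent by blast
qed

lemma basic_field_horizontal: "basic_field_on A F g U X \<Longrightarrow> horizontal_field_on A F g U X"
  unfolding basic_field_on_def by blast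

lemma basic_fieldE:
  assumes "basic_field_on A F g U X" "(U', s) \<in> F" "x \<in> U" "x \<in> U'"
  obtains W Xb where "open W" "x \<in> W" "W \<subseteq> U \<inter> U'" "smooth_on (s ` W) Xb"
    "\<And>y. y \<in> W \<Longrightarrow> differential s (X y) = Xb (s y)"
proof -
  have "\<forall>(U', s)\<in>F. \<forall>x\<in>U \<inter> U'. \<exists>W Xb. open W \<and> x \<in> W \<and> W \<subseteq> U \<inter> U' \<and>
      smooth_on (s ` W) Xb \<and> (\<forall>y\<in>W. differential s (X y) = Xb (s y))"
    using assms(1) unfolding basic_field_on_def by blast
  from bspec[OF this assms(2)] have "\<exists>W Xb. open W \<and> x \<in> W \<and> W \<subseteq> U \<inter> U' \<and>
      smooth_on (s ` W) Xb \<and> (\<forall>y\<in>W. differential s (X y) = Xb (s y))"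
    using assms(3,4) by auto
  then show ?thesis using that by blast
qed

lemma basic_field_subset:
  assumes X: "basic_field_on A F g U X" and U': "open U'" "U' \<subseteq> U"
  shows "basic_field_on A F g U' X"
  unfolding basic_field_on_def
proof (intro conjI ballI)
  show "horizontal_field_on A F g U' X"
    using basic_field_horizontal[OF X] U' vf_subset unfolding horizontal_field_iff by blast
next
  fix S assume S: "S \<in> F"
  obtain U0 s where Us: "S = (U0, s)" by (cases S)
  have "\<exists>W Xb. open W \<and> x \<in> W \<and> W \<subseteq> U' \<inter> U0 \<and> smooth_on (s ` W) Xb \<and> (\<forall>y\<in>W. differential s (X y) = Xb (s y))"
    if x: "x \<in> U' \<inter> U0" for x
  proof -
    obtain W Xb where W: "open W" "x \<in> W" "W \<subseteq> U \<inter> U0" "smooth_on (s ` W) Xb"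
        "\<And>y. y \<in> W \<Longrightarrow> differential s (X y) = Xb (s y)"
      using basic_fieldE[OF X, of U0 s x] S x U' unfolding Us by blast
    then show ?thesis
      using U' x smooth_on_subset[OF W(4), of "s ` (W \<inter> U')"]
      by (intro exI[of _ "W \<inter> U'"] exI[of _ Xb]) auto
  qed
  then show "case S of (U0, s) \<Rightarrow> \<forall>x\<in>U' \<inter> U0. \<exists>W Xb. open W \<and> x \<in> W \<and> W \<subseteq> U' \<inter> U0 \<and>
      smooth_on (s ` W) Xb \<and> (\<forall>y\<in>W. differential s (X y) = Xb (s y))"
    unfolding Us by blast
qed

text \<open>A lift projects to a constant field under \<open>s\<close>; under another submersion \<open>s' = \<gamma> \<circ> s\<close> it projects to the image
  of this constant field under the derivative of \<open>\<gamma>\<close>.\<close>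

lemma horizontal_lifts_basic:
  assumes s: "(U0, s) \<in> F" and U: "open U" "U \<subseteq> U0" and X: "horizontal_lifts s U X"
  shows "basic_field_on A F g U (X a)"
  unfolding basic_field_on_def
proof (intro conjI ballI)
  show "horizontal_field_on A F g U (X a)"
    using X unfolding horizontal_field_iff horizontal_lifts_def lifts_def by blast
next
  fix S assume S: "S \<in> F"
  obtain U' s' where Us: "S = (U', s')" by (cases S)
  have s': "(U', s') \<in> F" using S Us by simp
  have "\<exists>W Xb. open W \<and> x \<in> W \<and> W \<subseteq> U \<inter> U' \<and> smooth_on (s' ` W) Xb \<and> (\<forall>y\<in>W. differential s' (X a y) = Xb (s' y))"
    if x: "x \<in> U \<inter> U'" for x
  proof -
    have x': "x \<in> U0" "x \<in> U'" using x U by auto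
    obtain P \<gamma> W where t: "open P" "smooth_on P \<gamma>" "inj_on \<gamma> P" "open (\<gamma> ` P)"
        "smooth_on (\<gamma> ` P) (inv_into P \<gamma>)" "open W" "x \<in> W" "W \<subseteq> U0 \<inter> U'" "s ` W \<subseteq> P"
        "\<And>y. y \<in> W \<Longrightarrow> s' y = \<gamma> (s y)"
      by (rule transition_exists[OF s s' x']) blast
    define Xb where "Xb z = frechet_derivative \<gamma> (at (inv_into P \<gamma> z)) (axis a 1)" for z
    have "inv_into P \<gamma> ` \<gamma> ` P \<subseteq> P" using t(3) by (auto simp: inv_into_f_f)
    then have "smooth_on (\<gamma> ` P) Xb"
      unfolding Xb_def using smooth_on_compose[OF t(4,1,5) smooth_on_derivative[OF t(2), of "axis a 1"]] by blast
    moreover have "s' ` (W \<inter> U) \<subseteq> \<gamma> ` P" using t(9,10) by auto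
    ultimately have "smooth_on (s' ` (W \<inter> U)) Xb" using smooth_on_subset by blast
    moreover have "differential s' (X a y) = Xb (s' y)" if y: "y \<in> W \<inter> U" for y
    proof -
      have "vf U (X a)" "differential s (X a y) = axis a 1"
        using X y unfolding horizontal_lifts_def lifts_def by auto
      moreover have "y \<in> W" "y \<in> U" "s y \<in> P" using y t(9) by auto
      ultimately show ?thesis
        using transition_differential[OF s s' t(1,2,6,8,9,10), of y "X a y"] vf_tangent[of U "X a" y]
          t(10)[of y] inv_into_f_f[OF t(3), of "s y"]
        by (simp add: Xb_def)
    qed
    ultimately show ?thesis using t x U by (intro exI[of _ "W \<inter> U"] exI[of _ Xb]) auto
  qed
  then show "case S of (U', s) \<Rightarrow> \<forall>x\<in>U \<inter> U'. \<exists>W Xb. open W \<and> x \<in> W \<and> W \<subseteq> U \<inter> U' \<and>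
      smooth_on (s ` W) Xb \<and> (\<forall>y\<in>W. differential s (X a y) = Xb (s y))"
    unfolding Us by blast
qed

text \<open>A basic field is related to a field \<open>Xb\<close> below, a vertical field to the zero field; hence so is their
  bracket.\<close>

lemma basic_bracket_vertical:
  assumes U: "open U" and X: "basic_field_on A F g U X" and V: "vf U V" "\<And>y. y \<in> U \<Longrightarrow> V y \<in> vert_sp y"
    and x: "x \<in> U"
  shows "lie_bracket A X V x \<in> vert_sp x"
proof -
  have Xvf: "vf U X" using basic_field_horizontal[OF X] unfolding horizontal_field_iff by blast
  obtain U' s where s: "(U', s) \<in> F" "x \<in> U'" using submersion_exists .
  obtain W Xb where W: "open W" "x \<in> W" "W \<subseteq> U \<inter> U'" "smooth_on (s ` W) Xb"
      "\<And>y. y \<in> W \<Longrightarrow> differential s (X y) = Xb (s y)"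
    by (rule basic_fieldE[OF X s(1) x s(2)]) blast
  have XT: "X x \<in> T x" and VT: "V x \<in> T x" using vf_tangent Xvf V(1) x by blast+
  have "lie_bracket A X V x (\<lambda>y. vec_nth (s y) j) = 0" for j
  proof -
    let ?s = "\<lambda>y. vec_nth (s y) j"
    have near: "smooth_near A x ?s"
      using smooth_nearI[OF submersion_open[OF s(1)] s(2) submersion_component[OF s(1)]] .
    have "X x (\<lambda>y. V y ?s) = X x (\<lambda>y. 0)"
    proof (rule tangent_cong[OF XT W(1,2)])
      fix y assume y: "y \<in> W"
      have "differential s (V y) = 0" using V(2)[of y] vert_space_iff[OF s(1), of y] y W(3) by auto
      then show "V y ?s = 0" unfolding differential_def by (simp add: Finite_Cartesian_Product.vec_eq_iff)
    qed
    then have 1: "X x (\<lambda>y. V y ?s) = 0" using tangent_const[OF XT] by simp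
    have eq: "X y ?s = vec_nth (Xb (s y)) j" if "y \<in> W" for y
      using W(5)[OF that] unfolding differential_def by (simp add: Finite_Cartesian_Product.vec_eq_iff)
    have "smooth_near A x (\<lambda>y. X y ?s)" using vf_smooth_near[OF U x Xvf near] .
    then have near2: "smooth_near A x (\<lambda>y. vec_nth (Xb (s y)) j)"
      using smooth_near_cong[OF W(1,2), of "\<lambda>y. X y ?s" "\<lambda>y. vec_nth (Xb (s y)) j"] eq by simp
    have dif: "(\<lambda>z. vec_nth (Xb z) j) differentiable (at (s x))"
    proof -
      obtain Xb' where "(Xb has_derivative Xb') (at (s x))"
        using smooth_on_differentiable[OF W(4), of "s x"] W(2) unfolding differentiable_def by blast
      from bounded_linear.has_derivative[OF bounded_linear_vec_nth this] show ?thesis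
        unfolding differentiable_def by blast
    qed
    have dv: "differential s (V x) = 0" using V(2)[OF x] vert_space_iff[OF s] by blast
    have "V x (\<lambda>y. X y ?s) = V x (\<lambda>y. vec_nth (Xb (s y)) j)"
      by (rule tangent_cong[OF VT W(1,2) eq])
    also have "\<dots> = frechet_derivative (\<lambda>z. vec_nth (Xb z) j) (at (s x)) (differential s (V x))"
      by (rule tangent_chain_rule[OF VT submersion_open[OF s(1)] s(2) submersion_smooth[OF s(1)] dif near2])
    also have "\<dots> = 0" unfolding dv using linear_0[OF linear_frechet_derivative[OF dif]] .
    finally show ?thesis using 1 near by (simp add: bracket_eq)
  qed
  then have "differential s (lie_bracket A X V x) = 0"
    unfolding differential_def by (simp add: Finite_Cartesian_Product.vec_eq_iff)
  then show ?thesis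
    using vert_space_iff[OF s] vf_tangent[OF bracket_vf[OF U Xvf V(1)] x] by blast
qed

abbreviation dkappa :: "'m vfield \<Rightarrow> 'm vfield \<Rightarrow> 'm \<Rightarrow> real" where
  "dkappa X Y \<equiv> ext_deriv A 1 (\<lambda>y e. kappa y (e 0)) (\<lambda>i. if i = 0 then X else Y)"

lemma dkappa_eq:
  "dkappa X Y x = X x (\<lambda>y. kappa y (Y y)) - Y x (\<lambda>y. kappa y (X y)) - kappa x (lie_bracket A X Y x)"
  unfolding ext_deriv_def by (simp add: omit_def)

lemma kappa_basic_trace:
  assumes U: "open U" "x \<in> U" and V: "vertical_frame p U V" and X: "horizontal_field_on A F g U X"
  shows "kappa x (X x) = (\<Sum>i<p. g x (lie_bracket A X (V i) x) (V i x))"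
  using kappa_horizontal[OF U V] bracket_trace[OF U V] X unfolding horizontal_field_iff by simp

text \<open>Let \<open>a\<close> and \<open>b\<close> be the matrices of \<open>[X, _]\<close> and \<open>[Y, _]\<close> on the vertical frame.  By the Jacobi
  identity that of \<open>[[X, Y], _]\<close> is \<open>X b - Y a\<close> up to a commutator of matrices, which has trace 0, and
  the traces of \<open>a\<close> and \<open>b\<close> are \<open>\<kappa>(X)\<close> and \<open>\<kappa>(Y)\<close>.\<close>

lemma bracket_trace_basic:
  assumes U: "open U" "x \<in> U" and V: "vertical_frame p U V"
    and X: "basic_field_on A F g U X" and Y: "basic_field_on A F g U Y"
  shows "(\<Sum>i<p. g x (lie_bracket A (lie_bracket A X Y) (V i) x) (V i x))
    = X x (\<lambda>y. kappa y (Y y)) - Y x (\<lambda>y. kappa y (X y))"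
proof -
  have XY: "vf U X" "vf U Y"
    using X Y basic_field_horizontal unfolding horizontal_field_iff by blast+
  note Vvf = vertical_frameD(1)[OF V] and v = vertical_frameD(2)[OF V]
  note d = vertical_orthonormalD[OF v]
  have DX: "vf U (lie_bracket A Z (V i))" "smooth U (\<lambda>y. g y (lie_bracket A Z (V i) y) (V j y))"
    if "vf U Z" "i < p" "j < p" for Z i j
    using that Vvf by (auto intro!: g_smooth bracket_vf U)
  have exp: "lie_bracket A Z (V i) y = (\<lambda>f. \<Sum>j<p. g y (lie_bracket A Z (V i) y) (V j y) * V j y f)"
    if "basic_field_on A F g U Z" "i < p" "y \<in> U" for Z i y
    using basic_bracket_vertical[OF U(1) that(1) Vvf[OF that(2)] _ that(3)] d(1) that
    by (intro vertical_expansion[OF v]) auto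
  have second: "g x (lie_bracket A P (lie_bracket A Z (V i)) x) (V i x)
      = P x (\<lambda>y. g y (lie_bracket A Z (V i) y) (V i y))
        + (\<Sum>j<p. g x (lie_bracket A Z (V i) x) (V j x) * g x (lie_bracket A P (V j) x) (V i x))"
    if P: "vf U P" and Z: "basic_field_on A F g U Z" and i: "i < p" for P Z i
  proof -
    define b where "b j y = g y (lie_bracket A Z (V i) y) (V j y)" for j y
    have Zvf: "vf U Z" using Z basic_field_horizontal unfolding horizontal_field_iff by blast
    have bs: "smooth U (b j)" if "j < p" for j unfolding b_def using DX(2)[OF Zvf i that] .
    have sum: "vf U (\<lambda>y f. \<Sum>j<p. b j y * V j y f)" by (intro vf_lincomb U Vvf bs) auto
    have "lie_bracket A P (lie_bracket A Z (V i)) x = lie_bracket A P (\<lambda>y f. \<Sum>j<p. b j y * V j y f) x"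
      by (rule bracket_cong[OF U P DX(1)[OF Zvf i i]]) (use exp[OF Z i] in \<open>auto simp: b_def\<close>)
    also have "\<dots> = (\<lambda>f. \<Sum>j<p. P x (b j) * V j x f + b j x * lie_bracket A P (V j) x f)"
      by (rule bracket_lincomb_right[OF U P]) (auto intro: Vvf bs)
    also have "\<dots> = (\<lambda>f. 1 * (\<Sum>j<p. P x (b j) * V j x f) + 1 * (\<Sum>j<p. b j x * lie_bracket A P (V j) x f))"
      by (simp add: sum.distrib)
    finally have e: "lie_bracket A P (lie_bracket A Z (V i)) x
      = (\<lambda>f. 1 * (\<Sum>j<p. P x (b j) * V j x f) + 1 * (\<Sum>j<p. b j x * lie_bracket A P (V j) x f))" .
    have t: "V j x \<in> T x" "lie_bracket A P (V j) x \<in> T x" if "j < p" for j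
      using that vf_tangent[OF _ U(2)] Vvf DX(1)[OF P that that] by blast+
    have "g x (lie_bracket A P (lie_bracket A Z (V i)) x) (V i x)
        = 1 * g x (\<lambda>f. \<Sum>j<p. P x (b j) * V j x f) (V i x) + 1 * g x (\<lambda>f. \<Sum>j<p. b j x * lie_bracket A P (V j) x f) (V i x)"
      unfolding e by (intro g_lincomb tangent_lincomb_sum) (use t i in auto)
    also have "g x (\<lambda>f. \<Sum>j<p. P x (b j) * V j x f) (V i x) = (\<Sum>j<p. P x (b j) * g x (V j x) (V i x))"
      by (rule g_sum_left) (use t i in auto)
    also have "\<dots> = (\<Sum>j<p. if j = i then P x (b i) else 0)"
      using d(3)[OF U(2)] i by (intro sum.cong) auto
    also have "\<dots> = P x (b i)" using i by simp
    also have "g x (\<lambda>f. \<Sum>j<p. b j x * lie_bracket A P (V j) x f) (V i x)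
        = (\<Sum>j<p. b j x * g x (lie_bracket A P (V j) x) (V i x))"
      by (rule g_sum_left) (use t i in auto)
    finally show ?thesis unfolding b_def by simp
  qed
  have trace: "(\<Sum>i<p. P x (\<lambda>y. g y (lie_bracket A Z (V i) y) (V i y))) = P x (\<lambda>y. kappa y (Z y))"
    if P: "vf U P" and Z: "basic_field_on A F g U Z" for P Z
  proof -
    have Zvf: "vf U Z" using Z basic_field_horizontal unfolding horizontal_field_iff by blast
    have PT: "P x \<in> T x" using vf_tangent P U by blast
    have "P x (\<lambda>y. kappa y (Z y)) = P x (\<lambda>y. \<Sum>i<p. g y (lie_bracket A Z (V i) y) (V i y))"
      by (rule tangent_cong[OF PT U]) (rule kappa_basic_trace[OF U(1) _ V basic_field_horizontal[OF Z]])
    also have "\<dots> = (\<Sum>i<p. P x (\<lambda>y. g y (lie_bracket A Z (V i) y) (V i y)))"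
      by (rule tangent_sum[OF PT]) (use smooth_nearI[OF U DX(2)[OF Zvf]] in auto)
    finally show ?thesis by simp
  qed
  define a where "a i j = g x (lie_bracket A X (V i) x) (V j x)" for i j
  define b where "b i j = g x (lie_bracket A Y (V i) x) (V j x)" for i j
  have "g x (lie_bracket A (lie_bracket A X Y) (V i) x) (V i x)
      = (X x (\<lambda>y. g y (lie_bracket A Y (V i) y) (V i y)) + (\<Sum>j<p. b i j * a j i))
        - (Y x (\<lambda>y. g y (lie_bracket A X (V i) y) (V i y)) + (\<Sum>j<p. a i j * b j i))" if i: "i < p" for i
  proof -
    have vfs: "vf U (lie_bracket A X Y)" "vf U (lie_bracket A Y (V i))" "vf U (lie_bracket A X (V i))"
      "vf U (lie_bracket A X (lie_bracket A Y (V i)))" "vf U (lie_bracket A Y (lie_bracket A X (V i)))"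
      using XY Vvf[OF i] bracket_vf[OF U(1)] by blast+
    have "lie_bracket A (lie_bracket A X Y) (V i) x
        = (\<lambda>f. lie_bracket A X (lie_bracket A Y (V i)) x f - lie_bracket A Y (lie_bracket A X (V i)) x f)"
      by (rule bracket_jacobi[OF U XY Vvf[OF i] vfs(1-3)])
    then show ?thesis
      using g_minus[OF vf_tangent[OF vfs(4) U(2)] vf_tangent[OF vfs(5) U(2)] d(2)[OF U(2) i]]
        second[OF XY(1) Y i] second[OF XY(2) X i] by (simp add: a_def b_def)
  qed
  then have "(\<Sum>i<p. g x (lie_bracket A (lie_bracket A X Y) (V i) x) (V i x))
      = (X x (\<lambda>y. kappa y (Y y)) + (\<Sum>i<p. \<Sum>j<p. b i j * a j i))
        - (Y x (\<lambda>y. kappa y (X y)) + (\<Sum>i<p. \<Sum>j<p. a i j * b j i))"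
    by (simp add: sum.distrib sum_subtractf trace[OF XY(1) Y, symmetric] trace[OF XY(2) X, symmetric])
  also have "(\<Sum>i<p. \<Sum>j<p. b i j * a j i) = (\<Sum>i<p. \<Sum>j<p. a i j * b j i)"
    by (subst sum.swap) (simp add: mult.commute)
  finally show ?thesis by simp
qed

text \<open>The trace of \<open>[[X, Y], _]\<close> computed in two ways: by the previous lemma, and by splitting \<open>[X, Y]\<close> into its
  vertical part \<open>W\<close>, which contributes its divergence, and its horizontal part \<open>Z\<close>, which contributes \<open>\<kappa>(Z)\<close>.\<close>

lemma dkappa_basic:
  assumes U: "open U" "x \<in> U" and X: "basic_field_on A F g U X" and Y: "basic_field_on A F g U Y"
  shows "dkappa X Y x = - leaf_div A F g D p (vert A F g (lie_bracket A X Y)) x"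
proof -
  obtain U0 s U' V L where U': "open U'" "x \<in> U'" "U' \<subseteq> U" and aV: "adapted_frame_on A F g p U' V"
    by (rule adapted_frame_exists[OF U]) blast
  have V: "vertical_frame p U' V" using aV unfolding adapted_frame_iff by blast
  have X': "basic_field_on A F g U' X" and Y': "basic_field_on A F g U' Y"
    using X Y U' basic_field_subset by blast+
  have XY: "vf U' X" "vf U' Y"
    using X' Y' basic_field_horizontal unfolding horizontal_field_iff by blast+
  define B where "B = lie_bracket A X Y"
  define W where "W = vert A F g B"
  define Z where "Z = (\<lambda>y f. B y f - W y f)"
  have B: "vf U' B" unfolding B_def using bracket_vf[OF U'(1) XY] .
  have Weq: "W y = (\<lambda>f. \<Sum>i<p. g y (B y) (V i y) * V i y f)" if "y \<in> U'" for y
    unfolding W_def using vert_eq[where E = B, OF vertical_frameD(2)[OF V that] vf_tangent[OF B that]] .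
  have "vf U' (\<lambda>y f. \<Sum>i<p. g y (B y) (V i y) * V i y f)"
    by (intro vf_lincomb U' g_smooth B) (auto intro: vertical_frameD(1)[OF V])
  then have W: "vf U' W" by (rule vf_cong[rotated]) (simp add: Weq)
  have Z: "vf U' Z" unfolding Z_def by (intro vf_diff U' B W)
  have Zh: "Z y \<in> hor_sp y" if "y \<in> U'" for y
    unfolding Z_def Weq[OF that] using horizontal_projection_vf(2)[OF U'(1) V B that] .
  have BWZ: "B = (\<lambda>y f. W y f + Z y f)" by (simp add: Z_def)
  have "g x (D (V i) B x) (V i x) = g x (D (V i) W x) (V i x) + g x (D (V i) Z x) (V i x)" if i: "i < p" for i
  proof -
    have Vi: "vf U' (V i)" using vertical_frameD(1)[OF V i] .
    have "D (V i) B x = (\<lambda>f. D (V i) W x f + D (V i) Z x f)"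
      by (subst BWZ) (rule D_add_right[OF U'(1) Vi W Z U'(2)])
    then show ?thesis
      using g_plus[OF vf_tangent[OF D_vf[OF U'(1) Vi W] U'(2)] vf_tangent[OF D_vf[OF U'(1) Vi Z] U'(2)]
          vf_tangent[OF Vi U'(2)]] by simp
  qed
  then have "(\<Sum>i<p. g x (D (V i) B x) (V i x)) = leaf_div A F g D p W x - kappa x (Z x)"
    using leaf_div_eq[OF U'(1,2) V W] kappa_horizontal[OF U'(1,2) V Z Zh] by (simp add: sum.distrib)
  moreover have "W x \<in> vert_sp x"
    unfolding Weq[OF U'(2)]
    using vert_hor_decomposition(1)[OF vertical_frameD(2)[OF V U'(2)] vf_tangent[OF B U'(2)]] .
  then have "kappa x (Z x) = kappa x (B x)"
    unfolding Z_def using kappa_minus[OF vf_tangent[OF B U'(2)] vert_tangent] kappa_vert by simp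
  ultimately show ?thesis
    using bracket_trace_basic[OF U'(1,2) V X' Y'] bracket_trace[OF U'(1,2) V B]
    unfolding dkappa_eq W_def B_def by simp
qed

end

section \<open>The exterior derivative of an alternating form\<close>

definition adj_swap :: "nat \<Rightarrow> nat \<Rightarrow> nat" where
  "adj_swap m = (\<lambda>j. if j = m then Suc m else if j = Suc m then m else j)"

lemma adj_swap_adj_swap [simp]: "adj_swap m (adj_swap m j) = j"
  by (simp add: adj_swap_def)

lemma comp_adj_swap_adj_swap [simp]: "e \<circ> adj_swap m \<circ> adj_swap m = e"
  by (simp add: fun_eq_iff)

lemma adj_swap_le: "Suc m \<le> k \<Longrightarrow> i \<le> k \<Longrightarrow> adj_swap m i \<le> k"
  by (simp add: adj_swap_def)

lemma omit_comp_adj_swap: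
  "i \<le> m \<Longrightarrow> omit i (e \<circ> adj_swap (Suc m)) = omit i e \<circ> adj_swap m"
  "Suc m < i \<Longrightarrow> omit i (e \<circ> adj_swap m) = omit i e \<circ> adj_swap m"
  "omit m (e \<circ> adj_swap m) = omit (Suc m) e"
  "omit (Suc m) (e \<circ> adj_swap m) = omit m e"
  by (auto simp: omit_def adj_swap_def fun_eq_iff less_Suc_eq)

lemma omit_omit_same: "omit m (omit (Suc m) e) = omit m (omit m e)"
  by (auto simp: omit_def fun_eq_iff)

lemma case_nat_comp_adj_swap: "case_nat b (e \<circ> adj_swap m) = case_nat b e \<circ> adj_swap (Suc m)"
  by (auto simp: adj_swap_def fun_eq_iff split: nat.splits)

lemma case_nat_adj_swap_0: "case_nat b (case_nat z e) = case_nat z (case_nat b e) \<circ> adj_swap 0"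
  by (auto simp: adj_swap_def fun_eq_iff split: nat.splits)

lemma omit_case_nat:
  "omit 0 (case_nat z e) = e" "omit (Suc i) (case_nat z e) = case_nat z (omit i e)"
  by (auto simp: omit_def fun_eq_iff split: nat.splits)

text \<open>The alternating sum over the omitted index changes sign if two neighbouring entries are
  exchanged: the two summands in which one of them is omitted are interchanged with opposite
  signs, and in all others the two entries are still neighbours.\<close>

lemma alternating_sum_adj_swap:
  fixes \<Phi> :: "'b \<Rightarrow> (nat \<Rightarrow> 'b) \<Rightarrow> real"
  assumes m: "Suc m \<le> k"
    and \<Phi>: "\<And>i l. i \<le> k \<Longrightarrow> Suc l < k \<Longrightarrow> \<Phi> (e i) (omit i e \<circ> adj_swap l) = - \<Phi> (e i) (omit i e)"
  shows "(\<Sum>i\<le>k. (-1) ^ i * \<Phi> ((e \<circ> adj_swap m) i) (omit i (e \<circ> adj_swap m))) = - (\<Sum>i\<le>k. (-1) ^ i * \<Phi> (e i) (omit i e))"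
proof -
  let ?f = "\<lambda>i. (-1) ^ i * \<Phi> ((e \<circ> adj_swap m) i) (omit i (e \<circ> adj_swap m))"
  have "(\<Sum>i\<le>k. ?f i) = (\<Sum>i\<le>k. ?f (adj_swap m i))"
    by (rule sum.reindex_bij_witness[of _ "adj_swap m" "adj_swap m"]) (use m in \<open>auto simp: adj_swap_le\<close>)
  also have "\<dots> = (\<Sum>i\<le>k. - ((-1) ^ i * \<Phi> (e i) (omit i e)))"
  proof (rule sum.cong[OF refl])
    fix i assume "i \<in> {..k}"
    then have i: "i \<le> k" by simp
    consider "i = m" | "i = Suc m" | l where "m = Suc l" "i \<le> l" | "Suc m < i"
      by (metis Suc_lessI less_Suc_eq_le linorder_neqE_nat not0_implies_Suc not_less_zero)
    then show "?f (adj_swap m i) = - ((-1) ^ i * \<Phi> (e i) (omit i e))"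
    proof cases
      case 1
      then have "adj_swap m i = Suc m" by (simp add: adj_swap_def)
      then show ?thesis using 1 by (simp add: omit_comp_adj_swap(4)) (simp add: adj_swap_def)
    next
      case 2
      then have "adj_swap m i = m" by (simp add: adj_swap_def)
      then show ?thesis using 2 by (simp add: omit_comp_adj_swap(3)) (simp add: adj_swap_def)
    next
      case (3 l)
      then have "adj_swap m i = i" by (simp add: adj_swap_def)
      moreover have "omit i (e \<circ> adj_swap m) = omit i e \<circ> adj_swap l" using 3 omit_comp_adj_swap(1) by blast
      ultimately show ?thesis using \<Phi>[OF i, of l] 3 m by simp
    next
      case 4
      then have "adj_swap m i = i" by (simp add: adj_swap_def)
      moreover have "omit i (e \<circ> adj_swap m) = omit i e \<circ> adj_swap m" using 4 omit_comp_adj_swap(2) by blast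
      ultimately show ?thesis using \<Phi>[OF i, of m] 4 i by simp
    qed
  qed
  finally show ?thesis by (simp add: sum_negf)
qed

text \<open>The analogue for the summands with a bracket, in which two entries are omitted.  Pairs are permuted by the
  exchange, except that the pair of the two neighbours itself is fixed; there the antisymmetry of the
  bracket supplies the sign.\<close>

lemma alternating_pair_sum_adj_swap:
  fixes \<Psi> :: "'b \<Rightarrow> 'b \<Rightarrow> (nat \<Rightarrow> 'b) \<Rightarrow> real"
  assumes m: "Suc m \<le> k"
    and anti: "\<And>i j. i < j \<Longrightarrow> j \<le> k \<Longrightarrow> \<Psi> (e j) (e i) (omit i (omit j e)) = - \<Psi> (e i) (e j) (omit i (omit j e))"
    and swap: "\<And>i j l. i < j \<Longrightarrow> j \<le> k \<Longrightarrow> Suc (Suc l) < k \<Longrightarrow>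
      \<Psi> (e i) (e j) (omit i (omit j e) \<circ> adj_swap l) = - \<Psi> (e i) (e j) (omit i (omit j e))"
  shows "(\<Sum>j\<le>k. \<Sum>i<j. (-1) ^ (i + j) * \<Psi> ((e \<circ> adj_swap m) i) ((e \<circ> adj_swap m) j) (omit i (omit j (e \<circ> adj_swap m))))
    = - (\<Sum>j\<le>k. \<Sum>i<j. (-1) ^ (i + j) * \<Psi> (e i) (e j) (omit i (omit j e)))"
proof -
  let ?P = "SIGMA j:{..k}. {..<j}"
  let ?e = "e \<circ> adj_swap m"
  define f where "f = (\<lambda>(j, i). (-1) ^ (i + j) * \<Psi> (e i) (e j) (omit i (omit j e)))"
  define h where "h = (\<lambda>(j, i). (-1) ^ (i + j) * \<Psi> (?e i) (?e j) (omit i (omit j ?e)))"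
  define \<tau> where "\<tau> = (\<lambda>(j, i). if i = m \<and> j = Suc m then (j, i) else (adj_swap m j, adj_swap m i))"
  have "sum h ?P = sum (h \<circ> \<tau>) ?P"
    by (rule sum.reindex_bij_witness[of _ \<tau> \<tau>]) (use m in \<open>auto simp: \<tau>_def adj_swap_def split: if_splits\<close>)
  also have "\<dots> = sum (\<lambda>z. - f z) ?P"
  proof (rule sum.cong[OF refl])
    fix z assume "z \<in> ?P"
    then obtain i j where z: "z = (j, i)" and ij: "i < j" "j \<le> k" by auto
    consider (a) "i = m" "j = Suc m" | (b) "i = m" "Suc m < j" | (c) "i = Suc m" "Suc m < j"
      | (d) "i < m" "j = m" | (e) "i < m" "j = Suc m" | (f) l where "m = Suc (Suc l)" "i \<le> l" "j \<le> Suc l"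
      | (g) l where "m = Suc l" "i \<le> l" "Suc m < j" | (h) "Suc m < i"
    proof -
      have "\<exists>l. m = Suc (Suc l) \<and> i \<le> l \<and> j \<le> Suc l" if "j < m"
        using that ij by (intro exI[of _ "m - 2"]) auto
      moreover have "\<exists>l. m = Suc l \<and> i \<le> l" if "i < m"
        using that by (intro exI[of _ "m - 1"]) auto
      ultimately show ?thesis using that ij by (metis linorder_neqE_nat Suc_lessI less_trans)
    qed
    then show "(h \<circ> \<tau>) z = - f z"
    proof cases
      case a
      then show ?thesis using anti[of m "Suc m"] ij
        by (simp add: z h_def f_def \<tau>_def omit_comp_adj_swap omit_omit_same) (simp add: adj_swap_def)
    next
      case b
      then have t: "\<tau> z = (j, Suc m)" by (simp add: z \<tau>_def adj_swap_def)
      have "omit (Suc m) (omit j ?e) = omit m (omit j e)" using b by (simp add: omit_comp_adj_swap)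
      then show ?thesis using b by (simp add: t h_def f_def) (simp add: z adj_swap_def)
    next
      case c
      then have t: "\<tau> z = (j, m)" by (simp add: z \<tau>_def adj_swap_def)
      have "omit m (omit j ?e) = omit (Suc m) (omit j e)" using c by (simp add: omit_comp_adj_swap)
      then show ?thesis using c by (simp add: t h_def f_def) (simp add: z adj_swap_def)
    next
      case d
      then have t: "\<tau> z = (Suc m, i)" by (simp add: z \<tau>_def adj_swap_def)
      show ?thesis using d by (simp add: t h_def f_def omit_comp_adj_swap) (simp add: z adj_swap_def)
    next
      case e
      then have t: "\<tau> z = (m, i)" by (simp add: z \<tau>_def adj_swap_def)
      show ?thesis using e by (simp add: t h_def f_def omit_comp_adj_swap) (simp add: z adj_swap_def)
    next
      case (f l)
      then have t: "\<tau> z = (j, i)" "adj_swap m i = i" "adj_swap m j = j" using ij by (auto simp: z \<tau>_def adj_swap_def)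
      have "omit i (omit j ?e) = omit i (omit j e) \<circ> adj_swap l"
        using f omit_comp_adj_swap(1)[of j "Suc l" e] omit_comp_adj_swap(1)[of i l "omit j e"] by simp
      moreover have "Suc (Suc l) < k" using f m by simp
      ultimately show ?thesis using swap[OF ij, of l] by (simp add: t h_def f_def) (simp add: z)
    next
      case (g l)
      then have t: "\<tau> z = (j, i)" "adj_swap m i = i" "adj_swap m j = j" using ij by (auto simp: z \<tau>_def adj_swap_def)
      have "omit i (omit j ?e) = omit i (omit j e) \<circ> adj_swap l"
        using g omit_comp_adj_swap(2)[of m j e] omit_comp_adj_swap(1)[of i l "omit j e"] by simp
      moreover have "Suc (Suc l) < k" using g ij by simp
      ultimately show ?thesis using swap[OF ij, of l] by (simp add: t h_def f_def) (simp add: z)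
    next
      case h
      then have t: "\<tau> z = (j, i)" "adj_swap m i = i" "adj_swap m j = j" using ij by (auto simp: z \<tau>_def adj_swap_def)
      have "omit i (omit j ?e) = omit i (omit j e) \<circ> adj_swap m"
        using h ij omit_comp_adj_swap(2)[of m j e] omit_comp_adj_swap(2)[of m i "omit j e"] by simp
      then show ?thesis using swap[OF ij, of m] h ij by (simp add: t h_def f_def) (simp add: z)
    qed
  qed
  finally have "sum h ?P = - sum f ?P" by (simp add: sum_negf)
  then show ?thesis unfolding f_def h_def by (simp add: sum.Sigma)
qed

context riemannian_manifold
begin

text \<open>Forms take infinite sequences, of which the first \<open>k\<close> entries matter.  Exchanging neighbours generates all
  permutations, so antisymmetry is asked for these exchanges and linearity for the first entry only.  The notion
  is meant for \<open>k \<ge> 1\<close>.\<close>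

definition alternating_form :: "nat \<Rightarrow> 'm form \<Rightarrow> bool" where
  "alternating_form k \<omega> \<longleftrightarrow>
     (\<forall>x e e'. (\<forall>i<k. e i = e' i) \<longrightarrow> \<omega> x e = \<omega> x e') \<and>
     (\<forall>x e m. Suc m < k \<and> (\<forall>i<k. e i \<in> T x) \<longrightarrow> \<omega> x (e \<circ> adj_swap m) = - \<omega> x e) \<and>
     (\<forall>x e u v a b. (\<forall>i. Suc i < k \<longrightarrow> e i \<in> T x) \<and> u \<in> T x \<and> v \<in> T x \<longrightarrow>
        \<omega> x (case_nat (\<lambda>f. a * u f + b * v f) e) = a * \<omega> x (case_nat u e) + b * \<omega> x (case_nat v e)) \<and>
     (\<forall>U E. open U \<and> (\<forall>i<k. vf U (E i)) \<longrightarrow> smooth U (\<lambda>y. \<omega> y (\<lambda>l. E l y)))"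

context
  fixes k :: nat and \<omega> :: "'m form"
  assumes \<omega>: "alternating_form k \<omega>"
begin

lemma form_cong: "(\<And>i. i < k \<Longrightarrow> e i = e' i) \<Longrightarrow> \<omega> y e = \<omega> y e'"
  and form_adj_swap: "Suc m < k \<Longrightarrow> (\<And>i. i < k \<Longrightarrow> e i \<in> T y) \<Longrightarrow> \<omega> y (e \<circ> adj_swap m) = - \<omega> y e"
  and form_lincomb: "(\<And>i. Suc i < k \<Longrightarrow> e i \<in> T y) \<Longrightarrow> u \<in> T y \<Longrightarrow> v \<in> T y \<Longrightarrow>
    \<omega> y (case_nat (\<lambda>f. a * u f + b * v f) e) = a * \<omega> y (case_nat u e) + b * \<omega> y (case_nat v e)"
  and form_smooth: "open U \<Longrightarrow> (\<And>i. i < k \<Longrightarrow> vf U (E i)) \<Longrightarrow> smooth U (\<lambda>y. \<omega> y (\<lambda>l. E l y))"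
proof -
  note d = \<omega>[unfolded alternating_form_def]
  show "\<omega> y e = \<omega> y e'" if "\<And>i. i < k \<Longrightarrow> e i = e' i"
    using that by (intro d[THEN conjunct1, rule_format])
  show "\<omega> y (e \<circ> adj_swap m) = - \<omega> y e" if "Suc m < k" "\<And>i. i < k \<Longrightarrow> e i \<in> T y"
    using that by (intro d[THEN conjunct2, THEN conjunct1, rule_format] conjI allI impI)
  show "\<omega> y (case_nat (\<lambda>f. a * u f + b * v f) e) = a * \<omega> y (case_nat u e) + b * \<omega> y (case_nat v e)"
    if "\<And>i. Suc i < k \<Longrightarrow> e i \<in> T y" "u \<in> T y" "v \<in> T y"
    using that by (intro d[THEN conjunct2, THEN conjunct2, THEN conjunct1, rule_format] conjI allI impI)
  show "smooth U (\<lambda>y. \<omega> y (\<lambda>l. E l y))" if "open U" "\<And>i. i < k \<Longrightarrow> vf U (E i)"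
    using that by (intro d[THEN conjunct2, THEN conjunct2, THEN conjunct2, rule_format] conjI allI impI)
qed

lemma form_lincomb_sum:
  assumes I: "finite I" "\<And>i. i \<in> I \<Longrightarrow> u i \<in> T y" and e: "\<And>i. Suc i < k \<Longrightarrow> e i \<in> T y"
  shows "\<omega> y (case_nat (\<lambda>f. \<Sum>i\<in>I. a i * u i f) e) = (\<Sum>i\<in>I. a i * \<omega> y (case_nat (u i) e))"
  using I
proof (induction I rule: finite_induct)
  case empty
  show ?case unfolding sum.empty using form_lincomb[where a = 0 and b = 0 and e = e, OF e tangent_zero tangent_zero] by simp
next
  case (insert i I)
  have "(\<lambda>f. \<Sum>i\<in>I. a i * u i f) \<in> T y" using insert by (intro tangent_lincomb_sum) auto
  then show ?case
    unfolding sum.insert[OF insert(1,2)]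
    using insert form_lincomb[where a = "a i" and b = 1 and e = e, OF e, of "u i" "\<lambda>f. \<Sum>i\<in>I. a i * u i f"]
    by simp
qed

text \<open>Linearity in the entry after a bracket, obtained by exchanging the two.\<close>

lemma form_lincomb_sum_second:
  assumes k: "Suc 0 < k" and I: "finite I" "\<And>i. i \<in> I \<Longrightarrow> u i \<in> T y" and b: "b \<in> T y"
    and e: "\<And>i. Suc (Suc i) < k \<Longrightarrow> e i \<in> T y"
  shows "\<omega> y (case_nat b (case_nat (\<lambda>f. \<Sum>i\<in>I. a i * u i f) e)) = (\<Sum>i\<in>I. a i * \<omega> y (case_nat b (case_nat (u i) e)))"
proof -
  have *: "\<omega> y (case_nat b (case_nat z e)) = - \<omega> y (case_nat z (case_nat b e))" if "z \<in> T y" for z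
    unfolding case_nat_adj_swap_0[of b] using that b e k by (intro form_adj_swap) (auto split: nat.splits)
  have "(\<lambda>f. \<Sum>i\<in>I. a i * u i f) \<in> T y" using I by (intro tangent_lincomb_sum) auto
  moreover have "\<omega> y (case_nat (\<lambda>f. \<Sum>i\<in>I. a i * u i f) (case_nat b e)) = (\<Sum>i\<in>I. a i * \<omega> y (case_nat (u i) (case_nat b e)))"
    using b e by (intro form_lincomb_sum I) (auto split: nat.splits)
  ultimately show ?thesis using I(2) by (simp add: * sum_negf[symmetric])
qed

context
  fixes U :: "'m set" and x :: 'm
  assumes U: "open U" "x \<in> U"
begin

lemma ext_deriv_cong:
  assumes E: "\<And>i. i \<le> k \<Longrightarrow> vf U (E i)" "\<And>i y. i \<le> k \<Longrightarrow> y \<in> U \<Longrightarrow> E i y = E' i y"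
  shows "ext_deriv A k \<omega> E x = ext_deriv A k \<omega> E' x"
proof -
  have "E i x (\<lambda>y. \<omega> y (\<lambda>l. omit i E l y)) = E' i x (\<lambda>y. \<omega> y (\<lambda>l. omit i E' l y))" if i: "i \<le> k" for i
  proof -
    have "E i x (\<lambda>y. \<omega> y (\<lambda>l. omit i E l y)) = E i x (\<lambda>y. \<omega> y (\<lambda>l. omit i E' l y))"
      by (rule tangent_cong[OF vf_tangent[OF E(1)[OF i] U(2)] U], rule form_cong)
        (use E(2) in \<open>auto simp: omit_def\<close>)
    then show ?thesis using E(2)[OF i U(2)] by simp
  qed
  moreover have "\<omega> x (case_nat (lie_bracket A (E i) (E j) x) (\<lambda>l. omit i (omit j E) l x))
      = \<omega> x (case_nat (lie_bracket A (E' i) (E' j) x) (\<lambda>l. omit i (omit j E') l x))"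
    if ij: "i < j" "j \<le> k" for i j
  proof (rule form_cong)
    fix l assume l: "l < k"
    have "lie_bracket A (E i) (E j) x = lie_bracket A (E' i) (E' j) x"
      using ij E by (intro bracket_cong[OF U]) auto
    then show "(case l of 0 \<Rightarrow> lie_bracket A (E i) (E j) x | Suc l \<Rightarrow> omit i (omit j E) l x)
        = (case l of 0 \<Rightarrow> lie_bracket A (E' i) (E' j) x | Suc l \<Rightarrow> omit i (omit j E') l x)"
      using E(2)[OF _ U(2)] l by (auto simp: omit_def split: nat.splits)
  qed
  ultimately show ?thesis unfolding ext_deriv_def by simp
qed

text \<open>Both sums in the formula for the exterior derivative are alternating sums as above.\<close>

lemma ext_deriv_adj_swap:
  assumes E: "\<And>i. i \<le> k \<Longrightarrow> vf U (E i)" and m: "Suc m \<le> k"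
  shows "ext_deriv A k \<omega> (E \<circ> adj_swap m) x = - ext_deriv A k \<omega> E x"
proof -
  let ?\<Phi> = "\<lambda>X e. X x (\<lambda>y. \<omega> y (\<lambda>l. e l y))"
  let ?\<Psi> = "\<lambda>X Y e. \<omega> x (case_nat (lie_bracket A X Y x) (\<lambda>l. e l x))"
  have om: "vf U (omit i E l)" if "i \<le> k" "l < k" for i l
    using E that by (simp add: omit_def)
  have om2: "omit i (omit j E) l x \<in> T x" if "i < j" "j \<le> k" "Suc l < k" for i j l
    using vf_tangent[OF E U(2)] that by (simp add: omit_def)
  have br: "lie_bracket A (E i) (E j) x \<in> T x" if "i < j" "j \<le> k" for i j
    using vf_tangent[OF bracket_vf[OF U(1) E E] U(2)] that by simp
  have "(\<Sum>i\<le>k. (-1) ^ i * ?\<Phi> ((E \<circ> adj_swap m) i) (omit i (E \<circ> adj_swap m))) = - (\<Sum>i\<le>k. (-1) ^ i * ?\<Phi> (E i) (omit i E))"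
  proof (rule alternating_sum_adj_swap[where \<Phi> = ?\<Phi> and e = E, OF m])
    fix i l assume i: "i \<le> k" and l: "Suc l < k"
    have Ei: "E i x \<in> T x" using vf_tangent[OF E[OF i] U(2)] .
    have "?\<Phi> (E i) (omit i E \<circ> adj_swap l) = E i x (\<lambda>y. -1 * \<omega> y (\<lambda>l. omit i E l y))"
    proof (rule tangent_cong[OF Ei U])
      fix y assume y: "y \<in> U"
      have "(\<lambda>j. (omit i E \<circ> adj_swap l) j y) = (\<lambda>j. omit i E j y) \<circ> adj_swap l" by auto
      then show "\<omega> y (\<lambda>j. (omit i E \<circ> adj_swap l) j y) = -1 * \<omega> y (\<lambda>j. omit i E j y)"
        using form_adj_swap[OF l, of "\<lambda>j. omit i E j y" y] vf_tangent[OF om[OF i] y] by simp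
    qed
    also have "\<dots> = -1 * ?\<Phi> (E i) (omit i E)"
      by (rule tangent_cmult[OF Ei smooth_nearI[OF U form_smooth[OF U(1) om[OF i]]]])
    finally show "?\<Phi> (E i) (omit i E \<circ> adj_swap l) = - ?\<Phi> (E i) (omit i E)" by simp
  qed
  moreover have "(\<Sum>j\<le>k. \<Sum>i<j. (-1) ^ (i + j) * ?\<Psi> ((E \<circ> adj_swap m) i) ((E \<circ> adj_swap m) j) (omit i (omit j (E \<circ> adj_swap m))))
    = - (\<Sum>j\<le>k. \<Sum>i<j. (-1) ^ (i + j) * ?\<Psi> (E i) (E j) (omit i (omit j E)))"
  proof (rule alternating_pair_sum_adj_swap[where \<Psi> = ?\<Psi> and e = E, OF m])
    fix i j assume ij: "i < j" "j \<le> k"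
    have "case_nat (lie_bracket A (E j) (E i) x) (\<lambda>l. omit i (omit j E) l x)
      = case_nat (\<lambda>f. (-1) * lie_bracket A (E i) (E j) x f + 0 * lie_bracket A (E i) (E j) x f) (\<lambda>l. omit i (omit j E) l x)"
      by (simp add: bracket_antisym[of "E j" "E i"])
    then show "?\<Psi> (E j) (E i) (omit i (omit j E)) = - ?\<Psi> (E i) (E j) (omit i (omit j E))"
      using form_lincomb[where a = "-1" and b = 0 and e = "\<lambda>l. omit i (omit j E) l x", OF om2[OF ij] br[OF ij] br[OF ij]] by simp
  next
    fix i j l assume ij: "i < j" "j \<le> k" and l: "Suc (Suc l) < k"
    have "(\<lambda>n. (omit i (omit j E) \<circ> adj_swap l) n x) = (\<lambda>n. omit i (omit j E) n x) \<circ> adj_swap l" by auto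
    then show "?\<Psi> (E i) (E j) (omit i (omit j E) \<circ> adj_swap l) = - ?\<Psi> (E i) (E j) (omit i (omit j E))"
      using form_adj_swap[OF l, of "case_nat (lie_bracket A (E i) (E j) x) (\<lambda>l. omit i (omit j E) l x)" x]
        om2[OF ij] br[OF ij] by (simp add: case_nat_comp_adj_swap split: nat.splits)
  qed
  ultimately show ?thesis unfolding ext_deriv_def by simp
qed

text \<open>The first argument \<open>Z\<close> occurs once as a derivation, then inside a form that is differentiated or in a bracket,
  and finally as a mere entry of the form.\<close>

lemma ext_deriv_case_nat:
  shows "ext_deriv A k \<omega> (case_nat Z E) x = Z x (\<lambda>y. \<omega> y (\<lambda>l. E l y))
    - (\<Sum>i<k. (-1) ^ i * (E i x (\<lambda>y. \<omega> y (case_nat (Z y) (\<lambda>l. omit i E l y)))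
        + \<omega> x (case_nat (lie_bracket A Z (E i) x) (\<lambda>l. omit i E l x))))
    + (\<Sum>j<k. \<Sum>i<j. (-1) ^ (i + j) * \<omega> x (case_nat (lie_bracket A (E i) (E j) x)
        (case_nat (Z x) (\<lambda>l. omit i (omit j E) l x))))"
proof -
  have c: "(\<lambda>l. case_nat P Q l y) = case_nat (P y) (\<lambda>l. Q l y)" for P :: "'m vfield" and Q y
    by (auto simp: fun_eq_iff split: nat.splits)
  have "(\<Sum>i\<le>k. (-1) ^ i * case_nat Z E i x (\<lambda>y. \<omega> y (\<lambda>l. omit i (case_nat Z E) l y)))
    = Z x (\<lambda>y. \<omega> y (\<lambda>l. E l y)) - (\<Sum>i<k. (-1) ^ i * E i x (\<lambda>y. \<omega> y (case_nat (Z y) (\<lambda>l. omit i E l y))))"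
    unfolding sum.atMost_shift by (simp add: omit_case_nat c sum_negf)
  moreover have "(\<Sum>j\<le>k. \<Sum>i<j. (-1) ^ (i + j) * \<omega> x (case_nat (lie_bracket A (case_nat Z E i) (case_nat Z E j) x)
        (\<lambda>l. omit i (omit j (case_nat Z E)) l x)))
    = - (\<Sum>i<k. (-1) ^ i * \<omega> x (case_nat (lie_bracket A Z (E i) x) (\<lambda>l. omit i E l x)))
    + (\<Sum>j<k. \<Sum>i<j. (-1) ^ (i + j) * \<omega> x (case_nat (lie_bracket A (E i) (E j) x)
        (case_nat (Z x) (\<lambda>l. omit i (omit j E) l x))))"
    unfolding sum.atMost_shift
    by (simp add: omit_case_nat c sum.lessThan_Suc_shift sum.distrib sum_negf sum_subtractf del: sum.lessThan_Suc)
  ultimately show ?thesis unfolding ext_deriv_def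
    by (simp add: sum.distrib sum_subtractf sum_negf distrib_left)
qed

text \<open>The derivatives \<open>E\<^sub>i(h)\<close> of a coefficient arise twice, from differentiating the form and from the bracket
  \<open>[h B, E\<^sub>i] = h [B, E\<^sub>i] - E\<^sub>i(h) B\<close>, with opposite signs.\<close>

lemma ext_deriv_linear_first:
  assumes I: "finite I" "\<And>a. a \<in> I \<Longrightarrow> vf U (B a)" "\<And>a. a \<in> I \<Longrightarrow> smooth U (h a)"
    and E: "\<And>i. i < k \<Longrightarrow> vf U (E i)"
  shows "ext_deriv A k \<omega> (case_nat (\<lambda>y f. \<Sum>a\<in>I. h a y * B a y f) E) x
    = (\<Sum>a\<in>I. h a x * ext_deriv A k \<omega> (case_nat (B a) E) x)"
proof -
  let ?Z = "\<lambda>y f. \<Sum>a\<in>I. h a y * B a y f"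
  have BT: "B a y \<in> T y" if "a \<in> I" "y \<in> U" for a y using vf_tangent I(2) that by blast
  have om: "vf U (omit i E l)" if "i < k" "Suc l < k" for i l
    using E that by (simp add: omit_def)
  have omT: "omit i E l y \<in> T y" if "i < k" "Suc l < k" "y \<in> U" for i l y
    using vf_tangent[OF om] that by blast
  have om2: "omit i (omit j E) l x \<in> T x" if "i < j" "j < k" "Suc (Suc l) < k" for i j l
    using vf_tangent[OF E U(2)] that by (simp add: omit_def)
  define P where "P i a y = \<omega> y (case_nat (B a y) (\<lambda>l. omit i E l y))" for i a y
  have Ps: "smooth U (P i a)" if "i < k" "a \<in> I" for i a
  proof -
    have "smooth U (\<lambda>y. \<omega> y (\<lambda>l. case_nat (B a) (omit i E) l y))"
      using that I(2) om by (intro form_smooth U(1)) (auto split: nat.splits)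
    moreover have "(\<lambda>l. case_nat (B a) (omit i E) l y) = case_nat (B a y) (\<lambda>l. omit i E l y)" for y
      by (auto simp: fun_eq_iff split: nat.splits)
    ultimately show ?thesis by (simp add: P_def[abs_def])
  qed
  have 1: "E i x (\<lambda>y. \<omega> y (case_nat (?Z y) (\<lambda>l. omit i E l y)))
      + \<omega> x (case_nat (lie_bracket A ?Z (E i) x) (\<lambda>l. omit i E l x))
    = (\<Sum>a\<in>I. h a x * (E i x (P i a) + \<omega> x (case_nat (lie_bracket A (B a) (E i) x) (\<lambda>l. omit i E l x))))"
    if i: "i < k" for i
  proof -
    have Ei: "E i x \<in> T x" using vf_tangent[OF E[OF i] U(2)] .
    have "E i x (\<lambda>y. \<omega> y (case_nat (?Z y) (\<lambda>l. omit i E l y))) = E i x (\<lambda>y. \<Sum>a\<in>I. h a y * P i a y)"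
      unfolding P_def by (rule tangent_cong[OF Ei U]) (auto intro!: form_lincomb_sum I BT omT i)
    also have "\<dots> = (\<Sum>a\<in>I. E i x (\<lambda>y. h a y * P i a y))"
      by (rule tangent_sum[OF Ei], rule smooth_near_mult) (blast intro: smooth_nearI[OF U] I Ps i)+
    also have "\<dots> = (\<Sum>a\<in>I. h a x * E i x (P i a) + E i x (h a) * P i a x)"
      by (intro sum.cong refl tangent_mult[OF Ei] smooth_nearI[OF U] I Ps i)
    finally have e1: "E i x (\<lambda>y. \<omega> y (case_nat (?Z y) (\<lambda>l. omit i E l y)))
      = (\<Sum>a\<in>I. h a x * E i x (P i a) + E i x (h a) * P i a x)" .
    have brT: "lie_bracket A (B a) (E i) x \<in> T x" if "a \<in> I" for a
      using vf_tangent[OF bracket_vf[OF U(1) I(2)[OF that] E[OF i]] U(2)] .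
    have "lie_bracket A ?Z (E i) x = (\<lambda>f. \<Sum>a\<in>I. h a x * lie_bracket A (B a) (E i) x f - E i x (h a) * B a x f)"
      by (rule bracket_lincomb_left[OF U E[OF i]]) (use I in auto)
    also have "\<dots> = (\<lambda>f. 1 * (\<Sum>a\<in>I. h a x * lie_bracket A (B a) (E i) x f) + (-1) * (\<Sum>a\<in>I. E i x (h a) * B a x f))"
      by (simp add: sum_subtractf)
    finally have br: "lie_bracket A ?Z (E i) x = (\<lambda>f. 1 * (\<Sum>a\<in>I. h a x * lie_bracket A (B a) (E i) x f)
        + (-1) * (\<Sum>a\<in>I. E i x (h a) * B a x f))" .
    have "\<omega> x (case_nat (lie_bracket A ?Z (E i) x) (\<lambda>l. omit i E l x))
      = 1 * \<omega> x (case_nat (\<lambda>f. \<Sum>a\<in>I. h a x * lie_bracket A (B a) (E i) x f) (\<lambda>l. omit i E l x))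
        + (-1) * \<omega> x (case_nat (\<lambda>f. \<Sum>a\<in>I. E i x (h a) * B a x f) (\<lambda>l. omit i E l x))"
      unfolding br by (intro form_lincomb tangent_lincomb_sum brT BT U omT i)
    also have "\<omega> x (case_nat (\<lambda>f. \<Sum>a\<in>I. h a x * lie_bracket A (B a) (E i) x f) (\<lambda>l. omit i E l x))
      = (\<Sum>a\<in>I. h a x * \<omega> x (case_nat (lie_bracket A (B a) (E i) x) (\<lambda>l. omit i E l x)))"
      by (intro form_lincomb_sum I brT omT i U)
    also have "\<omega> x (case_nat (\<lambda>f. \<Sum>a\<in>I. E i x (h a) * B a x f) (\<lambda>l. omit i E l x))
      = (\<Sum>a\<in>I. E i x (h a) * P i a x)"
      unfolding P_def by (intro form_lincomb_sum I BT omT i U)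
    finally show ?thesis unfolding e1
      by (simp add: sum.distrib[symmetric] sum_subtractf[symmetric] distrib_left)
  qed
  have 2: "\<omega> x (case_nat (lie_bracket A (E i) (E j) x) (case_nat (?Z x) (\<lambda>l. omit i (omit j E) l x)))
    = (\<Sum>a\<in>I. h a x * \<omega> x (case_nat (lie_bracket A (E i) (E j) x) (case_nat (B a x) (\<lambda>l. omit i (omit j E) l x))))"
    if ij: "i < j" "j < k" for i j
  proof (rule form_lincomb_sum_second)
    show "lie_bracket A (E i) (E j) x \<in> T x"
      using vf_tangent[OF bracket_vf[OF U(1) E E] U(2)] ij by simp
  qed (use ij I BT U om2[OF ij] in auto)
  have "ext_deriv A k \<omega> (case_nat ?Z E) x = (\<Sum>a\<in>I. h a x * B a x (\<lambda>y. \<omega> y (\<lambda>l. E l y)))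
    - (\<Sum>i<k. (-1) ^ i * (\<Sum>a\<in>I. h a x * (E i x (P i a) + \<omega> x (case_nat (lie_bracket A (B a) (E i) x) (\<lambda>l. omit i E l x)))))
    + (\<Sum>j<k. \<Sum>i<j. (-1) ^ (i + j) * (\<Sum>a\<in>I. h a x * \<omega> x (case_nat (lie_bracket A (E i) (E j) x)
        (case_nat (B a x) (\<lambda>l. omit i (omit j E) l x)))))"
    unfolding ext_deriv_case_nat using 1 2 by simp
  also have "\<dots> = (\<Sum>a\<in>I. h a x * ext_deriv A k \<omega> (case_nat (B a) E) x)"
  proof -
    have s1: "(\<Sum>i<k. (-1) ^ i * (\<Sum>a\<in>I. h a x * Q i a)) = (\<Sum>a\<in>I. h a x * (\<Sum>i<k. (-1) ^ i * Q i a))"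
      for Q :: "nat \<Rightarrow> _ \<Rightarrow> real"
      unfolding sum_distrib_left by (subst sum.swap) (simp add: ac_simps)
    have s2: "(\<Sum>j<k. \<Sum>i<j. (-1) ^ (i + j) * (\<Sum>a\<in>I. h a x * Q i j a))
        = (\<Sum>a\<in>I. h a x * (\<Sum>j<k. \<Sum>i<j. (-1) ^ (i + j) * Q i j a))" for Q :: "nat \<Rightarrow> nat \<Rightarrow> _ \<Rightarrow> real"
    proof -
      have "(\<Sum>j<k. \<Sum>i<j. (-1) ^ (i + j) * (\<Sum>a\<in>I. h a x * Q i j a))
        = (\<Sum>j<k. \<Sum>a\<in>I. \<Sum>i<j. h a x * ((-1) ^ (i + j) * Q i j a))"
        unfolding sum_distrib_left by (rule sum.cong[OF refl], subst sum.swap) (simp add: ac_simps)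
      also have "\<dots> = (\<Sum>a\<in>I. \<Sum>j<k. \<Sum>i<j. h a x * ((-1) ^ (i + j) * Q i j a))" by (rule sum.swap)
      finally show ?thesis by (simp add: sum_distrib_left)
    qed
    show ?thesis
      unfolding s1 s2 ext_deriv_case_nat P_def
      by (simp add: sum.distrib[symmetric] sum_subtractf[symmetric] distrib_left right_diff_distrib)
  qed
  finally show ?thesis .
qed

text \<open>An exchange of neighbours moves slot \<open>r + 1\<close> to slot \<open>r\<close>.\<close>

lemma ext_deriv_linear:
  assumes I: "finite I" "\<And>a. a \<in> I \<Longrightarrow> vf U (B a)" "\<And>a. a \<in> I \<Longrightarrow> smooth U (h a)"
    and r: "r \<le> k" and E: "\<And>i. i \<le> k \<Longrightarrow> vf U (E i)"
  shows "ext_deriv A k \<omega> (E(r := (\<lambda>y f. \<Sum>a\<in>I. h a y * B a y f))) x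
    = (\<Sum>a\<in>I. h a x * ext_deriv A k \<omega> (E(r := B a)) x)"
  using r E
proof (induction r arbitrary: E)
  case 0
  have "E(0 := Z) = case_nat Z (\<lambda>i. E (Suc i))" for Z :: "'m vfield"
    by (auto simp: fun_eq_iff split: nat.splits)
  then show ?case using ext_deriv_linear_first[where E = "\<lambda>i. E (Suc i)", OF I] 0 by simp
next
  case (Suc r)
  have u: "E(Suc r := Z) = (E \<circ> adj_swap r)(r := Z) \<circ> adj_swap r" for Z :: "'m vfield"
    by (auto simp: fun_eq_iff adj_swap_def)
  have sw: "ext_deriv A k \<omega> (E(Suc r := Z)) x = - ext_deriv A k \<omega> ((E \<circ> adj_swap r)(r := Z)) x" if "vf U Z" for Z
    unfolding u using Suc.prems that by (intro ext_deriv_adj_swap) (auto simp: adj_swap_le)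
  have "vf U (\<lambda>y f. \<Sum>a\<in>I. h a y * B a y f)" by (intro vf_lincomb U I)
  moreover have "ext_deriv A k \<omega> ((E \<circ> adj_swap r)(r := (\<lambda>y f. \<Sum>a\<in>I. h a y * B a y f))) x
    = (\<Sum>a\<in>I. h a x * ext_deriv A k \<omega> ((E \<circ> adj_swap r)(r := B a)) x)"
    using Suc.prems by (intro Suc.IH) (auto simp: adj_swap_le)
  moreover have "(\<Sum>a\<in>I. h a x * ext_deriv A k \<omega> (E(Suc r := B a)) x)
      = (\<Sum>a\<in>I. - (h a x * ext_deriv A k \<omega> ((E \<circ> adj_swap r)(r := B a)) x))"
    by (rule sum.cong[OF refl]) (simp only: sw[OF I(2)] mult_minus_right)
  ultimately show ?case by (simp only: sw sum_negf)
qed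

text \<open>Linearity in every slot reduces arbitrary arguments, slot by slot, to members of the frame.\<close>

lemma ext_deriv_vanishes_on_frame:
  fixes N :: nat
  assumes B: "\<And>a. a < N \<Longrightarrow> vf U (B a)"
    and h: "\<And>i a. i \<le> k \<Longrightarrow> a < N \<Longrightarrow> smooth U (h i a)"
    and E: "\<And>i y. i \<le> k \<Longrightarrow> y \<in> U \<Longrightarrow> E i y = (\<lambda>f. \<Sum>a<N. h i a y * B a y f)"
    and zero: "\<And>\<sigma>. (\<And>i. i \<le> k \<Longrightarrow> \<sigma> i < N) \<Longrightarrow> ext_deriv A k \<omega> (\<lambda>i. B (\<sigma> i)) x = 0"
  shows "ext_deriv A k \<omega> E x = 0"
proof -
  have lc: "vf U (\<lambda>y f. \<Sum>a<N. h i a y * B a y f)" if "i \<le> k" for i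
    using that B h by (intro vf_lincomb U) auto
  have *: "ext_deriv A k \<omega> (\<lambda>i. if i < r then (\<lambda>y f. \<Sum>a<N. h i a y * B a y f) else B (\<sigma> i)) x = 0"
    if "r \<le> Suc k" "\<And>i. i \<le> k \<Longrightarrow> \<sigma> i < N" for r \<sigma>
    using that
  proof (induction r arbitrary: \<sigma>)
    case 0
    then show ?case using zero by simp
  next
    case (Suc r)
    define G where "G \<sigma> = (\<lambda>i. if i < r then (\<lambda>y f. \<Sum>a<N. h i a y * B a y f) else B (\<sigma> i))" for \<sigma> :: "nat \<Rightarrow> nat"
    have "(\<lambda>i. if i < Suc r then (\<lambda>y f. \<Sum>a<N. h i a y * B a y f) else B (\<sigma> i))
      = (G \<sigma>)(r := (\<lambda>y f. \<Sum>a<N. h r a y * B a y f))"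
      by (auto simp: G_def fun_eq_iff less_Suc_eq)
    moreover have "ext_deriv A k \<omega> ((G \<sigma>)(r := (\<lambda>y f. \<Sum>a<N. h r a y * B a y f))) x
      = (\<Sum>a<N. h r a x * ext_deriv A k \<omega> ((G \<sigma>)(r := B a)) x)"
      using Suc.prems B h lc by (intro ext_deriv_linear) (auto simp: G_def)
    moreover have "ext_deriv A k \<omega> ((G \<sigma>)(r := B a)) x = 0" if "a < N" for a
    proof -
      have "(G \<sigma>)(r := B a) = G (\<sigma>(r := a))" by (auto simp: G_def fun_eq_iff)
      then show ?thesis using Suc.IH[of "\<sigma>(r := a)"] Suc.prems that by (simp add: G_def)
    qed
    ultimately show ?case by simp
  qed
  show ?thesis
  proof (cases "N = 0")
    case True
    then have "E i y = (\<lambda>f. 0)" if "i \<le> k" "y \<in> U" for i y using E that by simp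
    moreover have "vf U (\<lambda>y f. 0 :: real)" using vf_lincomb[of U "{}"] U by simp
    ultimately have "ext_deriv A k \<omega> (\<lambda>i y f. 0) x = ext_deriv A k \<omega> E x"
      by (intro ext_deriv_cong) auto
    moreover have "ext_deriv A k \<omega> ((\<lambda>i y f. 0)(0 := (\<lambda>y f. \<Sum>a\<in>{}. h 0 a y * B a y f))) x = 0"
      using ext_deriv_linear[of "{}" B "h 0" 0 "\<lambda>i y f. 0"] \<open>vf U (\<lambda>y f. 0)\<close> by simp
    ultimately show ?thesis by (simp add: fun_upd_def)
  next
    case False
    have "ext_deriv A k \<omega> (\<lambda>i. if i < Suc k then (\<lambda>y f. \<Sum>a<N. h i a y * B a y f) else B 0) x
      = ext_deriv A k \<omega> E x"
      by (rule ext_deriv_cong) (use lc E in auto)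
    then show ?thesis using *[of "Suc k" "\<lambda>_. 0"] False by simp
  qed
qed

text \<open>Exchange neighbours until the two equal entries are adjacent.\<close>

lemma ext_deriv_repeated:
  assumes E: "\<And>i. i \<le> k \<Longrightarrow> vf U (E i)" and ij: "i < j" "j \<le> k" "E i = E j"
  shows "ext_deriv A k \<omega> E x = 0"
  using E ij
proof (induction "j - Suc i" arbitrary: j E)
  case 0
  then have j: "j = Suc i" by simp
  have "E \<circ> adj_swap i = E" using 0 j by (auto simp: fun_eq_iff adj_swap_def)
  then show ?case using ext_deriv_adj_swap[of E i] 0 j by simp
next
  case (Suc d)
  then obtain j' where j': "j = Suc j'" "i < j'" by (cases j) auto
  have "ext_deriv A k \<omega> (E \<circ> adj_swap j') x = 0"
    using Suc.prems Suc.hyps j' by (intro Suc.hyps(1)[of j']) (auto simp: adj_swap_le adj_swap_def)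
  then show ?case using ext_deriv_adj_swap[of E j'] Suc.prems j' by simp
qed

text \<open>Only the vanishing is claimed, so signs need not be tracked.  The entries \<open>B 0\<close>, \<open>B 1\<close>, \<open>\<dots>\<close> are brought into
  their places one after the other; if one of them does not occur, another occurs twice.\<close>

lemma ext_deriv_reordered:
  assumes B: "\<And>i. i \<le> k \<Longrightarrow> vf U (B i)" and zero: "ext_deriv A k \<omega> B x = 0" and \<sigma>: "\<And>i. i \<le> k \<Longrightarrow> \<sigma> i \<le> k"
  shows "ext_deriv A k \<omega> (\<lambda>i. B (\<sigma> i)) x = 0"
proof -
  have "ext_deriv A k \<omega> (\<lambda>i. B (\<sigma> i)) x = 0"
    if "r \<le> Suc k" "\<And>i. i \<le> k \<Longrightarrow> \<sigma> i \<le> k" "\<And>i. i < r \<Longrightarrow> \<sigma> i = i" for r \<sigma>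
    using that
  proof (induction "Suc k - r" arbitrary: r \<sigma>)
    case 0
    then have "ext_deriv A k \<omega> B x = ext_deriv A k \<omega> (\<lambda>i. B (\<sigma> i)) x"
      using B by (intro ext_deriv_cong) auto
    then show ?case using zero by simp
  next
    case (Suc d)
    note IH = Suc.hyps(1)
    have r: "r \<le> k" "d = Suc k - Suc r" using Suc.hyps(2) by auto
    show ?case
    proof (cases "\<exists>j. r \<le> j \<and> j \<le> k \<and> \<sigma> j = r")
      case True
      then obtain j where j: "r \<le> j" "j \<le> k" "\<sigma> j = r" by blast
      show ?thesis
        using j Suc.prems(2,3)
      proof (induction "j - r" arbitrary: j \<sigma>)
        case 0
        then have "\<sigma> i = i" if "i < Suc r" for i using that by (auto simp: less_Suc_eq)
        then show ?case using IH[OF r(2), of \<sigma>] 0 r by simp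
      next
        case (Suc n)
        then obtain j' where j': "j = Suc j'" "r \<le> j'" by (cases j) auto
        have "ext_deriv A k \<omega> (\<lambda>i. B ((\<sigma> \<circ> adj_swap j') i)) x = 0"
          using Suc.prems Suc.hyps(2) j' by (intro Suc.hyps(1)[of j']) (auto simp: adj_swap_le adj_swap_def)
        moreover have "(\<lambda>i. B ((\<sigma> \<circ> adj_swap j') i)) = (\<lambda>i. B (\<sigma> i)) \<circ> adj_swap j'" by auto
        ultimately show ?case using ext_deriv_adj_swap[of "\<lambda>i. B (\<sigma> i)" j'] Suc.prems B j' by simp
      qed
    next
      case False
      have "\<not> inj_on \<sigma> {..k}"
      proof
        assume "inj_on \<sigma> {..k}"
        moreover have "\<sigma> ` {..k} \<subseteq> {..k}" using Suc.prems(2) by auto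
        ultimately have "\<sigma> ` {..k} = {..k}" by (simp add: endo_inj_surj)
        then obtain j where "j \<le> k" "\<sigma> j = r" using r by (metis atMost_iff imageE)
        then show False using False Suc.prems(3)[of j] by (metis linorder_not_less order_less_irrefl)
      qed
      then obtain i j where ij: "i \<le> k" "j \<le> k" "i \<noteq> j" "\<sigma> i = \<sigma> j" unfolding inj_on_def by auto
      then show ?thesis
        using ext_deriv_repeated[of "\<lambda>i. B (\<sigma> i)" "min i j" "max i j"] B Suc.prems(2)
        by (cases "i < j") auto
    qed
  qed
  from this[of 0 \<sigma>] \<sigma> show ?thesis by simp
qed

end

end

end

section \<open>The form \<open>\<kappa> \<and> \<chi>\<close>\<close>

lemma ndet_zero_row: "r < n \<Longrightarrow> (\<And>j. j < n \<Longrightarrow> M r j = 0) \<Longrightarrow> ndet n M = 0"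
proof -
  assume r: "r < n" and z: "\<And>j. j < n \<Longrightarrow> M r j = 0"
  have "ndet n M = ndet n (\<lambda>i j. if i = r then 0 * M i j else M i j)"
    using z by (intro ndet_cong) auto
  then show ?thesis using ndet_scale_row[OF r, of 0 M] by simp
qed

lemma ndet_adj_swap: "Suc m < n \<Longrightarrow> ndet n (\<lambda>i. M (adj_swap m i)) = - ndet n M"
proof -
  assume m: "Suc m < n"
  have "mat n n (\<lambda>(i, j). M (adj_swap m i) j) = swaprows m (Suc m) (mat n n (\<lambda>(i, j). M i j))"
    using m by (intro eq_matI) (auto simp: adj_swap_def)
  then show ?thesis using det_swaprows[of m n "Suc m" "mat n n (\<lambda>(i, j). M i j)"] m by simp
qed

lemma ndet_first_row:
  "ndet (Suc m) (case_nat \<alpha> M) = (\<Sum>j<Suc m. \<alpha> j * ((-1) ^ j * ndet m (\<lambda>i l. M i (if l < j then l else Suc l))))"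
proof -
  let ?A = "mat (Suc m) (Suc m) (\<lambda>(i, j). case_nat \<alpha> M i j)"
  have "Determinant.det ?A = (\<Sum>j<Suc m. ?A $$ (0, j) * cofactor ?A 0 j)"
    by (rule laplace_expansion_row) auto
  also have "\<dots> = (\<Sum>j<Suc m. \<alpha> j * ((-1) ^ j * ndet m (\<lambda>i l. M i (if l < j then l else Suc l))))"
  proof (rule sum.cong[OF refl])
    fix j assume "j \<in> {..<Suc m}"
    moreover have "mat_delete ?A 0 j = mat m m (\<lambda>(i, l). M i (if l < j then l else Suc l))"
      by (rule eq_matI) (auto simp: mat_delete_def)
    ultimately show "?A $$ (0, j) * cofactor ?A 0 j
        = \<alpha> j * ((-1) ^ j * ndet m (\<lambda>i l. M i (if l < j then l else Suc l)))"
      by (simp add: cofactor_def)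
  qed
  finally show ?thesis .
qed

context foliated_manifold
begin

lemma frame_near_vertical:
  "vertical_orthonormal p x (\<lambda>i. frame_near A F g p x i x)"
  by (rule frame_near_adapted[of x]) (auto simp: adapted_frame_iff dest: vertical_frameD(2))

lemma kappa_alternating: "alternating_form 1 (\<lambda>y e. kappa y (e 0))"
  unfolding alternating_form_def by (auto simp: kappa_lincomb kappa_smooth)

lemma chi_smooth:
  assumes U: "open U" and E: "\<And>i. i < p \<Longrightarrow> vf U (E i)"
  shows "smooth U (\<lambda>y. chi y (\<lambda>l. E l y))"
proof (rule smooth_local[OF U])
  fix x assume x: "x \<in> U"
  obtain U0 s U' V X where U': "open U'" "x \<in> U'" "U' \<subseteq> U" and V: "adapted_frame_on A F g p U' V"
    by (rule adapted_frame_exists[OF U x]) blast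
  have E': "vf U' (E i)" if "i < p" for i using E[OF that] U' vf_subset by blast
  have Vv: "vf U' (V i)" if "i < p" for i using V vertical_frameD(1) that unfolding adapted_frame_iff by blast
  have "smooth U' (\<lambda>y. ndet p (\<lambda>i j. g y (E i y) (V j y)))"
    by (intro smooth_det U' g_smooth E' Vv)
  then have "smooth U' (\<lambda>y. chi y (\<lambda>l. E l y))"
    by (rule smooth_cong[OF U'(1), rotated]) (simp add: characteristic_form_eq[OF V] vf_tangent[OF E'])
  then show "\<exists>U'. open U' \<and> x \<in> U' \<and> smooth U' (\<lambda>y. chi y (\<lambda>l. E l y))" using U' by blast
qed

text \<open>Everything is read off from the determinant in the frame chosen at the point.\<close>

lemma chi_alternating: "alternating_form p chi"
proof -
  obtain p' where p': "p = Suc p'" using p_pos by (cases p) auto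
  have chi: "chi x e = ndet p (\<lambda>i j. g x (e i) (frame_near A F g p x j x))" for x e
    unfolding characteristic_form_def Let_def ..
  have "chi x (e \<circ> adj_swap m) = - chi x e" if "Suc m < p" for x e m
    unfolding chi using ndet_adj_swap[OF that, of "\<lambda>i j. g x (e i) (frame_near A F g p x j x)"] by simp
  moreover have "chi x (case_nat (\<lambda>f. a * u f + b * v f) e) = a * chi x (case_nat u e) + b * chi x (case_nat v e)"
    if uv: "u \<in> T x" "v \<in> T x" for x e u v a b
  proof -
    let ?w = "\<lambda>j. frame_near A F g p x j x"
    have c: "(\<lambda>i j. g x (case_nat z e i) (?w j)) = case_nat (\<lambda>j. g x z (?w j)) (\<lambda>i j. g x (e i) (?w j))" for z
      by (auto simp: fun_eq_iff split: nat.splits)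
    have "g x (\<lambda>f. a * u f + b * v f) (?w j) = a * g x u (?w j) + b * g x v (?w j)" if "j < Suc p'" for j
      using g_lincomb uv vertical_orthonormalD(2)[OF frame_near_vertical] that p' by blast
    then show ?thesis
      unfolding chi c unfolding p' ndet_first_row
      by (simp add: sum_distrib_left sum.distrib[symmetric] algebra_simps del: sum.lessThan_Suc)
  qed
  moreover have "chi x e = chi x e'" if "\<forall>i<p. e i = e' i" for x e e'
    unfolding chi using that by (intro ndet_cong) simp
  ultimately show ?thesis unfolding alternating_form_def using chi_smooth by blast
qed

abbreviation omega :: "'m form" where
  "omega \<equiv> wedge1 p kappa chi"

text \<open>The wedge product is an alternating sum over the omitted entry, just as the exterior derivative.\<close>

lemma omega_alternating: "alternating_form (p + 1) omega"
  unfolding alternating_form_def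
proof (intro conjI allI impI)
  show "omega x e = omega x e'" if eq: "\<forall>i<p + 1. e i = e' i" for x e e'
  proof -
    have "chi x (omit i e) = chi x (omit i e')" if "i \<le> p" for i
    proof (rule form_cong[OF chi_alternating])
      fix l assume "l < p"
      then show "omit i e l = omit i e' l" using eq by (simp add: omit_def)
    qed
    then show ?thesis unfolding wedge1_def using eq by (intro sum.cong) auto
  qed
  show "omega x (e \<circ> adj_swap m) = - omega x e" if h: "Suc m < p + 1 \<and> (\<forall>i<p + 1. e i \<in> T x)" for x e m
  proof -
    have "kappa x (e i) * chi x (omit i e \<circ> adj_swap l) = - (kappa x (e i) * chi x (omit i e))"
      if "i \<le> p" "Suc l < p" for i l
    proof -
      have "omit i e j \<in> T x" if "j < p" for j using h that by (simp add: omit_def)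
      then show ?thesis using form_adj_swap[OF chi_alternating that(2), of "omit i e" x] by simp
    qed
    then show ?thesis
      using alternating_sum_adj_swap[where \<Phi> = "\<lambda>u e'. kappa x u * chi x e'" and e = e and k = p and m = m] h
      unfolding wedge1_def by (simp add: mult.assoc)
  qed
  show "omega x (case_nat (\<lambda>f. a * u f + b * v f) e) = a * omega x (case_nat u e) + b * omega x (case_nat v e)"
    if h: "(\<forall>i. Suc i < p + 1 \<longrightarrow> e i \<in> T x) \<and> u \<in> T x \<and> v \<in> T x" for x e u v a b
  proof -
    have eq: "omega x (case_nat z e) = kappa x z * chi x e
      - (\<Sum>i<p. (-1) ^ i * kappa x (e i) * chi x (case_nat z (omit i e)))" for z
      unfolding wedge1_def sum.atMost_shift by (simp add: omit_case_nat sum_negf)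
    have "chi x (case_nat (\<lambda>f. a * u f + b * v f) (omit i e))
      = a * chi x (case_nat u (omit i e)) + b * chi x (case_nat v (omit i e))" if "i < p" for i
    proof (rule form_lincomb[OF chi_alternating])
      show "omit i e l \<in> T x" if "Suc l < p" for l using h that by (simp add: omit_def)
    qed (use h in auto)
    then show ?thesis
      unfolding eq using kappa_lincomb[of u x v a b] h
      by (simp add: sum_distrib_left sum.distrib[symmetric] sum_subtractf[symmetric] algebra_simps)
  qed
  show "smooth U (\<lambda>y. omega y (\<lambda>l. E l y))" if h: "open U \<and> (\<forall>i<p + 1. vf U (E i))" for U E
  proof -
    have "smooth U (\<lambda>y. chi y (\<lambda>l. omit i E l y))" if "i \<le> p" for i
      using h that by (intro chi_smooth) (auto simp: omit_def)
    moreover have "omit i (\<lambda>l. E l y) = (\<lambda>l. omit i E l y)" for i y by (auto simp: omit_def)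
    ultimately show ?thesis
      unfolding wedge1_def using h
      by (auto intro!: smooth_sum smooth_mult smooth_const kappa_smooth)
  qed
qed

subsection \<open>Values on vertical and horizontal vectors\<close>

context
  fixes U V y
  assumes V: "adapted_frame_on A F g p U V" and y: "y \<in> U"
begin

lemma frame_orthonormal: "vertical_orthonormal p y (\<lambda>i. V i y)"
  using V y vertical_frameD(2) unfolding adapted_frame_iff by blast

lemmas frame_facts = vertical_orthonormalD[OF frame_orthonormal]

lemma chi_horizontal:
  assumes e: "\<And>i. i < p \<Longrightarrow> e i \<in> T y" and r: "r < p" "e r \<in> hor_sp y"
  shows "chi y e = 0"
proof -
  have "chi y e = ndet p (\<lambda>i j. g y (e i) (V j y))" using e by (rule characteristic_form_eq[OF V y])
  also have "\<dots> = 0"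
    using r hor_vert_orthogonal frame_facts(1) by (intro ndet_zero_row[of r]) auto
  finally show ?thesis .
qed

lemma chi_frame: "chi y (\<lambda>l. V l y) = 1"
proof -
  have "chi y (\<lambda>l. V l y) = ndet p (\<lambda>i j. g y (V i y) (V j y))"
    using frame_facts(2) by (rule characteristic_form_eq[OF V y])
  also have "\<dots> = ndet p (\<lambda>i j. if i = j then 1 else 0)" using frame_facts(3) by (intro ndet_cong) auto
  finally show ?thesis by (simp add: ndet_id)
qed

text \<open>Expand along the row of \<open>v\<close>: the minor without column \<open>i\<close> is the identity matrix, the others have a zero row.\<close>

lemma chi_frame_replace:
  assumes v: "v \<in> T y" and i: "i < p"
  shows "chi y (case_nat v (\<lambda>l. omit i V l y)) = (-1) ^ i * g y v (V i y)"
proof -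
  obtain p' where p': "p = Suc p'" using p_pos by (cases p) auto
  let ?skip = "\<lambda>j l :: nat. if l < j then l else Suc l"
  have om: "omit i V r y = V (?skip i r) y" for r by (simp add: omit_def)
  have T: "(case_nat v (\<lambda>l. omit i V l y)) r \<in> T y" if "r < p" for r
    using that v frame_facts(2) by (auto simp: omit_def split: nat.splits)
  have c: "(\<lambda>r j. g y (case_nat v (\<lambda>l. omit i V l y) r) (V j y))
      = case_nat (\<lambda>j. g y v (V j y)) (\<lambda>r j. g y (omit i V r y) (V j y))"
    by (auto simp: fun_eq_iff split: nat.splits)
  have minor: "ndet p' (\<lambda>r l. g y (omit i V r y) (V (?skip j l) y)) = (if j = i then 1 else 0)" if j: "j < p" for j
  proof -
    have e: "g y (omit i V r y) (V (?skip j l) y) = (if ?skip i r = ?skip j l then 1 else 0)"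
      if "r < p'" "l < p'" for r l
      unfolding om using that p' by (intro frame_facts(3)) auto
    show ?thesis
    proof (cases "j = i")
      case True
      have "ndet p' (\<lambda>r l. g y (omit i V r y) (V (?skip j l) y)) = ndet p' (\<lambda>r l. if r = l then 1 else 0)"
        using e True by (intro ndet_cong) (auto split: if_splits)
      then show ?thesis using True by (simp add: ndet_id)
    next
      case False
      \<comment> \<open>The row of the frame vector \<open>V j\<close> is zero, since its own column has been deleted.\<close>
      define r where "r = (if j < i then j else j - 1)"
      have r: "r < p'" "?skip i r = j" using False j i p' by (auto simp: r_def)
      have "ndet p' (\<lambda>r l. g y (omit i V r y) (V (?skip j l) y)) = 0"
        using e[OF r(1)] r by (intro ndet_zero_row[OF r(1)]) auto
      then show ?thesis using False by simp
    qed
  qed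
  have "chi y (case_nat v (\<lambda>l. omit i V l y)) = ndet p (\<lambda>r j. g y (case_nat v (\<lambda>l. omit i V l y) r) (V j y))"
    using T by (rule characteristic_form_eq[OF V y])
  also have "\<dots> = ndet p (case_nat (\<lambda>j. g y v (V j y)) (\<lambda>r j. g y (omit i V r y) (V j y)))"
    unfolding c ..
  also have "\<dots> = (\<Sum>j<Suc p'. if j = i then (-1) ^ i * g y v (V i y) else 0)"
    unfolding p' ndet_first_row by (rule sum.cong[OF refl]) (use minor p' in auto)
  also have "\<dots> = (-1) ^ i * g y v (V i y)" using i p' by simp
  finally show ?thesis .
qed

text \<open>The horizontal entries compete for the single slot of \<open>\<kappa>\<close>, since \<open>\<chi>\<close> annihilates them.\<close>

lemma omega_two_horizontal:
  assumes e: "\<And>i. i \<le> p \<Longrightarrow> e i \<in> T y" and r: "r \<le> p" "r' \<le> p" "r \<noteq> r'" "e r \<in> hor_sp y" "e r' \<in> hor_sp y"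
    and vert: "\<And>i. i \<le> p \<Longrightarrow> i \<noteq> r \<Longrightarrow> i \<noteq> r' \<Longrightarrow> e i \<in> vert_sp y"
  shows "omega y e = 0"
proof -
  have "chi y (omit a e) = 0" if "a \<le> p" "b \<le> p" "a \<noteq> b" "e b \<in> hor_sp y" for a b
  proof (rule chi_horizontal)
    show "omit a e i \<in> T y" if "i < p" for i using e that by (simp add: omit_def)
    show "(if b < a then b else b - 1) < p" using that by auto
    show "omit a e (if b < a then b else b - 1) \<in> hor_sp y" using that by (auto simp: omit_def)
  qed
  then have "kappa y (e i) * chi y (omit i e) = 0" if "i \<le> p" for i
    using r that kappa_vert[OF vert[OF that]] by (cases "i = r \<or> i = r'") auto
  then show ?thesis unfolding wedge1_def by (intro sum.neutral) (auto simp: mult.assoc)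
qed

lemma omega_frame:
  assumes z: "z \<in> T y"
  shows "omega y (case_nat z (\<lambda>l. V l y)) = kappa y z"
  unfolding wedge1_def sum.atMost_shift
  by (simp add: omit_case_nat chi_frame kappa_vert[OF frame_facts(1)])

lemma omega_frame_replace:
  assumes v: "v \<in> vert_sp y" and h: "h \<in> hor_sp y" and i: "i < p"
  shows "omega y (case_nat v (case_nat h (\<lambda>l. omit i V l y))) = - ((-1) ^ i * kappa y h * g y v (V i y))"
proof -
  obtain p' where p': "p = Suc p'" using p_pos by (cases p) auto
  have "kappa y (omit i V l y) = 0" if "l < p'" for l
    using that p' kappa_vert[OF frame_facts(1)] by (simp add: omit_def)
  moreover have "(\<Sum>l<p. f l) = f 0 + (\<Sum>l<p'. f (Suc l))" for f :: "nat \<Rightarrow> real"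
    unfolding p' by (rule sum.lessThan_Suc_shift)
  ultimately have "omega y (case_nat v (case_nat h (\<lambda>l. omit i V l y)))
      = - (kappa y h * chi y (case_nat v (\<lambda>l. omit i V l y)))"
    unfolding wedge1_def sum.atMost_shift
    by (simp add: kappa_vert[OF v] omit_case_nat)
  then show ?thesis unfolding chi_frame_replace[OF vert_tangent[OF v] i] by simp
qed

end

text \<open>Integrability of the vertical distribution: vertical fields annihilate the components of \<open>s\<close>.\<close>

lemma vertical_bracket:
  assumes U: "open U" "x \<in> U" and V: "vf U V" "vf U W"
    and vert: "\<And>y. y \<in> U \<Longrightarrow> V y \<in> vert_sp y" "\<And>y. y \<in> U \<Longrightarrow> W y \<in> vert_sp y"
  shows "lie_bracket A V W x \<in> vert_sp x"
proof -
  obtain U' s where s: "(U', s) \<in> F" "x \<in> U'" using submersion_exists .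
  have "lie_bracket A V W x (\<lambda>y. vec_nth (s y) j) = 0" for j
  proof -
    let ?s = "\<lambda>y. vec_nth (s y) j"
    have near: "smooth_near A x ?s"
      using smooth_nearI[OF submersion_open[OF s(1)] s(2) submersion_component[OF s(1)]] .
    have z: "P x (\<lambda>y. Q y ?s) = 0" if P: "vf U P" and Q: "\<And>y. y \<in> U \<Longrightarrow> Q y \<in> vert_sp y" for P Q
    proof -
      have PT: "P x \<in> T x" using vf_tangent[OF P U(2)] .
      have "P x (\<lambda>y. Q y ?s) = P x (\<lambda>y. 0)"
      proof (rule tangent_cong[OF PT, of "U \<inter> U'"])
        fix y assume "y \<in> U \<inter> U'"
        then have "differential s (Q y) = 0" using Q vert_space_iff[OF s(1)] by blast
        then show "Q y ?s = 0" unfolding differential_def by (simp add: Finite_Cartesian_Product.vec_eq_iff)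
      qed (use U s submersion_open in auto)
      then show ?thesis using tangent_const[OF PT] by simp
    qed
    show ?thesis using near z[OF V(1) vert(2)] z[OF V(2) vert(1)] by (simp add: bracket_eq)
  qed
  then have "differential s (lie_bracket A V W x) = 0"
    unfolding differential_def by (simp add: Finite_Cartesian_Product.vec_eq_iff)
  then show ?thesis
    using vert_space_iff[OF s] vf_tangent[OF bracket_vf[OF U(1) V] U(2)] by blast
qed

text \<open>In the exterior derivative on \<open>X, Y, V\<^sub>0, \<dots>\<close> only the summands in which a single horizontal entry is
  left survive: those of \<open>d\<kappa>(X, Y)\<close> and, from the brackets of \<open>X\<close> and \<open>Y\<close> with the frame,
  \<open>\<kappa>(X) \<kappa>(Y)\<close> twice with opposite signs.\<close>

lemma ext_deriv_omega_basic:
  assumes U: "open U" "x \<in> U" and V: "adapted_frame_on A F g p U V"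
    and X: "basic_field_on A F g U X" and Y: "basic_field_on A F g U Y"
  shows "ext_deriv A (p + 1) omega (case_nat X (case_nat Y V)) x = dkappa X Y x"
proof -
  have XY: "vf U X" "vf U Y" and XYh: "\<And>y. y \<in> U \<Longrightarrow> X y \<in> hor_sp y" "\<And>y. y \<in> U \<Longrightarrow> Y y \<in> hor_sp y"
    using X Y basic_field_horizontal unfolding horizontal_field_iff by blast+
  have Vf: "vertical_frame p U V" using V unfolding adapted_frame_iff by blast
  note Vv = vertical_frameD(1)[OF Vf]
  note vv = vertical_orthonormalD(1)[OF vertical_frameD(2)[OF Vf]]
  have XT: "X x \<in> T x" and YT: "Y x \<in> T x" using vf_tangent XY U by blast+
  have c: "(\<lambda>l. case_nat P Q l y) = case_nat (P y) (\<lambda>l. Q l y)" for P :: "'m vfield" and Q y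
    by (auto simp: fun_eq_iff split: nat.splits)
  have br: "lie_bracket A Z (V i) x \<in> vert_sp x" if "basic_field_on A F g U Z" "i < p" for Z i
    using basic_bracket_vertical[OF U(1) that(1) Vv[OF that(2)] vv[OF _ that(2)] U(2)] .
  have om: "omit i V l y \<in> vert_sp y" if "y \<in> U" "i < p" "Suc l < p" for i l y
    using that vv by (simp add: omit_def)
  have t1: "P x (\<lambda>y. omega y (case_nat (Z y) (\<lambda>l. V l y))) = P x (\<lambda>y. kappa y (Z y))"
    if "vf U P" "vf U Z" for P Z
    using that by (intro tangent_cong[OF vf_tangent[OF that(1) U(2)] U] omega_frame[OF V] vf_tangent)
  have t2: "V i x (\<lambda>y. omega y (case_nat (X y) (case_nat (Y y) (\<lambda>l. omit i V l y)))) = 0" if i: "i < p" for i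
  proof -
    have VT: "V i x \<in> T x" using vf_tangent[OF Vv[OF i] U(2)] .
    have "V i x (\<lambda>y. omega y (case_nat (X y) (case_nat (Y y) (\<lambda>l. omit i V l y)))) = V i x (\<lambda>y. 0)"
    proof (rule tangent_cong[OF VT U])
      fix y assume y: "y \<in> U"
      let ?e = "case_nat (X y) (case_nat (Y y) (\<lambda>l. omit i V l y))"
      have vert: "?e l \<in> vert_sp y" if "l \<le> p" "l \<noteq> 0" "l \<noteq> 1" for l
        using that om[OF y i] by (auto split: nat.splits)
      then have "?e l \<in> T y" if "l \<le> p" for l
        using that XYh[OF y] hor_tangent vert_tangent by (cases "l = 0 \<or> l = 1") auto
      then show "omega y ?e = 0"
        using omega_two_horizontal[OF V y, of ?e 0 1] XYh[OF y] vert p_pos by simp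
    qed
    then show ?thesis using tangent_const[OF VT] by simp
  qed
  have t3: "omega x (case_nat (lie_bracket A (V i) (V j) x) (case_nat (X x) (case_nat (Y x) (\<lambda>l. omit i (omit j V) l x)))) = 0"
    if ij: "i < j" "j < p" for i j
  proof -
    let ?e = "case_nat (lie_bracket A (V i) (V j) x) (case_nat (X x) (case_nat (Y x) (\<lambda>l. omit i (omit j V) l x)))"
    have b: "lie_bracket A (V i) (V j) x \<in> vert_sp x"
      using ij by (intro vertical_bracket[OF U Vv Vv vv vv]) auto
    have vert: "?e l \<in> vert_sp x" if "l \<le> p" "l \<noteq> 1" "l \<noteq> 2" for l
      using that b vv[OF U(2)] ij by (auto simp: omit_def numeral_2_eq_2 split: nat.splits)
    then have "?e l \<in> T x" if "l \<le> p" for l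
      using that XT YT vert_tangent by (cases "l = 1 \<or> l = 2") (auto simp: numeral_2_eq_2)
    then show ?thesis
      using omega_two_horizontal[OF V U(2), of ?e 1 2] XYh[OF U(2)] vert ij by (simp add: numeral_2_eq_2)
  qed
  have B: "lie_bracket A X Y x \<in> T x" using vf_tangent[OF bracket_vf[OF U(1) XY] U(2)] .
  have trX: "(\<Sum>i<p. g x (lie_bracket A X (V i) x) (V i x)) = kappa x (X x)"
    and trY: "(\<Sum>i<p. g x (lie_bracket A Y (V i) x) (V i x)) = kappa x (Y x)"
    using kappa_basic_trace[OF U Vf basic_field_horizontal[OF X]]
      kappa_basic_trace[OF U Vf basic_field_horizontal[OF Y]] by simp_all
  have s1: "(\<Sum>i<p + 1. (-1) ^ i * (case_nat Y V i x (\<lambda>y. omega y (case_nat (X y) (\<lambda>l. omit i (case_nat Y V) l y)))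
        + omega x (case_nat (lie_bracket A X (case_nat Y V i) x) (\<lambda>l. omit i (case_nat Y V) l x))))
    = Y x (\<lambda>y. kappa y (X y)) + kappa x (lie_bracket A X Y x) + kappa x (Y x) * kappa x (X x)"
  proof -
    have "(\<Sum>i<p. (-1) ^ Suc i * (V i x (\<lambda>y. omega y (case_nat (X y) (case_nat (Y y) (\<lambda>l. omit i V l y))))
        + omega x (case_nat (lie_bracket A X (V i) x) (case_nat (Y x) (\<lambda>l. omit i V l x)))))
      = (\<Sum>i<p. kappa x (Y x) * g x (lie_bracket A X (V i) x) (V i x))"
      using t2 omega_frame_replace[OF V U(2) br[OF X] XYh(2)[OF U(2)]]
      by (intro sum.cong) (simp_all add: power_mult_distrib[symmetric] mult.assoc[symmetric])
    then show ?thesis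
      using t1[OF XY(2,1)] omega_frame[OF V U(2) B] trX
      by (simp add: sum.lessThan_Suc_shift omit_case_nat c sum_distrib_left[symmetric] del: sum.lessThan_Suc)
  qed
  have s2: "(\<Sum>j<p + 1. \<Sum>i<j. (-1) ^ (i + j) * omega x (case_nat (lie_bracket A (case_nat Y V i) (case_nat Y V j) x)
        (case_nat (X x) (\<lambda>l. omit i (omit j (case_nat Y V)) l x)))) = kappa x (X x) * kappa x (Y x)"
  proof -
    have "(\<Sum>j<p. (-1) ^ Suc j * omega x (case_nat (lie_bracket A Y (V j) x) (case_nat (X x) (\<lambda>l. omit j V l x))))
      = (\<Sum>j<p. kappa x (X x) * g x (lie_bracket A Y (V j) x) (V j x))"
      using omega_frame_replace[OF V U(2) br[OF Y] XYh(1)[OF U(2)]]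
      by (intro sum.cong) (simp_all add: power_mult_distrib[symmetric] mult.assoc[symmetric])
    then show ?thesis
      using t3 trY
      by (simp add: sum.lessThan_Suc_shift omit_case_nat c sum_distrib_left[symmetric] del: sum.lessThan_Suc)
  qed
  show ?thesis
    unfolding ext_deriv_case_nat[OF omega_alternating U] s1 s2 dkappa_eq
    using t1[OF XY] by (simp add: c)
qed

section \<open>Closedness of \<open>\<kappa> \<and> \<chi>\<close>\<close>

definition basic_brackets_divergence_free :: bool where
  "basic_brackets_divergence_free \<longleftrightarrow>
    (\<forall>U X Y. open U \<and> basic_field_on A F g U X \<and> basic_field_on A F g U Y
      \<longrightarrow> (\<forall>x\<in>U. leaf_div A F g D p (vert A F g (lie_bracket A X Y)) x = 0))"

lemma closed_imp_divergence_free: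
  assumes "closed_form A (p + 1) omega"
  shows basic_brackets_divergence_free
  unfolding basic_brackets_divergence_free_def
proof (intro allI impI ballI)
  fix U X Y x assume h: "open U \<and> basic_field_on A F g U X \<and> basic_field_on A F g U Y" and x: "x \<in> U"
  obtain U0 s U' V L where U': "open U'" "x \<in> U'" "U' \<subseteq> U" and V: "adapted_frame_on A F g p U' V"
    using h by (elim conjE) (rule adapted_frame_exists[OF _ x], auto)
  have XY: "basic_field_on A F g U' X" "basic_field_on A F g U' Y" using h U' basic_field_subset by blast+
  have "vf U' (case_nat X (case_nat Y V) i)" if "i \<le> p + 1" for i
    using that XY basic_field_horizontal horizontal_field_iff V vertical_frameD(1) unfolding adapted_frame_iff
    by (auto split: nat.splits)
  then have "ext_deriv A (p + 1) omega (case_nat X (case_nat Y V)) x = 0"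
    using assms U' unfolding closed_form_def by blast
  then show "leaf_div A F g D p (vert A F g (lie_bracket A X Y)) x = 0"
    using ext_deriv_omega_basic[OF U'(1,2) V XY] dkappa_basic[OF U'(1,2) XY] by simp
qed

text \<open>The difference of the two sides is horizontal, and vertical as well, since \<open>differential s\<close> annihilates it.\<close>

lemma horizontal_expansion:
  assumes s: "(U0, s) \<in> F" "U \<subseteq> U0" and X: "horizontal_lifts s U X" and y: "y \<in> U" and u: "u \<in> hor_sp y"
  shows "u = (\<lambda>f. \<Sum>a<CARD('q). vec_nth (differential s u) (coord_index a) * X (coord_index a) y f)"
proof -
  have Xa: "X a y \<in> hor_sp y" "differential s (X a y) = axis a 1" for a
    using X y unfolding horizontal_lifts_def lifts_def by auto
  define w where "w = (\<lambda>f. \<Sum>a\<in>UNIV. vec_nth (differential s u) a * X a y f)"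
  have w: "w \<in> hor_sp y" unfolding w_def by (intro hor_lincomb_sum Xa)
  have "differential s w = (\<Sum>a\<in>UNIV. vec_nth (differential s u) a *\<^sub>R axis a 1)"
    unfolding w_def differential_lincomb by (simp add: Xa)
  also have "\<dots> = differential s u"
    using basis_expansion[of "differential s u"] by (simp add: scalar_mult_eq_scaleR)
  finally have "differential s (\<lambda>f. u f - w f) = 0" by (simp add: differential_minus)
  moreover have d: "(\<lambda>f. u f - w f) \<in> hor_sp y" using hor_minus[OF u w] .
  ultimately have "(\<lambda>f. u f - w f) \<in> vert_sp y"
    using vert_space_iff[OF s(1)] hor_tangent[OF d] s(2) y by blast
  then have "(\<lambda>f. u f - w f) = (\<lambda>f. 0)" using vert_hor_zero d by blast
  then have "u = w" by (simp add: fun_eq_iff)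
  then show ?thesis
    unfolding w_def using sum_coord_index[of "\<lambda>a. vec_nth (differential s u) a * X a y _"] by simp
qed

text \<open>Basic fields are horizontal, which gives one direction.  For the other, expand horizontal fields in lifts,
  which are basic, and use that the exterior derivative is linear over functions.\<close>

lemma divergence_free_iff:
  "basic_brackets_divergence_free \<longleftrightarrow> horizontally_closed A F g kappa"
proof
  assume h: "horizontally_closed A F g kappa"
  show basic_brackets_divergence_free
    unfolding basic_brackets_divergence_free_def
  proof (intro allI impI ballI)
    fix U X Y x assume b: "open U \<and> basic_field_on A F g U X \<and> basic_field_on A F g U Y" and x: "x \<in> U"
    then have "dkappa X Y x = 0"
      using h basic_field_horizontal unfolding horizontally_closed_def by blast
    then show "leaf_div A F g D p (vert A F g (lie_bracket A X Y)) x = 0"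
      using dkappa_basic[of U x X Y] b x by simp
  qed
next
  assume b: basic_brackets_divergence_free
  show "horizontally_closed A F g kappa"
    unfolding horizontally_closed_def
  proof (intro allI impI ballI)
    fix U Z1 Z2 x
    assume h: "open U \<and> horizontal_field_on A F g U Z1 \<and> horizontal_field_on A F g U Z2" and x: "x \<in> U"
    obtain U0 s U' V X where s: "(U0, s) \<in> F" and U': "open U'" "x \<in> U'" "U' \<subseteq> U0" "U' \<subseteq> U"
      and X: "horizontal_lifts s U' X"
      using h by (elim conjE) (rule adapted_frame_exists[OF _ x], auto)
    define E where "E i = (if i = (0::nat) then Z1 else Z2)" for i
    define B where "B a = X (coord_index a)" for a
    have Bb: "basic_field_on A F g U' (B a)" for a
      unfolding B_def using horizontal_lifts_basic[OF s U'(1,3) X] .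
    have Bv: "vf U' (B a)" for a using basic_field_horizontal[OF Bb] unfolding horizontal_field_iff by blast
    have E: "vf U' (E i)" "y \<in> U' \<Longrightarrow> E i y \<in> hor_sp y" for i y
      using h U'(4) vf_subset unfolding horizontal_field_iff E_def by auto
    have "ext_deriv A 1 (\<lambda>y e. kappa y (e 0)) E x = 0"
    proof (rule ext_deriv_vanishes_on_frame[OF kappa_alternating U'(1,2), where N = "CARD('q)" and B = B
          and h = "\<lambda>i a y. vec_nth (differential s (E i y)) (coord_index a)"])
      show "E i y = (\<lambda>f. \<Sum>a<CARD('q). vec_nth (differential s (E i y)) (coord_index a) * B a y f)"
        if "y \<in> U'" for i y
        unfolding B_def by (rule horizontal_expansion[OF s U'(3) X that E(2)[OF that]])
      fix \<sigma> :: "nat \<Rightarrow> nat"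
      have "leaf_div A F g D p (vert A F g (lie_bracket A (B (\<sigma> 0)) (B (\<sigma> 1)))) x = 0"
        using b Bb U'(1,2) unfolding basic_brackets_divergence_free_def by blast
      then have "dkappa (B (\<sigma> 0)) (B (\<sigma> 1)) x = 0"
        using dkappa_basic[OF U'(1,2) Bb[of "\<sigma> 0"] Bb[of "\<sigma> 1"]] by simp
      moreover have "dkappa (B (\<sigma> 0)) (B (\<sigma> 1)) x = ext_deriv A 1 (\<lambda>y e. kappa y (e 0)) (\<lambda>i. B (\<sigma> i)) x"
        by (rule ext_deriv_cong[OF kappa_alternating U'(1,2)]) (auto simp: Bv le_Suc_eq)
      ultimately show "ext_deriv A 1 (\<lambda>y e. kappa y (e 0)) (\<lambda>i. B (\<sigma> i)) x = 0" by simp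
    qed (use Bv differential_smooth[OF s U'(1,3) E(1)] in auto)
    then show "dkappa Z1 Z2 x = 0" unfolding E_def[abs_def] .
  qed
qed

text \<open>The \<open>p + 2\<close> arguments expand in a frame of as many members: two lifts and the vertical frame.  By reordering, only
  the value on the frame itself matters, and this is \<open>d\<kappa>\<close> on the two lifts.\<close>

lemma horizontally_closed_imp_closed:
  assumes q: "CARD('q) = 2" and h: "horizontally_closed A F g kappa"
  shows "closed_form A (p + 1) omega"
  unfolding closed_form_def
proof (intro allI impI ballI)
  fix U E x assume E: "open U \<and> (\<forall>i\<le>p + 1. vf U (E i))" and x: "x \<in> U"
  obtain U0 s U' V X where s: "(U0, s) \<in> F" and U': "open U'" "x \<in> U'" "U' \<subseteq> U0" "U' \<subseteq> U"
    and V: "adapted_frame_on A F g p U' V" and X: "horizontal_lifts s U' X"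
    using E by (elim conjE) (rule adapted_frame_exists[OF _ x], auto)
  have Vf: "vertical_frame p U' V" using V unfolding adapted_frame_iff by blast
  have Xb: "basic_field_on A F g U' (X a)" for a using horizontal_lifts_basic[OF s U'(1,3) X] .
  have Xv: "vf U' (X a)" for a using basic_field_horizontal[OF Xb] unfolding horizontal_field_iff by blast
  have E': "vf U' (E i)" if "i \<le> p + 1" for i using E U' vf_subset that by blast
  define B where "B = case_nat (X (coord_index 0)) (case_nat (X (coord_index 1)) V)"
  define c where "c i = case_nat (\<lambda>y. vec_nth (differential s (E i y)) (coord_index 0))
    (case_nat (\<lambda>y. vec_nth (differential s (E i y)) (coord_index 1)) (\<lambda>l y. g y (E i y) (V l y)))" for i
  have Bv: "vf U' (B a)" if "a < p + 2" for a
    unfolding B_def using that Xv vertical_frameD(1)[OF Vf] by (auto split: nat.splits)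
  have "ext_deriv A (p + 1) omega B x = 0"
  proof -
    have "dkappa (X (coord_index 0)) (X (coord_index 1)) x = 0"
      using h Xb basic_field_horizontal U' unfolding horizontally_closed_def by blast
    moreover have "ext_deriv A (p + 1) omega B x = dkappa (X (coord_index 0)) (X (coord_index 1)) x"
      unfolding B_def by (rule ext_deriv_omega_basic[OF U'(1,2) V Xb Xb])
    ultimately show ?thesis by simp
  qed
  then have zero: "ext_deriv A (p + 1) omega (\<lambda>i. B (\<sigma> i)) x = 0" if "\<And>i. i \<le> p + 1 \<Longrightarrow> \<sigma> i < p + 2" for \<sigma>
    using ext_deriv_reordered[OF omega_alternating U'(1,2), of B \<sigma>] Bv that by fastforce
  show "ext_deriv A (p + 1) omega E x = 0"
  proof (rule ext_deriv_vanishes_on_frame[OF omega_alternating U'(1,2), where N = "p + 2" and B = B and h = c])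
    show "smooth U' (c i a)" if "i \<le> p + 1" "a < p + 2" for i a
      unfolding c_def
      using that differential_smooth[OF s U'(1,3) E'] g_smooth[OF U'(1) E' vertical_frameD(1)[OF Vf]]
      by (auto split: nat.splits)
    show "E i y = (\<lambda>f. \<Sum>a<p + 2. c i a y * B a y f)" if i: "i \<le> p + 1" and y: "y \<in> U'" for i y
    proof -
      have ET: "E i y \<in> T y" using vf_tangent[OF E'[OF i] y] .
      note vh = vert_hor_decomposition[OF vertical_frameD(2)[OF Vf y] ET]
      let ?u = "\<lambda>f. E i y f - (\<Sum>l<p. g y (E i y) (V l y) * V l y f)"
      have "differential s ?u = differential s (E i y)"
        using vert_space_iff[OF s] vh(1) y U'(3) by (auto simp: differential_minus)
      then have "?u = (\<lambda>f. \<Sum>a<CARD('q). vec_nth (differential s (E i y)) (coord_index a) * X (coord_index a) y f)"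
        using horizontal_expansion[OF s U'(3) X y vh(2)] by simp
      then have "E i y f = (\<Sum>a<CARD('q). vec_nth (differential s (E i y)) (coord_index a) * X (coord_index a) y f)
          + (\<Sum>l<p. g y (E i y) (V l y) * V l y f)" for f
        by (simp add: fun_eq_iff algebra_simps)
      then show ?thesis
        unfolding q by (simp add: fun_eq_iff B_def c_def numeral_2_eq_2 sum.lessThan_Suc_shift del: sum.lessThan_Suc)
    qed
  qed (use Bv zero in auto)
qed

end

theorem theorem1p2:
  fixes A :: "('m::{t2_space,second_countable_topology}, 'n::{finite,linorder}) chart set"
    and F :: "('m, 'q::{finite,linorder}) submersion set"
    and g :: "'m metric"
    and D :: "'m vfield \<Rightarrow> 'm vfield \<Rightarrow> 'm vfield"
    and p :: nat
  assumes manifold: "oriented_atlas A"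
    and closed: "compact (UNIV :: 'm set)"
    and conn: "connected (UNIV :: 'm set)"
    and dims: "CARD('n) = p + CARD('q)" "p \<ge> 1"
    and metric: "riemannian_metric A g"
    and connection: "levi_civita A g D"
    and foliation: "foliation A F"
    and transverse: "transversely_oriented F"
  defines "\<kappa> \<equiv> mean_curvature A F g D p"
    and "\<chi>F \<equiv> characteristic_form A F g p"
  defines "basic_brackets_div_free \<equiv>
      (\<forall>U X Y. open U \<and> basic_field_on A F g U X \<and> basic_field_on A F g U Y
         \<longrightarrow> (\<forall>x\<in>U. leaf_div A F g D p (vert A F g (lie_bracket A X Y)) x = 0))"
  shows "(closed_form A (p + 1) (wedge1 p \<kappa> \<chi>F) \<longrightarrow> basic_brackets_div_free)
     \<and> (basic_brackets_div_free \<longleftrightarrow> horizontally_closed A F g \<kappa>)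
     \<and> (CARD('q) = 2 \<longrightarrow>
          (horizontally_closed A F g \<kappa> \<longleftrightarrow> closed_form A (p + 1) (wedge1 p \<kappa> \<chi>F)))"
proof -
  interpret foliated_manifold A g D F p
    using assms unfolding oriented_atlas_def by unfold_locales (auto simp: oriented_atlas_def)
  have b: "basic_brackets_div_free \<longleftrightarrow> basic_brackets_divergence_free"
    unfolding basic_brackets_div_free_def basic_brackets_divergence_free_def ..
  show ?thesis
    unfolding b \<kappa>_def \<chi>F_def
    using closed_imp_divergence_free divergence_free_iff horizontally_closed_imp_closed by blast
qed

end
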